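(* Locally anti-blocking bodies satisfy Godbersen's conjecture. That is, for any locally anti-blocking convex body $K\subseteq\mathbb{R}^n$ and $0<j<n$, $$V_n(K[j],-K[n-j])\ \le\ \binom{n}{j}\,\mathrm{Vol}(K).$$ Equality holds for $j\neq 0,n$ if and only if $K$ is a simplex.
   Context: A convex body is a nonempty compact convex subset of $\mathbb{R}^n$. Let $e_1,\dots,e_n$ be the standard basis of $\mathbb{R}^n$ and $[n]=\{1,\dots,n\}$. A convex body $K\subseteq\mathbb{R}^n$ is called locally anti-blocking if for every coordinate subspace $E=\mathrm{span}\{e_j: j\in J\}$, $J\subseteq[n]$, one has $P_E K=K\cap E$, where $P_E$ denotes orthogonal projection onto $E$. $\mathrm{Vol}$ is $n$-dimensional volume (Lebesgue measure) and $-K=\{-x:x\in K\}$. The mixed volume $V_n$ is the non-negative symmetric function on $n$-tuples of convex bodies in $\mathbb{R}^n$ satisfying $$\mathrm{Vol}(\lambda_1K_1+\dots+\lambda_nK_n)=\sum_{i_1,\dots,i_n=1}^n\lambda_{i_1}\cdots\lambda_{i_n}V_n(K_{i_1},\dots,K_{i_n})$$ for all convex bodies $K_1,\dots,K_n\subset\mathbb{R}^n$ and $\lambda_1,\dots,\lambda_n\ge 0$, where sums of sets are Minkowski sums. $V_n(K[j],T[n-j])$ denotes the mixed volume of $j$ copies of $K$ and $n-j$ copies of $T$.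
   Formalization: The implication "equality implies K is a simplex" is stated only for K with nonempty interior; without this it is false, e.g. K = [0,1]^2 x {0} in R^3, j = 1, where both sides are 0. The inequality and "simplex implies equality" are stated for all K. *)

theory Defs
  imports "HOL-Analysis.Analysis"
begin

definition convex_body :: "'a::euclidean_space set \<Rightarrow> bool" where
  "convex_body K \<longleftrightarrow> K \<noteq> {} \<and> compact K \<and> convex K"

definition orthogonal_projection :: "'a::euclidean_space set \<Rightarrow> 'a \<Rightarrow> 'a" where
  "orthogonal_projection E x = (THE y. y \<in> E \<and> (\<forall>z\<in>E. orthogonal (x - y) z))"

definition coordinate_subspace :: "'n set \<Rightarrow> (real ^ 'n::finite) set" where
  "coordinate_subspace J = span ((\<lambda>j. axis j 1) ` J)"

definition locally_anti_blocking :: "(real ^ 'n::finite) set \<Rightarrow> bool" where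
  "locally_anti_blocking K \<longleftrightarrow> convex_body K \<and>
    (\<forall>J. orthogonal_projection (coordinate_subspace J) ` K = K \<inter> coordinate_subspace J)"

(* An n-tuple of sets is a list of length n = CARD('n). Sets are added with the Minkowski sum
   of HOL-Library.Set_Algebras; note that -K is "uminus ` K", since "- K" is the complement.
   A mixed volume is unique on lists of n convex bodies; its values on all other lists
   are arbitrary and irrelevant. *)
definition is_mixed_volume :: "((real ^ 'n::finite) set list \<Rightarrow> real) \<Rightarrow> bool" where
  "is_mixed_volume V \<longleftrightarrow>
    (let n = CARD('n) in
      \<forall>Ks. length Ks = n \<and> (\<forall>K\<in>set Ks. convex_body K) \<longrightarrow>
        V Ks \<ge> 0 \<and>
        (\<forall>Ls. mset Ls = mset Ks \<longrightarrow> V Ls = V Ks) \<and>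
        (\<forall>l :: nat \<Rightarrow> real. (\<forall>i<n. l i \<ge> 0) \<longrightarrow>
          measure lebesgue (\<Sum>i<n. (\<lambda>x. l i *\<^sub>R x) ` (Ks ! i)) =
          (\<Sum>is | set is \<subseteq> {..<n} \<and> length is = n.
             (\<Prod>i\<leftarrow>is. l i) * V (map (\<lambda>i. Ks ! i) is))))"

lemma orthogonal_projection_eqI:
  assumes "subspace E" "y \<in> E" "\<And>z. z \<in> E \<Longrightarrow> orthogonal (x - y) z"
  shows "orthogonal_projection E x = y"
  unfolding orthogonal_projection_def
proof (rule the_equality)
  fix w assume w: "w \<in> E \<and> (\<forall>z\<in>E. orthogonal (x - w) z)"
  then have "y - w \<in> E"
    using assms by (simp add: subspace_diff)
  then have "(x - w) \<bullet> (y - w) = 0" "(x - y) \<bullet> (y - w) = 0"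
    using w assms(3) by (auto simp: orthogonal_def)
  then have "(y - w) \<bullet> (y - w) = 0"
    by (simp add: inner_diff_left)
  then show "w = y" by simp
qed (use assms in auto)

lemma coordinate_subspace_eq:
  "coordinate_subspace J = {x :: real ^ 'n::finite. \<forall>i. i \<notin> J \<longrightarrow> x $ i = 0}"
proof
  have "subspace {x :: real ^ 'n. \<forall>i. i \<notin> J \<longrightarrow> x $ i = 0}"
    by (auto simp: subspace_def)
  then show "coordinate_subspace J \<subseteq> {x :: real ^ 'n. \<forall>i. i \<notin> J \<longrightarrow> x $ i = 0}"
    unfolding coordinate_subspace_def by (intro span_minimal) (auto simp: axis_def)
  show "{x :: real ^ 'n. \<forall>i. i \<notin> J \<longrightarrow> x $ i = 0} \<subseteq> coordinate_subspace J"
  proof clarify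
    fix x :: "real ^ 'n" assume "\<forall>i. i \<notin> J \<longrightarrow> x $ i = 0"
    then have "x = (\<Sum>i\<in>J. (x $ i) *\<^sub>R axis i 1)"
      by (auto simp: vec_eq_iff axis_def if_distrib [of "\<lambda>u. _ * u"] sum.delta cong: if_cong)
    also have "\<dots> \<in> coordinate_subspace J"
      unfolding coordinate_subspace_def by (intro span_sum span_scale span_base) auto
    finally show "x \<in> coordinate_subspace J" .
  qed
qed

lemma orthogonal_projection_coordinate_subspace:
  "orthogonal_projection (coordinate_subspace J) x = (\<chi> i. if i \<in> J then x $ i else 0)"
proof (rule orthogonal_projection_eqI)
  show "subspace (coordinate_subspace J)"
    by (simp add: coordinate_subspace_def)
qed (auto simp: coordinate_subspace_eq orthogonal_def inner_vec_def intro!: sum.neutral)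

end

theory Submission
  imports Defs
begin

text \<open>
  Since \<open>V\<close> exists, \<open>Vol (t A + B)\<close> is a polynomial in \<open>t\<close> whose \<open>j\<close>-th coefficient \<open>c\<^sub>j(A, B)\<close> is
  \<open>n choose j\<close> times the mixed volume, and \<open>c\<^sub>j \<ge> 0\<close>. Let \<open>Z\<close> set the coordinate \<open>p\<close> to zero. If
  \<open>A\<close> and \<open>B\<close> are polytopes in the half-space \<open>x\<^sub>p \<ge> 0\<close> with \<open>Z A \<subseteq> A\<close> and \<open>Z B \<subseteq> B\<close>, then the mixed
  subdivision of \<open>t A + B\<close> induced by the \<open>p\<close>-th coordinate on \<open>B\<close> consists of \<open>t Z A + B\<close> and of
  cells that are shears, with determinant \<open>1 - q\<^sub>p \<in> (0, 1]\<close>, of cells of a subdivision of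
  \<open>t A + Z B\<close>. All cells are again of the form \<open>t F + G\<close>, with \<open>F\<close> and \<open>G\<close> independent of \<open>t\<close>, so comparing
  coefficients gives \<open>c\<^sub>j(A, B) \<le> c\<^sub>j(A, Z B) + c\<^sub>j(Z A, B)\<close>. Cutting along \<open>x\<^sub>p = 0\<close> removes the sign
  condition, and approximation extends the inequality to convex bodies. Applying it to all
  coordinates of \<open>K\<close> and \<open>- K\<close> bounds \<open>c\<^sub>j(K, - K)\<close> by the sum of \<open>Vol (P\<^sub>J K + P\<^sub>J\<^sub>' K)\<close> over the
  \<open>j\<close>-element sets \<open>J\<close> with complement \<open>J'\<close>. Each summand is at most \<open>n choose j\<close> times the volume of
  \<open>K\<close>, because \<open>K\<close> contains the convex hull of \<open>P\<^sub>J K\<close> and \<open>P\<^sub>J\<^sub>' K\<close>.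

  In the equality case \<open>K\<close> is such a convex hull for every \<open>J\<close>, hence the convex hull of
  segments on the axes. If two of these had the origin in their relative interior, the
  one-coordinate inequality would be strict for a suitable pair of coordinate sections; so at most one
  has, and \<open>K\<close> is a simplex.
\<close>

section \<open>Dilated sums and polynomial coefficients\<close>

text \<open>The proof has to produce strictness as well as the inequality, so the loss in the
  one-coordinate step is kept. A cell of \<open>t A + Z B\<close> with slope \<open>q\<close> loses
  the fraction \<open>q\<^sub>p\<close> of its volume under the shear, and a cell with
  \<open>q\<^sub>p \<ge> 1\<close> has no counterpart in \<open>t A + B\<close>. For polytopes in
  the half-space the two sides therefore differ exactly by the sum of \<open>min 1 q\<^sub>p\<close>
  times the \<open>j\<close>-th coefficient of the cell. A prescribed slope \<open>q0\<close> is
  carried through the subdivision so that its term survives. This surplus is lost when passing from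
  polytopes to convex bodies, but in the equality case \<open>K\<close> is already known to be the
  hull of finitely many points on the axes when strictness is required.

  The factor \<open>n choose j\<close> for a single \<open>J\<close> is the reciprocal of a Beta
  integral, obtained by slicing \<open>K\<close> along the scale of its \<open>J\<close>-block.

  That simplices attain equality follows by counting: the pieces
  \<open>P\<^sub>J S + P\<^sub>J\<^sub>' (- S)\<close> lie in different orthants inside
  \<open>S + (- S)\<close>, whose volume is the sum of all coefficients, so the upper bounds for the
  individual coefficients must all be attained at once.\<close>

definition dilsum :: "real \<Rightarrow> 'a::real_vector set \<Rightarrow> 'a set \<Rightarrow> 'a set" where
  "dilsum t A B = (\<lambda>(a, b). t *\<^sub>R a + b) ` (A \<times> B)"

lemma dilsumI: "a \<in> A \<Longrightarrow> b \<in> B \<Longrightarrow> x = t *\<^sub>R a + b \<Longrightarrow> x \<in> dilsum t A B"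
  by (auto simp: dilsum_def)

lemma dilsum_mono: "A \<subseteq> A' \<Longrightarrow> B \<subseteq> B' \<Longrightarrow> dilsum t A B \<subseteq> dilsum t A' B'"
  by (auto simp: dilsum_def)

lemma convex_body_dilsum:
  fixes A B :: "'a::euclidean_space set"
  assumes "convex_body A" "convex_body B"
  shows "convex_body (dilsum t A B)"
proof -
  have lin: "linear (\<lambda>(a :: 'a, b). t *\<^sub>R a + b)"
    by (auto intro!: linearI simp: algebra_simps)
  show ?thesis
    using assms unfolding convex_body_def dilsum_def
    by (intro conjI compact_continuous_image convex_linear_image [OF lin] compact_Times convex_Times
        linear_continuous_on linear_linear [THEN iffD1] lin)
      (auto intro: lin simp: linear_conv_bounded_linear[symmetric])
qed

lemma convex_body_linear_image:
  fixes f :: "'a::euclidean_space \<Rightarrow> 'b::euclidean_space"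
  shows "linear f \<Longrightarrow> convex_body A \<Longrightarrow> convex_body (f ` A)"
  by (auto simp: convex_body_def convex_linear_image linear_linear
      intro!: compact_continuous_image linear_continuous_on)

lemma convex_body_lmeasurable [intro]: "convex_body A \<Longrightarrow> A \<in> lmeasurable"
  by (simp add: convex_body_def lmeasurable_compact)

lemma dilsum_linear_image:
  "linear f \<Longrightarrow> dilsum t (f ` A) (f ` B) = f ` dilsum t A B"
  by (force simp: dilsum_def linear_add linear_scale image_iff)

lemma dilsum_translation:
  "dilsum t ((+) u ` A) ((+) v ` B) = (+) (t *\<^sub>R u + v) ` dilsum t A B"
  unfolding dilsum_def
  by (force simp: image_iff algebra_simps Bex_def)

lemma polynomial_coeffs_eq:
  fixes a b :: "nat \<Rightarrow> real"
  assumes "\<And>t. t > 0 \<Longrightarrow> (\<Sum>i\<le>n. a i * t ^ i) = (\<Sum>i\<le>n. b i * t ^ i)" and "j \<le> n"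
  shows "a j = b j"
proof (rule ccontr)
  assume ne: "a j \<noteq> b j"
  have "finite {t. (\<Sum>i\<le>n. (a i - b i) * t ^ i) = 0}"
    using ne assms(2) by (subst polyfun_finite_roots) auto
  moreover have "{0<..} \<subseteq> {t. (\<Sum>i\<le>n. (a i - b i) * t ^ i) = 0}"
    using assms(1) by (auto simp: left_diff_distrib sum_subtractf)
  ultimately show False
    using infinite_Ioi finite_subset by blast
qed

text \<open>Lagrange interpolation at the nodes 1, ..., n + 1: a coefficient is a fixed linear
  combination of finitely many values. This lets limits of volumes pass to coefficients.\<close>

lemma polynomial_coeff_functional:
  assumes "j \<le> n"
  obtains w :: "nat \<Rightarrow> real"
  where "\<And>a. (\<Sum>i\<le>n. w i * (\<Sum>m\<le>n. a m * real (Suc i) ^ m)) = a j"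
proof -
  \<comment> \<open>The Lagrange basis polynomial for the node \<open>Suc i\<close>; the shift by
    one keeps all nodes positive.\<close>
  define L :: "nat \<Rightarrow> real poly" where
    "L i = (\<Prod>m\<in>{..n} - {i}. smult (1 / (real i - real m)) [:- real (Suc m), 1:])" for i
  have degL: "degree (L i) \<le> n" if "i \<le> n" for i
  proof -
    have "degree (L i) \<le> (\<Sum>m\<in>{..n} - {i}. degree (smult (1 / (real i - real m)) [:- real (Suc m), 1:]))"
      unfolding L_def by (rule degree_prod_sum_le[simplified o_def]) auto
    also have "\<dots> \<le> (\<Sum>m\<in>{..n} - {i}. 1)"
      by (intro sum_mono) (auto intro: order.trans[OF degree_smult_le])
    finally show ?thesis using that by simp
  qed
  have Leval: "poly (L i) (real (Suc k)) = (if i = k then 1 else 0)" if "i \<le> n" "k \<le> n" for i k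
  proof (cases "i = k")
    case True
    then show ?thesis
      by (auto simp: L_def poly_prod diff_divide_distrib [symmetric] add_divide_distrib [symmetric] intro!: prod.neutral)
  next
    case False
    then show ?thesis
      using that by (auto simp: L_def poly_prod add_divide_distrib [symmetric] intro!: bexI[of _ k])
  qed
  show thesis
  proof (rule that)
    fix a :: "nat \<Rightarrow> real"
    define P where "P = (\<Sum>m\<le>n. monom (a m) m)"
    have evP: "poly P x = (\<Sum>m\<le>n. a m * x ^ m)" for x
      by (simp add: P_def poly_sum poly_monom)
    have "(\<Sum>i\<le>n. smult (poly P (real (Suc i))) (L i)) = P"
    proof (rule poly_eqI_degree)
      show "poly (\<Sum>i\<le>n. smult (poly P (real (Suc i))) (L i)) x = poly P x"
        if "x \<in> (\<lambda>k. real (Suc k)) ` {..n}" for x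
        using that by (auto simp: poly_sum Leval mult_delta_right simp del: of_nat_Suc)
      have c: "card ((\<lambda>k. real (Suc k)) ` {..n}) = Suc n"
        by (subst card_image) (auto simp: inj_on_def)
      have "degree (\<Sum>i\<le>n. smult (poly P (real (Suc i))) (L i)) \<le> n"
        by (intro degree_sum_le) (auto intro: order.trans[OF degree_smult_le] degL)
      then show "degree (\<Sum>i\<le>n. smult (poly P (real (Suc i))) (L i)) < card ((\<lambda>k. real (Suc k)) ` {..n})"
        using c by simp
      have "degree P \<le> n"
        unfolding P_def by (intro degree_sum_le) (auto intro: order.trans[OF degree_monom_le])
      then show "degree P < card ((\<lambda>k. real (Suc k)) ` {..n})"
        using c by simp
    qed
    then have "coeff (\<Sum>i\<le>n. smult (poly P (real (Suc i))) (L i)) j = coeff P j"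
      by simp
    moreover have "coeff P j = a j"
      using assms by (simp add: P_def coeff_sum)
    ultimately show "(\<Sum>i\<le>n. coeff (L i) j * (\<Sum>m\<le>n. a m * real (Suc i) ^ m)) = a j"
      by (simp add: coeff_sum evP mult.commute)
  qed
qed

section \<open>Volume and linear maps\<close>

text \<open>The change-of-variables theorems of the library require a well-ordered index type; \<open>idx\<close> is
  a well-ordered copy of an arbitrary finite type.\<close>

typedef (overloaded) ('n::finite) idx = "{..<CARD('n)}"
  by (rule exI[of _ 0]) simp

instantiation idx :: (finite) wellorder
begin

definition less_eq_idx :: "'a idx \<Rightarrow> 'a idx \<Rightarrow> bool" where
  "less_eq_idx x y \<longleftrightarrow> Rep_idx x \<le> Rep_idx y"

definition less_idx :: "'a idx \<Rightarrow> 'a idx \<Rightarrow> bool" where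
  "less_idx x y \<longleftrightarrow> Rep_idx x < Rep_idx y"

instance
proof
  fix P :: "'a idx \<Rightarrow> bool" and a :: "'a idx"
  assume step: "\<And>x. (\<And>y. y < x \<Longrightarrow> P y) \<Longrightarrow> P x"
  show "P a"
    by (induction "Rep_idx a" arbitrary: a rule: less_induct) (rule step, simp add: less_idx_def)
qed (auto simp: less_eq_idx_def less_idx_def Rep_idx_inject)

end

instance idx :: (finite) finite
proof
  have "(UNIV :: 'a idx set) = Abs_idx ` {..<CARD('a)}"
    using type_definition.Abs_image[OF type_definition_idx[where ?'n = 'a]] by simp
  then show "finite (UNIV :: 'a idx set)"
    by (metis finite_imageI finite_lessThan)
qed

lemma card_idx: "CARD('n::finite idx) = CARD('n)"
  using type_definition.card[OF type_definition_idx[where ?'n = 'n]] by simp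

text \<open>Relabelling takes boxes to boxes with the same edge lengths, and Lebesgue measure is
  determined by its values on boxes.\<close>

lemma measure_reindex:
  fixes h :: "'m::finite \<Rightarrow> 'n::finite" and S :: "(real ^ 'n) set"
  assumes "bij h" "compact S"
  shows "measure lebesgue ((\<lambda>x. \<chi> i. x $ h i) ` S) = measure lebesgue S"
proof -
  define \<phi> :: "real ^ 'n \<Rightarrow> real ^ 'm" where "\<phi> = (\<lambda>x. \<chi> i. x $ h i)"
  define \<psi> :: "real ^ 'm \<Rightarrow> real ^ 'n" where "\<psi> = (\<lambda>x. \<chi> i. x $ inv h i)"
  have h: "h (inv h i) = i" "inv h (h k) = k" for i k
    using assms(1) by (auto simp: bij_def surj_f_inv_f)
  have lin: "linear \<phi>" "linear \<psi>"
    unfolding \<phi>_def \<psi>_def by (auto intro!: linearI simp: vec_eq_iff)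
  have cont: "continuous_on UNIV \<phi>" "continuous_on UNIV \<psi>"
    using lin by (auto simp: linear_continuous_on linear_linear)
  have inv: "\<phi> (\<psi> y) = y" "\<psi> (\<phi> x) = x" for x y
    by (auto simp: \<phi>_def \<psi>_def vec_eq_iff h)
  have meas: "\<psi> \<in> borel \<rightarrow>\<^sub>M borel"
    using cont(2) by (rule borel_measurable_continuous_onI)
  have "lborel = distr lborel borel \<psi>"
  proof (rule lborel_eqI)
    fix l u :: "real ^ 'n"
    assume le: "\<And>b. b \<in> Basis \<Longrightarrow> l \<bullet> b \<le> u \<bullet> b"
    have le': "l $ i \<le> u $ i" for i
    proof -
      have "axis i (1 :: real) \<in> Basis"
        by (auto simp: Basis_vec_def)
      from le[OF this] show ?thesis
        by (simp add: inner_axis)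
    qed
    have "\<psi> -` box l u = box (\<phi> l) (\<phi> u)"
      by (auto simp: box_def Basis_vec_def inner_axis \<psi>_def \<phi>_def) (metis h)+
    then have "emeasure (distr lborel borel \<psi>) (box l u) = emeasure lborel (box (\<phi> l) (\<phi> u))"
      using meas by (simp add: emeasure_distr)
    also have "\<dots> = (\<Prod>b\<in>Basis. (\<phi> u - \<phi> l) \<bullet> b)"
      using le' by (subst emeasure_lborel_box) (auto simp: Basis_vec_def inner_axis \<phi>_def)
    also have "(\<Prod>b\<in>Basis. (\<phi> u - \<phi> l) \<bullet> b) = (\<Prod>i\<in>UNIV. (u $ h i - l $ h i))"
    proof -
      have basis: "(Basis :: (real ^ 'm) set) = (\<lambda>i. axis i 1) ` UNIV"
        by (auto simp: Basis_vec_def)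
      show ?thesis
        unfolding basis by (simp add: prod.reindex inj_on_def axis_eq_axis inner_axis \<phi>_def)
    qed
    also have "(\<Prod>i\<in>UNIV. (u $ h i - l $ h i)) = (\<Prod>i\<in>UNIV. (u $ i - l $ i))"
      using prod.reindex_bij_betw[of h UNIV UNIV "\<lambda>i. u $ i - l $ i"] assms(1) by simp
    also have "\<dots> = (\<Prod>b\<in>Basis. (u - l) \<bullet> b)"
    proof -
      have basis: "(Basis :: (real ^ 'n) set) = (\<lambda>i. axis i 1) ` UNIV"
        by (auto simp: Basis_vec_def)
      show ?thesis
        unfolding basis by (simp add: prod.reindex inj_on_def axis_eq_axis inner_axis)
    qed
    finally show "emeasure (distr lborel borel \<psi>) (box l u) = (\<Prod>b\<in>Basis. (u - l) \<bullet> b)" .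
  qed simp
  then have "emeasure lborel S = emeasure (distr lborel borel \<psi>) S"
    by simp
  also have "\<dots> = emeasure lborel (\<psi> -` S)"
    using meas assms(2) by (simp add: emeasure_distr borel_compact)
  also have "\<psi> -` S = \<phi> ` S"
  proof (intro set_eqI iffI)
    fix y assume "y \<in> \<psi> -` S"
    then show "y \<in> \<phi> ` S"
      using inv(1)[of y] by (metis imageI vimageE)
  qed (auto simp: inv)
  finally have "measure lborel S = measure lborel (\<phi> ` S)"
    by (simp add: measure_def)
  moreover have "compact (\<phi> ` S)"
    using assms(2) cont by (meson compact_continuous_image continuous_on_subset subset_UNIV)
  ultimately show ?thesis
    using assms(2) by (simp add: \<phi>_def borel_compact)
qed

text \<open>For linear \<open>f\<close> this \<open>d\<close> is the absolute determinant. As a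
  predicate it can be evaluated on one convenient body or through compositions.\<close>

definition volume_factor :: "(real ^ 'n::finite \<Rightarrow> real ^ 'n) \<Rightarrow> real \<Rightarrow> bool" where
  "volume_factor f d \<longleftrightarrow> (\<forall>S. compact S \<longrightarrow> measure lebesgue (f ` S) = d * measure lebesgue S)"

lemma volume_factorD: "volume_factor f d \<Longrightarrow> compact S \<Longrightarrow> measure lebesgue (f ` S) = d * measure lebesgue S"
  by (simp add: volume_factor_def)

text \<open>Conjugation with a relabelling of the coordinates by \<open>idx\<close> preserves
  volumes and moves the map to a space where the determinant formula applies.\<close>

lemma linear_has_volume_factor:
  fixes f :: "real ^ 'n::finite \<Rightarrow> real ^ 'n"
  assumes f: "linear f"
  shows "\<exists>d\<ge>0. volume_factor f d"
proof -
  obtain h :: "'n idx \<Rightarrow> 'n" where h: "bij h"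
    using finite_same_card_bij[of "UNIV :: 'n idx set" "UNIV :: 'n set"] by (auto simp: card_idx)
  define \<phi> :: "real ^ 'n \<Rightarrow> real ^ 'n idx" where "\<phi> = (\<lambda>x. \<chi> i. x $ h i)"
  define \<psi> :: "real ^ 'n idx \<Rightarrow> real ^ 'n" where "\<psi> = (\<lambda>x. \<chi> i. x $ inv h i)"
  have hi: "h (inv h i) = i" "inv h (h k) = k" for i k
    using h by (auto simp: bij_def surj_f_inv_f)
  have lin: "linear \<phi>" "linear \<psi>"
    unfolding \<phi>_def \<psi>_def by (auto intro!: linearI simp: vec_eq_iff)
  have inv: "\<psi> (\<phi> x) = x" for x
    by (auto simp: \<phi>_def \<psi>_def vec_eq_iff hi)
  define g where "g = \<phi> \<circ> f \<circ> \<psi>"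
  have g: "linear g"
    unfolding g_def by (intro linear_compose lin f)
  have cimg: "compact (k ` S)" if "linear k" "compact S" for S :: "(real ^ 'a::finite) set" and k :: "real ^ 'a \<Rightarrow> real ^ 'b::finite"
    using that by (auto intro!: compact_continuous_image linear_continuous_on simp: linear_linear)
  have "measure lebesgue (f ` S) = \<bar>det (matrix g)\<bar> * measure lebesgue S" if "compact S" for S
  proof -
    have "measure lebesgue (f ` S) = measure lebesgue (\<phi> ` f ` S)"
      unfolding \<phi>_def using measure_reindex[OF h] cimg[OF f that] by simp
    also have "\<phi> ` f ` S = g ` \<phi> ` S"
      by (simp add: g_def image_comp o_def inv)
    also have "measure lebesgue \<dots> = \<bar>det (matrix g)\<bar> * measure lebesgue (\<phi> ` S)"
      using g cimg[OF lin(1) that] by (intro measure_linear_image) (auto intro: lmeasurable_compact)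
    also have "measure lebesgue (\<phi> ` S) = measure lebesgue S"
      unfolding \<phi>_def using measure_reindex[OF h that] by simp
    finally show ?thesis .
  qed
  then show ?thesis
    by (intro exI[of _ "\<bar>det (matrix g)\<bar>"]) (auto simp: volume_factor_def)
qed

lemma volume_factor_unique:
  fixes f :: "real ^ 'n::finite \<Rightarrow> real ^ 'n"
  assumes "volume_factor f c" "volume_factor f d"
  shows "c = d"
proof -
  have "measure lebesgue (cbox 0 (\<chi> i. 1) :: (real ^ 'n) set) \<noteq> 0"
    by (simp add: content_cbox_if_cart interval_ne_empty_cart)
  then show ?thesis
    using volume_factorD[OF assms(1) compact_cbox] volume_factorD[OF assms(2) compact_cbox]
    by (metis mult_right_cancel)
qed

lemma volume_factor_compose:
  assumes "volume_factor f c" "volume_factor g d" "linear g"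
  shows "volume_factor (f \<circ> g) (c * d)"
proof -
  have "compact (g ` S)" if "compact S" for S
    using that assms(3) by (auto intro!: compact_continuous_image linear_continuous_on simp: linear_linear)
  then show ?thesis
    using assms(1,2) unfolding volume_factor_def image_comp[symmetric] by (simp add: mult.assoc)
qed

lemma volume_factor_pos:
  fixes f :: "real ^ 'n::finite \<Rightarrow> real ^ 'n"
  assumes "volume_factor f d" "d \<ge> 0" "linear f" "inj f"
  shows "d > 0"
proof -
  obtain g where g: "linear g" "g \<circ> f = id"
    using linear_injective_left_inverse[OF assms(3,4)] by blast
  obtain e where "volume_factor g e"
    using linear_has_volume_factor[OF g(1)] by blast
  then have "volume_factor (id :: real ^ 'n \<Rightarrow> _) (e * d)"
    using volume_factor_compose[OF _ assms(1,3), of g e] g(2) by simp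
  moreover have "volume_factor (id :: real ^ 'n \<Rightarrow> _) 1"
    by (simp add: volume_factor_def)
  ultimately have "e * d = 1"
    by (rule volume_factor_unique)
  then show ?thesis
    using assms(2) by (cases "d = 0") auto
qed

lemma volume_factor_stretch:
  fixes m :: "'n::finite \<Rightarrow> real"
  shows "volume_factor (\<lambda>x. \<chi> i. m i * x $ i) \<bar>prod m UNIV\<bar>"
proof -
  let ?f = "\<lambda>x :: real ^ 'n. \<chi> i. m i * x $ i"
  have lin: "linear ?f"
    by (auto intro!: linearI simp: vec_eq_iff algebra_simps)
  obtain d where d: "d \<ge> 0" "volume_factor ?f d"
    using linear_has_volume_factor[OF lin] by blast
  let ?u = "\<chi> i. 1 :: real ^ 'n"
  have ne: "cbox 0 ?u \<noteq> {}"
    by (auto simp: interval_ne_empty_cart)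
  have "?f ` cbox 0 ?u = cbox (\<chi> k. min (m k * 0) (m k * 1)) (\<chi> k. max (m k * 0) (m k * 1))"
    using ne by (subst image_stretch_interval_cart) simp
  then have "measure lebesgue (?f ` cbox 0 ?u) =
      measure lebesgue (cbox (\<chi> k. min (m k * 0) (m k * 1)) (\<chi> k. max (m k * 0) (m k * 1) :: real ^ 'n))"
    by simp
  also have "\<dots> = (\<Prod>k\<in>UNIV. max 0 (m k) - min 0 (m k))"
    by (simp add: content_cbox_if_cart interval_ne_empty_cart interval_eq_empty_cart min_def max_def)
  also have "\<dots> = \<bar>prod m UNIV\<bar>"
    by (simp add: abs_prod) (auto intro!: prod.cong)
  finally have "d * measure lebesgue (cbox 0 ?u) = \<bar>prod m UNIV\<bar>"
    using volume_factorD[OF d(2) compact_cbox] by metis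
  moreover have "measure lebesgue (cbox 0 ?u) = 1"
    using ne by (simp add: content_cbox_if_cart)
  ultimately show ?thesis
    using d(2) by simp
qed

text \<open>Because \<open>q $ p = 0\<close>, the reflection in coordinate \<open>p\<close>
  conjugates the map to its inverse, so the square of its factor is 1.\<close>

lemma volume_factor_transvection:
  fixes q :: "real ^ 'n::finite"
  assumes "q $ p = 0"
  shows "volume_factor (\<lambda>x. x - (q \<bullet> x) *\<^sub>R axis p 1) 1"
proof -
  let ?f = "\<lambda>x. x - (q \<bullet> x) *\<^sub>R axis p 1"
  let ?R = "\<lambda>x :: real ^ 'n. \<chi> i. (if i = p then - 1 else 1) * x $ i"
  have lin: "linear ?f" and linR: "linear ?R"
    by (auto intro!: linearI simp: algebra_simps inner_add_right vec_eq_iff)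
  obtain d where d: "d \<ge> 0" "volume_factor ?f d"
    using linear_has_volume_factor[OF lin] by blast
  have R: "volume_factor ?R 1"
    using volume_factor_stretch[of "\<lambda>i. if i = p then - 1 else 1"] by (simp add: prod.delta)
  have qR: "q \<bullet> ?R x = q \<bullet> x" for x
    using assms by (auto simp: inner_vec_def intro!: sum.cong)
  have "?R (?f (?R x)) = x + (q \<bullet> x) *\<^sub>R axis p 1" for x
    unfolding qR by (auto simp: vec_eq_iff axis_def)
  then have "?f \<circ> (?R \<circ> (?f \<circ> ?R)) = id"
    using assms by (simp add: fun_eq_iff inner_add_right inner_axis)
  moreover have "volume_factor (?f \<circ> (?R \<circ> (?f \<circ> ?R))) (d * (1 * (d * 1)))"
    by (intro volume_factor_compose d R lin linR linear_compose)
  moreover have "volume_factor id 1"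
    by (simp add: volume_factor_def)
  ultimately have "d * (1 * (d * 1)) = 1"
    using volume_factor_unique by metis
  then have "d\<^sup>2 = 1"
    by (simp add: power2_eq_square)
  then have "d = 1"
    using d(1) by (auto simp: power2_eq_1_iff)
  then show ?thesis
    using d(2) by simp
qed

text \<open>The map is a transvection followed by the stretch of coordinate \<open>p\<close> by
  \<open>1 - q $ p\<close>. This is the factor by which the cells shrink in the mixed
  subdivision.\<close>

lemma volume_factor_shear:
  fixes q :: "real ^ 'n::finite"
  assumes "q $ p < 1"
  shows "volume_factor (\<lambda>x. x - (q \<bullet> x) *\<^sub>R axis p 1) (1 - q $ p)"
proof -
  let ?c = "1 - q $ p"
  define r where "r = (1 / ?c) *\<^sub>R (q - (q $ p) *\<^sub>R axis p 1)"
  let ?g = "\<lambda>x. x - (r \<bullet> x) *\<^sub>R axis p 1"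
  let ?D = "\<lambda>x :: real ^ 'n. \<chi> i. (if i = p then ?c else 1) * x $ i"
  have lin: "linear ?g"
    by (auto intro!: linearI simp: algebra_simps inner_add_right)
  have r: "?c * (r \<bullet> x) = q \<bullet> x - q $ p * x $ p" for x
    using assms by (simp add: r_def inner_diff_left inner_axis' )
  have "volume_factor ?g 1"
    using assms by (intro volume_factor_transvection) (simp add: r_def)
  moreover have "volume_factor ?D ?c"
    using volume_factor_stretch[of "\<lambda>i. if i = p then ?c else 1"] assms by (simp add: prod.delta)
  ultimately have "volume_factor (?D \<circ> ?g) (?c * 1)"
    by (intro volume_factor_compose lin)
  moreover have "?D \<circ> ?g = (\<lambda>x. x - (q \<bullet> x) *\<^sub>R axis p 1)"
    using r by (auto simp: fun_eq_iff vec_eq_iff axis_def algebra_simps)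
  ultimately show ?thesis by simp
qed

section \<open>Coefficients of the volume polynomial\<close>

text \<open>Pascal's rule, split by the first letter. It collapses the sum over index lists in the
  definition of mixed volumes to a polynomial in one variable.\<close>

lemma sum_lists_two_letters:
  fixes h :: "nat \<Rightarrow> real"
  shows "(\<Sum>xs | set xs \<subseteq> {0, 1::nat} \<and> length xs = n. h (count_list xs 0)) =
    (\<Sum>j\<le>n. real (n choose j) * h j)"
proof (induction n arbitrary: h)
  case 0
  have "{xs :: nat list. set xs \<subseteq> {0, 1} \<and> length xs = 0} = {[]}" by auto
  then show ?case by simp
next
  case (Suc n)
  let ?L = "\<lambda>n. {xs. set xs \<subseteq> {0, 1::nat} \<and> length xs = n}"
  have fin: "finite (?L n)" for n
    by (rule finite_lists_length_eq) simp
  have split: "?L (Suc n) = (#) 0 ` ?L n \<union> (#) 1 ` ?L n"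
    by (auto simp: length_Suc_conv image_iff)
  have "(\<Sum>xs\<in>?L (Suc n). h (count_list xs 0)) =
      (\<Sum>xs\<in>?L n. h (Suc (count_list xs 0))) + (\<Sum>xs\<in>?L n. h (count_list xs 0))"
    unfolding split using fin
    by (subst sum.union_disjoint) (auto simp: sum.reindex)
  also have "\<dots> = (\<Sum>j\<le>n. real (n choose j) * h (Suc j)) + (\<Sum>j\<le>n. real (n choose j) * h j)"
    using Suc.IH[of "\<lambda>c. h (Suc c)"] Suc.IH[of h] by simp
  also have "(\<Sum>j\<le>n. real (n choose j) * h j) = (\<Sum>j\<le>Suc n. real (n choose j) * h j)"
    by simp
  also have "\<dots> = h 0 + (\<Sum>j\<le>n. real (n choose Suc j) * h (Suc j))"
    by (subst sum.atMost_Suc_shift) simp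
  also have "(\<Sum>j\<le>n. real (n choose j) * h (Suc j)) + \<dots> =
      h 0 + (\<Sum>j\<le>n. real (Suc n choose Suc j) * h (Suc j))"
    by (simp add: sum.distrib algebra_simps)
  also have "\<dots> = (\<Sum>j\<le>Suc n. real (Suc n choose j) * h j)"
    by (subst sum.atMost_Suc_shift) simp
  finally show ?case .
qed

text \<open>Entering both \<open>A\<close> and \<open>B\<close> into one tuple takes two slots,
  hence \<open>dim_ge_2\<close>; in the theorem it follows from \<open>0 < j\<close> and
  \<open>j < n\<close>.\<close>

locale mixed_volume =
  fixes V :: "(real ^ 'n::finite) set list \<Rightarrow> real"
  assumes is_mixed_volume: "is_mixed_volume V"
    and dim_ge_2: "CARD('n) \<ge> 2"
begin

definition mixed_coeff :: "nat \<Rightarrow> (real ^ 'n) set \<Rightarrow> (real ^ 'n) set \<Rightarrow> real" where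
  "mixed_coeff j A B =
    real (CARD('n) choose j) * V (replicate j A @ replicate (CARD('n) - j) B)"

lemma mixed_volumeD:
  assumes "length Ks = CARD('n)" "\<And>K. K \<in> set Ks \<Longrightarrow> convex_body K"
  shows "V Ks \<ge> 0"
    and "mset Ls = mset Ks \<Longrightarrow> V Ls = V Ks"
    and "(\<And>i. i < CARD('n) \<Longrightarrow> l i \<ge> 0) \<Longrightarrow>
      measure lebesgue (\<Sum>i<CARD('n). (\<lambda>x. l i *\<^sub>R x) ` (Ks ! i)) =
          (\<Sum>is | set is \<subseteq> {..<CARD('n)} \<and> length is = CARD('n).
             (\<Prod>i\<leftarrow>is. l i) * V (map (\<lambda>i. Ks ! i) is))"
proof -
  have "length Ks = CARD('n) \<and> (\<forall>K\<in>set Ks. convex_body K)"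
    using assms by simp
  note * = is_mixed_volume[unfolded is_mixed_volume_def Let_def, THEN spec, of Ks, THEN mp, OF this]
  show "V Ks \<ge> 0"
    using * by (rule conjunct1)
  show "mset Ls = mset Ks \<Longrightarrow> V Ls = V Ks"
    using *[THEN conjunct2, THEN conjunct1] by iprover
  show "(\<And>i. i < CARD('n) \<Longrightarrow> l i \<ge> 0) \<Longrightarrow>
      measure lebesgue (\<Sum>i<CARD('n). (\<lambda>x. l i *\<^sub>R x) ` (Ks ! i)) =
          (\<Sum>is | set is \<subseteq> {..<CARD('n)} \<and> length is = CARD('n).
             (\<Prod>i\<leftarrow>is. l i) * V (map (\<lambda>i. Ks ! i) is))"
    using *[THEN conjunct2, THEN conjunct2] by iprover
qed

lemma mixed_coeff_nonneg:
  assumes "convex_body A" "convex_body B"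
  shows "mixed_coeff j A B \<ge> 0"
proof (cases "j \<le> CARD('n)")
  case True
  have "V (replicate j A @ replicate (CARD('n) - j) B) \<ge> 0"
    using True assms by (intro mixed_volumeD) auto
  then show ?thesis
    by (simp add: mixed_coeff_def)
qed (simp add: mixed_coeff_def binomial_eq_0)

lemma volume_dilsum:
  assumes A: "convex_body A" and B: "convex_body B" and t: "t \<ge> 0"
  shows "measure lebesgue (dilsum t A B) = (\<Sum>j\<le>CARD('n). mixed_coeff j A B * t ^ j)"
proof -
  let ?n = "CARD('n)"
  obtain m where m: "?n = Suc (Suc m)"
    using dim_ge_2 that[of "?n - 2"] by linarith
  \<comment> \<open>The weights are t, 1, 0, ..., 0. The slots of weight 0 must still hold convex
    bodies, so \<open>B\<close> is repeated there.\<close>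
  define Ks where "Ks = A # replicate (?n - 1) B"
  define l :: "nat \<Rightarrow> real" where "l i = (if i = 0 then t else if i = 1 then 1 else 0)" for i
  have nth: "Ks ! i = (if i = 0 then A else B)" if "i < ?n" for i
    using that by (cases i) (auto simp: Ks_def)
  have len: "length Ks = ?n"
    by (simp add: Ks_def m)
  have cb: "convex_body K" if "K \<in> set Ks" for K
    using that A B by (auto simp: Ks_def split: if_splits)
  have "(\<Sum>i<?n. (\<lambda>x. l i *\<^sub>R x) ` (Ks ! i)) = dilsum t A B"
  proof -
    have "(\<Sum>i<?n. (\<lambda>x. l i *\<^sub>R x) ` (Ks ! i)) =
        (\<lambda>x. t *\<^sub>R x) ` A + (B + (\<Sum>i<m. (\<lambda>x. 0 *\<^sub>R x) ` B))"
      unfolding m by (simp add: sum.lessThan_Suc_shift nth m l_def del: sum.lessThan_Suc)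
    also have "(\<Sum>i<m. (\<lambda>x. 0 *\<^sub>R x) ` B) = 0"
      using B by (intro sum.neutral) (auto simp: convex_body_def image_constant_conv)
    finally show ?thesis
      by (auto simp: set_plus_def dilsum_def image_iff Bex_def)
  qed
  moreover have "measure lebesgue (\<Sum>i<?n. (\<lambda>x. l i *\<^sub>R x) ` (Ks ! i)) =
      (\<Sum>is | set is \<subseteq> {..<?n} \<and> length is = ?n. (\<Prod>i\<leftarrow>is. l i) * V (map (\<lambda>i. Ks ! i) is))"
    using len cb t by (intro mixed_volumeD) (auto simp: l_def)
  moreover have "\<dots> = (\<Sum>is | set is \<subseteq> {0, 1::nat} \<and> length is = ?n.
      (\<Prod>i\<leftarrow>is. l i) * V (map (\<lambda>i. Ks ! i) is))"
  proof (rule sum.mono_neutral_right)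
    show "finite {is. set is \<subseteq> {..<?n} \<and> length is = ?n}"
      by (rule finite_lists_length_eq) simp
    show "\<forall>is\<in>{is. set is \<subseteq> {..<?n} \<and> length is = ?n} - {is. set is \<subseteq> {0, 1::nat} \<and> length is = ?n}.
        (\<Prod>i\<leftarrow>is. l i) * V (map (\<lambda>i. Ks ! i) is) = 0"
      by (auto simp: prod_list_zero_iff l_def image_iff)
  qed (auto simp: m)
  moreover have "\<dots> = (\<Sum>is | set is \<subseteq> {0, 1::nat} \<and> length is = ?n.
      t ^ count_list is 0 * V (replicate (count_list is 0) A @ replicate (?n - count_list is 0) B))"
  proof (rule sum.cong [OF refl])
    fix xs assume "xs \<in> {xs. set xs \<subseteq> {0, 1::nat} \<and> length xs = ?n}"
    then have xs: "set xs \<subseteq> {0, 1}" "length xs = ?n" by auto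
    have le: "count_list xs 0 \<le> length xs" for xs :: "nat list"
      by (induction xs) auto
    have "(\<Prod>i\<leftarrow>xs. l i) = t ^ count_list xs 0"
      using xs(1) by (induction xs) (auto simp: l_def)
    moreover have "mset (map (\<lambda>i. Ks ! i) xs) =
        mset (replicate (count_list xs 0) A @ replicate (length xs - count_list xs 0) B)"
      using xs(1)
    proof (induction xs)
      case (Cons x xs)
      then show ?case using le[of xs]
        by (auto simp: nth m Suc_diff_le)
    qed auto
    moreover have "V (map (\<lambda>i. Ks ! i) xs) = V (replicate (count_list xs 0) A @ replicate (?n - count_list xs 0) B)"
      using calculation xs(2) le[of xs] A B
      by (intro mixed_volumeD(2)) (auto split: if_splits)
    ultimately show "(\<Prod>i\<leftarrow>xs. l i) * V (map (\<lambda>i. Ks ! i) xs) =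
        t ^ count_list xs 0 * V (replicate (count_list xs 0) A @ replicate (?n - count_list xs 0) B)"
      by simp
  qed
  moreover have "\<dots> = (\<Sum>j\<le>?n. real (?n choose j) * (t ^ j * V (replicate j A @ replicate (?n - j) B)))"
    by (rule sum_lists_two_letters)
  ultimately show ?thesis
    by (simp add: mixed_coeff_def algebra_simps)
qed

lemma mixed_coeff_eqI:
  assumes "convex_body A" "convex_body B" "j \<le> CARD('n)"
    and "\<And>t. t > 0 \<Longrightarrow> measure lebesgue (dilsum t A B) = (\<Sum>i\<le>CARD('n). c i * t ^ i)"
  shows "mixed_coeff j A B = c j"
proof (rule polynomial_coeffs_eq[OF _ assms(3)])
  show "(\<Sum>i\<le>CARD('n). mixed_coeff i A B * t ^ i) = (\<Sum>i\<le>CARD('n). c i * t ^ i)" if "t > 0" for t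
    using assms(4)[OF that] volume_dilsum[OF assms(1,2), of t] that by simp
qed

lemma mixed_coeff_scaled:
  assumes "convex_body A" "convex_body B" "convex_body A'" "convex_body B'" "j \<le> CARD('n)"
    and "\<And>t. t > 0 \<Longrightarrow> measure lebesgue (dilsum t A B) = d * measure lebesgue (dilsum t A' B')"
  shows "mixed_coeff j A B = d * mixed_coeff j A' B'"
  using assms by (intro mixed_coeff_eqI) (auto simp: volume_dilsum sum_distrib_left mult.assoc)

lemma mixed_coeff_linear_image:
  fixes f :: "real ^ 'n \<Rightarrow> real ^ 'n"
  assumes "convex_body A" "convex_body B" "linear f" "j \<le> CARD('n)" "volume_factor f d"
  shows "mixed_coeff j (f ` A) (f ` B) = d * mixed_coeff j A B"
proof (rule mixed_coeff_scaled)
  show "measure lebesgue (dilsum t (f ` A) (f ` B)) = d * measure lebesgue (dilsum t A B)" for t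
    using assms convex_body_dilsum[of A B t]
    by (simp add: dilsum_linear_image volume_factorD convex_body_def)
qed (use assms convex_body_linear_image in auto)

lemma convex_body_translation: "convex_body A \<Longrightarrow> convex_body ((+) u ` A)"
  by (simp add: convex_body_def compact_translation convex_translation)

lemma mixed_coeff_translation:
  assumes "convex_body A" "convex_body B" "j \<le> CARD('n)"
  shows "mixed_coeff j ((+) u ` A) ((+) v ` B) = mixed_coeff j A B"
  using assms mixed_coeff_scaled[of "(+) u ` A" "(+) v ` B" A B j 1]
  by (simp add: convex_body_translation dilsum_translation measure_translation)

text \<open>Each coefficient is a fixed combination of the volumes at t = 1, ..., n + 1, so
  convergence of volumes suffices.\<close>

lemma mixed_coeff_tendsto:
  assumes "convex_body A" "convex_body B" "\<And>k. convex_body (A' k)" "\<And>k. convex_body (B' k)"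
    and "j \<le> CARD('n)"
    and lim: "\<And>t. t > 0 \<Longrightarrow> (\<lambda>k. measure lebesgue (dilsum t (A' k) (B' k)))
        \<longlonglongrightarrow> measure lebesgue (dilsum t A B)"
  shows "(\<lambda>k. mixed_coeff j (A' k) (B' k)) \<longlonglongrightarrow> mixed_coeff j A B"
proof -
  let ?n = "CARD('n)"
  obtain w :: "nat \<Rightarrow> real" where
    w: "\<And>a. (\<Sum>i\<le>?n. w i * (\<Sum>m\<le>?n. a m * real (Suc i) ^ m)) = a j"
    using polynomial_coeff_functional[OF assms(5)] by blast
  have rep: "mixed_coeff j X Y = (\<Sum>i\<le>?n. w i * measure lebesgue (dilsum (real (Suc i)) X Y))"
    if "convex_body X" "convex_body Y" for X Y
    using w[of "\<lambda>m. mixed_coeff m X Y"] that by (simp add: volume_dilsum)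
  show ?thesis
    unfolding rep[OF assms(1,2)] rep[OF assms(3,4)]
    by (intro tendsto_intros lim) simp
qed

end

section \<open>Mixed subdivisions\<close>

definition max_face :: "'a::euclidean_space \<Rightarrow> 'a set \<Rightarrow> 'a set" where
  "max_face q A = {a \<in> A. \<forall>a'\<in>A. q \<bullet> a' \<le> q \<bullet> a}"

lemma max_face_subset: "max_face q A \<subseteq> A"
  by (auto simp: max_face_def)

lemma max_face_scaleR: "c > 0 \<Longrightarrow> max_face (c *\<^sub>R q) A = max_face q A"
  by (auto simp: max_face_def)

lemma max_face_eq_Int_hyperplane:
  assumes "compact A" "A \<noteq> {}"
  obtains m where "max_face q A = A \<inter> {x. q \<bullet> x = m}" "\<And>a. a \<in> A \<Longrightarrow> q \<bullet> a \<le> m" "max_face q A \<noteq> {}"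
proof -
  have "continuous_on A (\<lambda>x. q \<bullet> x)"
    by (intro continuous_intros)
  then obtain a where a: "a \<in> A" "\<forall>a'\<in>A. q \<bullet> a' \<le> q \<bullet> a"
    using continuous_attains_sup[OF assms] by blast
  then show thesis
    by (intro that[of "q \<bullet> a"]) (auto simp: max_face_def intro: antisym)
qed

lemma max_face_face_of: "convex_body A \<Longrightarrow> max_face q A face_of A"
  using face_of_Int_supporting_hyperplane_le max_face_eq_Int_hyperplane
  unfolding convex_body_def by metis

lemma convex_body_max_face:
  assumes "convex_body A"
  shows "convex_body (max_face q A)"
proof -
  obtain m where "max_face q A = A \<inter> {x. q \<bullet> x = m}" "max_face q A \<noteq> {}"
    using max_face_eq_Int_hyperplane assms unfolding convex_body_def by metis
  then show ?thesis
    using assms by (auto simp: convex_body_def compact_Int_closed closed_hyperplane convex_Int convex_hyperplane)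
qed

lemma polytope_convex_body: "polytope A \<Longrightarrow> A \<noteq> {} \<Longrightarrow> convex_body A"
  by (simp add: convex_body_def polytope_imp_compact polytope_imp_convex)

lemma finite_max_faces:
  assumes "polytope A" "A \<noteq> {}"
  shows "finite (range (\<lambda>q. max_face q A))"
proof (rule finite_subset)
  show "range (\<lambda>q. max_face q A) \<subseteq> {F. F face_of A}"
    using assms max_face_face_of polytope_convex_body by blast
qed (rule finite_polytope_faces[OF assms(1)])

text \<open>Lift \<open>t *\<^sub>R a + P b\<close> to the height \<open>w \<bullet> b\<close>. For
  self-adjoint \<open>P\<close>, the functional \<open>q\<close> plus the height equals
  \<open>t * (q \<bullet> a) + (P q + w) \<bullet> b\<close>, so it is maximal exactly on a sum of
  two faces. Used with \<open>P\<close> the identity or \<open>zero_coords {p}\<close>.\<close>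

definition cell :: "('a::euclidean_space \<Rightarrow> 'a) \<Rightarrow> 'a \<Rightarrow> real \<Rightarrow> 'a set \<Rightarrow> 'a set \<Rightarrow> 'a \<Rightarrow> 'a set" where
  "cell P w t A B q = dilsum t (max_face q A) (P ` max_face (P q + w) B)"

lemma cell_subset: "cell P w t A B q \<subseteq> dilsum t A (P ` B)"
  unfolding cell_def by (intro dilsum_mono image_mono max_face_subset)

lemma convex_body_cell:
  "convex_body A \<Longrightarrow> convex_body B \<Longrightarrow> linear P \<Longrightarrow> convex_body (cell P w t A B q)"
  unfolding cell_def by (intro convex_body_dilsum convex_body_linear_image convex_body_max_face)

text \<open>At a common point both cells assign the same height, because each decomposition is
  maximal among all with that sum. Comparing two common points then shows that \<open>q - r\<close>
  is constant on the intersection, which thus lies in a hyperplane.\<close>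

lemma negligible_cell_Int:
  fixes P :: "'a::euclidean_space \<Rightarrow> 'a"
  assumes adj: "\<And>u v. P u \<bullet> v = u \<bullet> P v" and "t > 0" "q \<noteq> r"
  shows "negligible (cell P w t A B q \<inter> cell P w t A B r)"
proof (cases "cell P w t A B q \<inter> cell P w t A B r = {}")
  case False
  have dec: "\<exists>b\<in>max_face (P q + w) B. \<exists>a\<in>max_face q A. x = t *\<^sub>R a + P b" if "x \<in> cell P w t A B q" for x q
    using that by (auto simp: cell_def dilsum_def)
  have le: "q \<bullet> y + w \<bullet> b' \<le> q \<bullet> x + w \<bullet> b"
    if "x = t *\<^sub>R a + P b" "a \<in> max_face q A" "b \<in> max_face (P q + w) B"
      and "y = t *\<^sub>R a' + P b'" "a' \<in> A" "b' \<in> B" for q x y a b a' b'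
  proof -
    have "t * (q \<bullet> a') \<le> t * (q \<bullet> a)" "(P q + w) \<bullet> b' \<le> (P q + w) \<bullet> b"
      using that \<open>t > 0\<close> by (auto simp: max_face_def)
    then show ?thesis
      using that by (simp add: inner_add_left inner_add_right adj)
  qed
  obtain x0 where x0: "x0 \<in> cell P w t A B q" "x0 \<in> cell P w t A B r"
    using False by blast
  have "(q - r) \<bullet> x = (q - r) \<bullet> x0" if x: "x \<in> cell P w t A B q" "x \<in> cell P w t A B r" for x
  proof -
    obtain a1 b1 a2 b2 where xd: "x = t *\<^sub>R a1 + P b1" "a1 \<in> max_face q A" "b1 \<in> max_face (P q + w) B"
       "x = t *\<^sub>R a2 + P b2" "a2 \<in> max_face r A" "b2 \<in> max_face (P r + w) B"
      using dec x by metis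
    obtain c1 d1 c2 d2 where x0d: "x0 = t *\<^sub>R c1 + P d1" "c1 \<in> max_face q A" "d1 \<in> max_face (P q + w) B"
       "x0 = t *\<^sub>R c2 + P d2" "c2 \<in> max_face r A" "d2 \<in> max_face (P r + w) B"
      using dec x0 by metis
    have A: "a1 \<in> A" "a2 \<in> A" "c1 \<in> A" "c2 \<in> A" "b1 \<in> B" "b2 \<in> B" "d1 \<in> B" "d2 \<in> B"
      using xd x0d max_face_subset by blast+
    have "w \<bullet> b1 = w \<bullet> b2" "w \<bullet> d1 = w \<bullet> d2"
      using le[OF xd(1-3) xd(4)] le[OF xd(4-6) xd(1)] le[OF x0d(1-3) x0d(4)] le[OF x0d(4-6) x0d(1)] A
      by (fastforce intro: antisym)+
    moreover have "q \<bullet> x + w \<bullet> b1 = q \<bullet> x0 + w \<bullet> d1"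
      using le[OF xd(1-3) x0d(1)] le[OF x0d(1-3) xd(1)] A by (fastforce intro: antisym)
    moreover have "r \<bullet> x + w \<bullet> b2 = r \<bullet> x0 + w \<bullet> d2"
      using le[OF xd(4-6) x0d(4)] le[OF x0d(4-6) xd(4)] A by (fastforce intro: antisym)
    ultimately show ?thesis
      by (simp add: inner_diff_left)
  qed
  then have "cell P w t A B q \<inter> cell P w t A B r \<subseteq> {x. (q - r) \<bullet> x = (q - r) \<bullet> x0}"
    by blast
  then show ?thesis
    using negligible_hyperplane[of "q - r"] assms(3) negligible_subset by (metis right_minus_eq)
qed simp

text \<open>Over an interior point of the base, a hyperplane supporting the body lifted by \<open>w \<bullet> b\<close> is not
  vertical; its slope is \<open>q\<close>.\<close>

lemma interior_dilsum_cell: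
  fixes P :: "'a::euclidean_space \<Rightarrow> 'a"
  assumes A: "convex_body A" and B: "convex_body B" and P: "linear P"
    and adj: "\<And>u v. P u \<bullet> v = u \<bullet> P v" and t: "t > 0"
    and x: "x \<in> interior (dilsum t A (P ` B))"
  shows "\<exists>q. \<exists>a\<in>max_face q A. \<exists>b\<in>max_face (P q + w) B. x = t *\<^sub>R a + P b"
proof -
  define M where "M = (\<lambda>(a, b). (t *\<^sub>R a + P b, w \<bullet> b)) ` (A \<times> B)"
  have lin: "linear (\<lambda>(a, b). (t *\<^sub>R a + P b, w \<bullet> b))"
    using P by (auto intro!: linearI simp: linear_add linear_scale algebra_simps inner_add_right)
  have M: "compact M" "convex M"
    using A B lin unfolding M_def convex_body_def
    by (auto intro!: compact_continuous_image compact_Times linear_continuous_on convex_linear_image convex_Times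
        simp: linear_linear)
  let ?F = "{b \<in> B. x - P b \<in> (\<lambda>a. t *\<^sub>R a) ` A}"
  have "x \<in> dilsum t A (P ` B)"
    using x interior_subset by blast
  then have ne: "M \<inter> {z. fst z = x} \<noteq> {}"
    by (fastforce simp: M_def dilsum_def)
  have "compact (M \<inter> {z. fst z = x})"
    by (intro compact_Int_closed M closed_Collect_eq continuous_intros)
  moreover have "continuous_on (M \<inter> {z. fst z = x}) snd"
    by (intro continuous_intros)
  ultimately obtain z where "z \<in> M \<inter> {z. fst z = x}" "\<forall>z'\<in>M \<inter> {z. fst z = x}. snd z' \<le> snd z"
    using continuous_attains_sup[OF _ ne, of snd] by blast
  then have z: "z \<in> M" "fst z = x" "\<And>z'. z' \<in> M \<Longrightarrow> fst z' = x \<Longrightarrow> snd z' \<le> snd z"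
    by auto
  define h where "h = snd z"
  obtain a0 b0 where ab: "a0 \<in> A" "b0 \<in> B" "x = t *\<^sub>R a0 + P b0" "h = w \<bullet> b0"
    using z by (auto simp: M_def h_def)
  \<comment> \<open>The open ray above the highest lifted point over \<open>x\<close>. Separating it
    from the lifted body yields the supporting hyperplane with normal \<open>(u, v)\<close>.\<close>
  let ?U = "{x} \<times> {h<..}"
  have "M \<inter> ?U = {}"
    using z by (force simp: h_def)
  then obtain n \<beta> where n: "n \<noteq> 0" "\<And>y. y \<in> M \<Longrightarrow> n \<bullet> y \<le> \<beta>" "\<And>y. y \<in> ?U \<Longrightarrow> n \<bullet> y \<ge> \<beta>"
  proof -
    have "\<exists>n \<beta>. n \<noteq> 0 \<and> (\<forall>y\<in>M. n \<bullet> y \<le> \<beta>) \<and> (\<forall>y\<in>?U. n \<bullet> y \<ge> \<beta>)"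
      using \<open>M \<inter> ?U = {}\<close> M ne by (intro separating_hyperplane_sets convex_Times) auto
    then show ?thesis
      using that by blast
  qed
  obtain u v where uv: "n = (u, v)" by (cases n)
  have up: "u \<bullet> x + v * k \<ge> \<beta>" if "k > h" for k
    using n(3)[of "(x, k)"] that by (simp add: uv)
  have dn: "u \<bullet> (t *\<^sub>R a + P b) + v * (w \<bullet> b) \<le> \<beta>" if "a \<in> A" "b \<in> B" for a b
  proof -
    have "(t *\<^sub>R a + P b, w \<bullet> b) \<in> M"
      using that by (auto simp: M_def intro!: image_eqI[of _ _ "(a, b)"])
    from n(2)[OF this] show ?thesis by (simp add: uv)
  qed
  have "u \<bullet> x + v * h \<le> \<beta>"
    using dn[OF ab(1,2)] ab by simp
  have v0: "v \<ge> 0"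
    using \<open>u \<bullet> x + v * h \<le> \<beta>\<close> up[of "h + 1"] by (simp add: algebra_simps)
  have top: "u \<bullet> x + v * h \<ge> \<beta>"
  proof (rule field_le_epsilon)
    fix e :: real assume "e > 0"
    then have "v * (e / (v + 1)) \<le> e"
      using v0 by (simp add: field_simps)
    moreover have "\<beta> \<le> u \<bullet> x + v * (h + e / (v + 1))"
      using v0 \<open>e > 0\<close> by (intro up) simp
    ultimately show "\<beta> \<le> u \<bullet> x + v * h + e"
      by (simp add: algebra_simps)
  qed
  \<comment> \<open>A vertical hyperplane would support the base at \<open>x\<close>, which is an
    interior point.\<close>
  have "v \<noteq> 0"
  proof
    assume "v = 0"
    then have "u \<noteq> 0" using n(1) uv by (simp add: zero_prod_def)
    obtain e where e: "e > 0" "ball x e \<subseteq> dilsum t A (P ` B)"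
      using x by (meson mem_interior)
    define y where "y = x + (e / 2 / norm u) *\<^sub>R u"
    have "y \<in> ball x e"
      using e \<open>u \<noteq> 0\<close> by (simp add: y_def dist_norm)
    then obtain a b where "a \<in> A" "b \<in> B" "y = t *\<^sub>R a + P b"
      using e by (auto simp: dilsum_def)
    then have "u \<bullet> y \<le> u \<bullet> x"
      using dn[of a b] top \<open>v = 0\<close> by simp
    moreover have "u \<bullet> y > u \<bullet> x"
      using e \<open>u \<noteq> 0\<close> by (simp add: y_def inner_add_right)
    ultimately show False by simp
  qed
  then have v: "v > 0" using v0 by simp
  define q where "q = (1 / v) *\<^sub>R u"
  have main: "q \<bullet> (t *\<^sub>R a + P b) + w \<bullet> b \<le> q \<bullet> (t *\<^sub>R a0 + P b0) + w \<bullet> b0" if "a \<in> A" "b \<in> B" for a b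
  proof -
    have "u \<bullet> (t *\<^sub>R a + P b) + v * (w \<bullet> b) \<le> u \<bullet> (t *\<^sub>R a0 + P b0) + v * (w \<bullet> b0)"
      using dn[OF that] top ab by simp
    then have "(1 / v) * (u \<bullet> (t *\<^sub>R a + P b) + v * (w \<bullet> b)) \<le> (1 / v) * (u \<bullet> (t *\<^sub>R a0 + P b0) + v * (w \<bullet> b0))"
      using v by (intro mult_left_mono) auto
    then show ?thesis
      using v by (simp add: q_def distrib_left)
  qed
  have "a0 \<in> max_face q A"
    using main[OF _ ab(2)] ab(1) t by (simp add: max_face_def inner_add_right)
  moreover have "b0 \<in> max_face (P q + w) B"
    using main[OF ab(1)] ab(2) by (simp add: max_face_def inner_add_right inner_add_left adj)
  ultimately show ?thesis
    using ab(3) by blast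
qed

text \<open>The set names the coordinates that are killed: \<open>Z\<close> of the overview is
  \<open>zero_coords {p}\<close>, and \<open>P\<^sub>J\<close> is
  \<open>zero_coords (- J)\<close>.\<close>

definition zero_coords :: "'n::finite set \<Rightarrow> real ^ 'n \<Rightarrow> real ^ 'n" where
  "zero_coords T x = (\<chi> i. if i \<in> T then 0 else x $ i)"

lemma zero_coords_nth [simp]: "zero_coords T x $ i = (if i \<in> T then 0 else x $ i)"
  by (simp add: zero_coords_def)

lemma linear_zero_coords [intro, simp]: "linear (zero_coords T)"
  by (auto intro!: linearI simp: vec_eq_iff)

lemma zero_coords_adjoint: "zero_coords T u \<bullet> v = u \<bullet> zero_coords T v"
  by (auto simp: inner_vec_def intro!: sum.cong)

lemma zero_coords_zero_coords [simp]: "zero_coords S (zero_coords T x) = zero_coords (S \<union> T) x"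
  by (auto simp: vec_eq_iff)

lemma zero_coords_singleton: "x = zero_coords {p} x + (x $ p) *\<^sub>R axis p 1"
  by (auto simp: vec_eq_iff axis_def)

lemma measure_eq_cover:
  fixes N U :: "'a::euclidean_space set"
  assumes "convex_body N" "compact U" "U \<subseteq> N" "interior N \<subseteq> U"
  shows "measure lebesgue N = measure lebesgue U"
proof (rule measure_negligible_symdiff)
  show "U \<in> lmeasurable"
    using assms(2) by (rule lmeasurable_compact)
  have "U - N \<union> (N - U) \<subseteq> frontier N"
    using assms closure_subset[of N] by (auto simp: frontier_def)
  then show "negligible (U - N \<union> (N - U))"
    using assms(1) negligible_convex_frontier negligible_subset by (auto simp: convex_body_def)
qed

text \<open>A polytope has finitely many faces but infinitely many slopes; this picks one slope per
  pair of faces from a prescribed range \<open>S\<close>.\<close>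

lemma finite_representatives:
  assumes "finite (range f)"
  obtains R where "finite R" "R \<subseteq> S" "\<And>q. q \<in> S \<Longrightarrow> \<exists>r\<in>R. f r = f q"
proof -
  have "finite (f ` S)"
    using assms finite_subset[of "f ` S" "range f"] by auto
  then obtain R where "R \<subseteq> S" "finite R" "f ` S = f ` R"
    using finite_subset_image[of "f ` S" f S] by auto
  then show thesis
    by (intro that[of R]) (auto simp: image_iff Bex_def set_eq_iff, metis)
qed

lemma halfspace_interior_pos:
  fixes p :: "'n::finite" and N :: "(real ^ 'n) set"
  assumes "N \<subseteq> {x. 0 \<le> x $ p}" "x \<in> interior N"
  shows "0 < x $ p"
proof -
  have ax: "axis p (1 :: real) \<bullet> y = y $ p" for y :: "real ^ 'n"
    by (simp add: inner_axis')
  have "x \<in> interior {x. axis p 1 \<bullet> x \<ge> 0}"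
    using interior_mono[of N "{x. axis p 1 \<bullet> x \<ge> 0}"] assms by (auto simp: ax)
  then show ?thesis
    by (subst (asm) interior_halfspace_ge) (auto simp: ax axis_eq_0_iff)
qed

text \<open>The lifting function is the \<open>p\<close>-th coordinate on \<open>B\<close> and zero on \<open>A\<close>. The cells of \<open>t A + B\<close>
  lying above \<open>t Z A + B\<close> are images of cells of \<open>t A + Z B\<close> under shears, because on each cell
  the lifting function is affine.\<close>

lemma mixed_subdivision:
  fixes A B :: "(real ^ 'n::finite) set" and p :: 'n
  defines "Z \<equiv> zero_coords {p}" and "e \<equiv> axis p 1"
  assumes A: "polytope A" "A \<noteq> {}" "\<And>x. x \<in> A \<Longrightarrow> 0 \<le> x $ p" "\<And>x. x \<in> A \<Longrightarrow> Z x \<in> A"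
    and B: "polytope B" "B \<noteq> {}" "\<And>x. x \<in> B \<Longrightarrow> 0 \<le> x $ p" "\<And>x. x \<in> B \<Longrightarrow> Z x \<in> B"
    and q0: "0 \<le> q0 $ p"
  obtains R1 R2 where "finite R1" "finite R2" "R1 \<subseteq> {q. 0 \<le> q $ p \<and> q $ p < 1}" "R2 \<subseteq> {q. 1 \<le> q $ p}"
    "q0 \<in> R1 \<union> R2"
    "\<And>t. t > 0 \<Longrightarrow> measure lebesgue (dilsum t A (Z ` B)) =
        (\<Sum>q\<in>R1 \<union> R2. measure lebesgue (cell Z e t A B q))"
    "\<And>t. t > 0 \<Longrightarrow> measure lebesgue (dilsum t A B) = measure lebesgue (dilsum t (Z ` A) B) +
        (\<Sum>q\<in>R1. (1 - q $ p) * measure lebesgue (cell Z e t A B q))"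
proof -
  have cA: "convex_body A" and cB: "convex_body B"
    using A(1,2) B(1,2) polytope_convex_body by blast+
  have linZ [simp]: "linear Z" and adjZ: "\<And>u v. Z u \<bullet> v = u \<bullet> Z v"
    by (auto simp: Z_def zero_coords_adjoint)
  have Zp [simp]: "Z x $ p = 0" for x
    by (simp add: Z_def)
  have ZZ: "Z (Z x) = Z x" for x
    by (simp add: Z_def)
  have dec: "x = Z x + (x $ p) *\<^sub>R e" for x
    unfolding Z_def e_def by (rule zero_coords_singleton)
  have ep [simp]: "e $ p = 1" and einner: "e \<bullet> x = x $ p" for x :: "real ^ 'n"
    by (simp_all add: e_def inner_axis')
  define f where "f q = (max_face q A, max_face (Z q + e) B)" for q
  have "finite (range f)"
  proof (rule finite_subset)
    show "range f \<subseteq> range (\<lambda>q. max_face q A) \<times> range (\<lambda>q. max_face q B)"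
      by (auto simp: f_def)
  qed (intro finite_cartesian_product finite_max_faces A B)
  note reps = finite_representatives[OF this]
  obtain R1' where R1': "finite R1'" "R1' \<subseteq> {q. 0 \<le> q $ p \<and> q $ p < 1}"
      "\<And>q. q \<in> {q. 0 \<le> q $ p \<and> q $ p < 1} \<Longrightarrow> \<exists>r\<in>R1'. f r = f q"
    by (rule reps) blast
  obtain R2' where R2': "finite R2'" "R2' \<subseteq> {q. 1 \<le> q $ p}"
      "\<And>q. q \<in> {q. 1 \<le> q $ p} \<Longrightarrow> \<exists>r\<in>R2'. f r = f q"
    by (rule reps) blast
  \<comment> \<open>Adding \<open>q0\<close> counts nothing twice: if another representative has the
    same cell, that cell is its own intersection for two distinct slopes and so has measure
    zero.\<close>
  define R1 where "R1 = (if q0 $ p < 1 then insert q0 R1' else R1')"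
  define R2 where "R2 = (if q0 $ p < 1 then R2' else insert q0 R2')"
  have R: "finite R1" "finite R2" "R1 \<subseteq> {q. 0 \<le> q $ p \<and> q $ p < 1}" "R2 \<subseteq> {q. 1 \<le> q $ p}"
      "q0 \<in> R1 \<union> R2"
    using R1' R2' q0 by (auto simp: R1_def R2_def)
  have rep1: "\<exists>r\<in>R1. f r = f q" if "0 \<le> q $ p" "q $ p < 1" for q
    using R1'(3)[of q] that by (auto simp: R1_def)
  have rep2: "\<exists>r\<in>R2. f r = f q" if "1 \<le> q $ p" for q
    using R2'(3)[of q] that by (auto simp: R2_def)
  have cb_cell: "convex_body (cell Z e t A B q)" for t q
    by (intro convex_body_cell cA cB linZ)
  show thesis
  proof (rule that[OF R])
    fix t :: real assume t: "t > 0"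
    let ?C = "dilsum t A (Z ` B)" and ?U = "\<Union>q\<in>R1 \<union> R2. cell Z e t A B q"
    have "measure lebesgue ?C = measure lebesgue ?U"
    proof (rule measure_eq_cover)
      show "convex_body ?C"
        by (intro convex_body_dilsum convex_body_linear_image cA cB linZ)
      show "compact ?U"
        using R cb_cell by (intro compact_UN) (auto simp: convex_body_def)
      show "?U \<subseteq> ?C"
        using cell_subset by blast
      show "interior ?C \<subseteq> ?U"
      proof
        fix x assume x: "x \<in> interior ?C"
        have "?C \<subseteq> {x. 0 \<le> x $ p}"
          using A(3) t by (auto simp: dilsum_def)
        then have xp: "0 < x $ p"
          using halfspace_interior_pos x by blast
        obtain q a b where q: "a \<in> max_face q A" "b \<in> max_face (Z q + e) B" "x = t *\<^sub>R a + Z b"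
          using interior_dilsum_cell[OF cA cB linZ adjZ t x, of e] by blast
        \<comment> \<open>The point \<open>Z a\<close> competes with \<open>a\<close> for the
          maximum of \<open>q\<close>, so \<open>a $ p * q $ p\<close> is nonnegative; with
          \<open>a $ p\<close> positive only slopes with \<open>0 \<le> q $ p\<close> occur.\<close>
        have ap: "0 < a $ p"
          using xp q(3) t by (simp add: zero_less_mult_iff)
        have "a \<in> A" "q \<bullet> Z a \<le> q \<bullet> a"
          using q(1) A(4) by (auto simp: max_face_def)
        moreover have "q \<bullet> a = q \<bullet> Z a + a $ p * q $ p"
          using arg_cong[OF dec[of a], of "\<lambda>v. q \<bullet> v"] by (simp add: inner_add_right inner_commute[of q e] einner)
        ultimately have "0 \<le> q $ p"
          using ap by (simp add: zero_le_mult_iff)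
        then obtain r where r: "r \<in> R1 \<union> R2" "f r = f q"
          using rep1[of q] rep2[of q] by (cases "q $ p < 1") auto
        then have "x \<in> cell Z e t A B r"
          using q unfolding cell_def f_def by (intro dilsumI[of a _ "Z b"]) auto
        then show "x \<in> ?U" using r by blast
      qed
    qed
    also have "\<dots> = (\<Sum>q\<in>R1 \<union> R2. measure lebesgue (cell Z e t A B q))"
      using R t adjZ cb_cell
      by (intro measure_negligible_finite_Union_image)
         (auto simp: pairwise_def intro!: negligible_cell_Int)
    finally show "measure lebesgue ?C = (\<Sum>q\<in>R1 \<union> R2. measure lebesgue (cell Z e t A B q))" .
  next
    fix t :: real assume t: "t > 0"
    let ?N = "dilsum t A B" and ?M = "dilsum t (Z ` A) B"
    define up where "up q = dilsum t (max_face q A) (max_face (Z q + e) B)" for q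
    \<comment> \<open>The slope of the same pair of faces in the subdivision of
      \<open>t A + B\<close> itself, where \<open>P\<close> is the identity. It is the multiple of
      \<open>q\<close> for which \<open>s q + e\<close> is parallel to
      \<open>Z q + e\<close>.\<close>
    define s where "s q = (1 / (1 - q $ p)) *\<^sub>R q" for q :: "real ^ 'n"
    have up_cell: "up q = cell id e t A B (s q)" if "q $ p < 1" for q
    proof -
      have "s q + e = (1 / (1 - q $ p)) *\<^sub>R (Z q + e)"
      proof -
        have "q $ p / (1 - q $ p) + 1 = 1 / (1 - q $ p)"
          using that add_divide_distrib[of "q $ p" "1 - q $ p" "1 - q $ p"] by simp
        then show ?thesis
          by (auto simp: s_def vec_eq_iff Z_def e_def axis_def)
      qed
      then show ?thesis
        using that by (simp add: up_def cell_def max_face_scaleR s_def)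
    qed
    have cb_up: "convex_body (up q)" for q
      unfolding up_def by (intro convex_body_dilsum convex_body_max_face cA cB)
    have s_inj: "q = r" if "s q = s r" "q $ p < 1" "r $ p < 1" for q r
    proof -
      have "q $ p / (1 - q $ p) = r $ p / (1 - r $ p)"
        using arg_cong[OF that(1), of "\<lambda>v. v $ p"] by (simp add: s_def)
      then have "q $ p = r $ p"
        using that(2,3) by (simp add: field_simps)
      then show ?thesis
        using that by (simp add: s_def)
    qed
    have cover: "interior ?N \<subseteq> ?M \<union> (\<Union>q\<in>R1. up q)"
    proof
      fix x assume "x \<in> interior ?N"
      then obtain q a b where q: "a \<in> max_face q A" "b \<in> max_face (q + e) B" "x = t *\<^sub>R a + b"
        using interior_dilsum_cell[OF cA cB linear_id _ t, of x e] by auto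
      have aA: "a \<in> A" "b \<in> B" "q \<bullet> Z a \<le> q \<bullet> a"
        using q A(4) by (auto simp: max_face_def)
      have qa: "q \<bullet> a = q \<bullet> Z a + a $ p * q $ p"
        using arg_cong[OF dec[of a], of "\<lambda>v. q \<bullet> v"] by (simp add: inner_add_right inner_commute[of q e] einner)
      show "x \<in> ?M \<union> (\<Union>q\<in>R1. up q)"
      proof (cases "0 \<le> q $ p")
        case True
        \<comment> \<open>Rescaling by \<open>c\<close> inverts \<open>s\<close> and brings the
          slope into the range of \<open>R1\<close>.\<close>
        define c where "c = 1 / (1 + q $ p)"
        have c: "c > 0" using True by (simp add: c_def)
        have "Z (c *\<^sub>R q) + e = c *\<^sub>R (q + e)"
        proof -
          have "c * (q $ p + 1) = 1"
            using True by (simp add: c_def add.commute)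
          then show ?thesis
            by (auto simp: vec_eq_iff Z_def e_def axis_def)
        qed
        then have f: "f (c *\<^sub>R q) = (max_face q A, max_face (q + e) B)"
          using c by (simp add: f_def max_face_scaleR)
        have "0 \<le> (c *\<^sub>R q) $ p" "(c *\<^sub>R q) $ p < 1"
          using True by (auto simp: c_def)
        then obtain r where "r \<in> R1" "f r = f (c *\<^sub>R q)"
          using rep1 by blast
        then show ?thesis
          using f q by (auto simp: up_def f_def intro!: dilsumI)
      next
        case False
        \<comment> \<open>A negative slope forces the maximiser down to the wall
          \<open>x $ p = 0\<close>, so the point belongs to \<open>t Z A + B\<close>.\<close>
        then have "a $ p = 0"
          using aA qa A(3)[OF aA(1)] by (simp add: zero_le_mult_iff)
        then have "Z a = a"
          using dec[of a] by simp
        then show ?thesis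
          using q(3) aA by (metis UnI1 dilsumI imageI)
      qed
    qed
    have vol_up: "measure lebesgue (up q) = (1 - q $ p) * measure lebesgue (cell Z e t A B q)" if qp: "q $ p < 1" for q
    proof -
      obtain mA where mA: "max_face q A = A \<inter> {x. q \<bullet> x = mA}"
        using max_face_eq_Int_hyperplane cA unfolding convex_body_def by metis
      obtain mB where mB: "max_face (Z q + e) B = B \<inter> {x. (Z q + e) \<bullet> x = mB}"
        using max_face_eq_Int_hyperplane cB unfolding convex_body_def by metis
      let ?L = "\<lambda>x. x - (q \<bullet> x) *\<^sub>R e"
      define c where "c = t * mA + mB"
      have "t *\<^sub>R a + b = c *\<^sub>R e + ?L (t *\<^sub>R a + Z b)"
        if "a \<in> max_face q A" "b \<in> max_face (Z q + e) B" for a b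
      proof -
        have "b $ p = c - q \<bullet> (t *\<^sub>R a + Z b)"
          using that by (simp add: mA mB c_def inner_add_left inner_add_right einner adjZ)
        have "t *\<^sub>R a + b = (t *\<^sub>R a + Z b) + (b $ p) *\<^sub>R e"
          using dec[of b] by (simp add: add.assoc)
        also have "(b $ p) *\<^sub>R e = c *\<^sub>R e - (q \<bullet> (t *\<^sub>R a + Z b)) *\<^sub>R e"
          unfolding \<open>b $ p = _\<close> by (rule scaleR_diff_left)
        finally show ?thesis
          by (simp only: add_diff_eq diff_add_eq add_ac)
      qed
      then have "up q = (+) (c *\<^sub>R e) ` ?L ` cell Z e t A B q"
        unfolding up_def cell_def dilsum_def by (force simp: image_iff)
      then have "measure lebesgue (up q) = measure lebesgue (?L ` cell Z e t A B q)"
        by (simp add: measure_translation)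
      also have "\<dots> = (1 - q $ p) * measure lebesgue (cell Z e t A B q)"
        using volume_factor_shear[OF qp] cb_cell unfolding e_def
        by (intro volume_factorD) (auto simp: convex_body_def)
      finally show ?thesis .
    qed
    have disj0: "negligible (?M \<inter> up q)" if q: "0 \<le> q $ p" "q $ p < 1" for q
    proof -
      \<comment> \<open>On \<open>?M\<close> the functional \<open>Z q + e\<close> is at most
        \<open>t * (q \<bullet> a) + (Z q + e) \<bullet> b\<close>. Since \<open>q $ p < 1\<close>,
        a point of \<open>up q\<close> already reaches this bound, so it cannot be moved upwards
        within \<open>?M\<close>.\<close>
      have "x \<notin> interior ?M" if x: "x \<in> up q" for x
      proof
        assume "x \<in> interior ?M"
        then obtain \<epsilon> where \<epsilon>: "\<epsilon> > 0" "cball x \<epsilon> \<subseteq> ?M"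
          by (meson mem_interior_cball)
        have "x + \<epsilon> *\<^sub>R e \<in> cball x \<epsilon>"
          using \<epsilon>(1) by (simp add: dist_norm e_def)
        then obtain a' b' where ab': "a' \<in> A" "b' \<in> B" "x + \<epsilon> *\<^sub>R e = t *\<^sub>R Z a' + b'"
          using \<epsilon>(2) by (auto simp: dilsum_def)
        obtain a b where ab: "a \<in> max_face q A" "b \<in> max_face (Z q + e) B" "x = t *\<^sub>R a + b"
          using x by (auto simp: up_def dilsum_def)
        have le: "q \<bullet> Z a' \<le> q \<bullet> a" "(Z q + e) \<bullet> b' \<le> (Z q + e) \<bullet> b" "a \<in> A"
          using ab ab' A(4) by (auto simp: max_face_def)
        have "(Z q + e) \<bullet> x + \<epsilon> = (Z q + e) \<bullet> (x + \<epsilon> *\<^sub>R e)"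
          by (simp add: inner_add_left inner_add_right einner inner_commute[of "Z q" e])
        also have "\<dots> = t * (q \<bullet> Z a') + (Z q + e) \<bullet> b'"
          unfolding ab'(3) by (simp add: inner_add_left inner_add_right einner adjZ ZZ)
        also have "\<dots> \<le> t * (q \<bullet> a) + (Z q + e) \<bullet> b"
          using le t by (intro add_mono mult_left_mono) auto
        also have "q \<bullet> a = q \<bullet> Z a + a $ p * q $ p"
          using arg_cong[OF dec[of a], of "\<lambda>v. q \<bullet> v"] by (simp add: inner_add_right inner_commute[of q e] einner)
        finally have "(Z q + e) \<bullet> x + \<epsilon> \<le> t * (q \<bullet> Z a + a $ p * q $ p) + (Z q + e) \<bullet> b" .
        moreover have "(Z q + e) \<bullet> x = t * (q \<bullet> Z a + a $ p) + (Z q + e) \<bullet> b"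
          unfolding ab(3) by (simp add: inner_add_left inner_add_right einner adjZ distrib_left)
        ultimately have "\<epsilon> + t * (a $ p * (1 - q $ p)) \<le> 0"
          by (simp add: algebra_simps)
        moreover have "0 \<le> t * (a $ p * (1 - q $ p))"
          using t A(3)[OF le(3)] q by simp
        ultimately show False
          using \<epsilon>(1) by simp
      qed
      then have "?M \<inter> up q \<subseteq> frontier ?M"
        using closure_subset by (auto simp: frontier_def)
      moreover have "convex ?M"
        using convex_body_dilsum[OF convex_body_linear_image[OF linZ cA] cB] by (simp add: convex_body_def)
      ultimately show ?thesis
        using negligible_convex_frontier negligible_subset by blast
    qed
    have cb0: "convex_body ?M"
      by (intro convex_body_dilsum convex_body_linear_image cA cB linZ)
    have comp: "compact (\<Union>q\<in>R1. up q)"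
      using R cb_up by (intro compact_UN) (auto simp: convex_body_def)
    have "measure lebesgue ?N = measure lebesgue (?M \<union> (\<Union>q\<in>R1. up q))"
    proof (rule measure_eq_cover)
      show "convex_body ?N"
        by (intro convex_body_dilsum cA cB)
      show "compact (?M \<union> (\<Union>q\<in>R1. up q))"
        using comp cb0 by (intro compact_Un) (auto simp: convex_body_def)
      show "?M \<union> (\<Union>q\<in>R1. up q) \<subseteq> ?N"
        using A(4) dilsum_mono[of "Z ` A" A B B t] dilsum_mono[OF max_face_subset max_face_subset]
        unfolding up_def by blast
    qed (fact cover)
    also have "\<dots> = measure lebesgue ?M + measure lebesgue (\<Union>q\<in>R1. up q) + measure lebesgue ({} :: (real ^ 'n) set)"
    proof (rule measure_Un3_negligible)
      have "negligible (\<Union>q\<in>R1. ?M \<inter> up q)"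
        using R(1,3) disj0 by (intro negligible_Union) auto
      then show "negligible (?M \<inter> (\<Union>q\<in>R1. up q))"
        by simp
    qed (use cb0 comp lmeasurable_compact in auto)
    also have "measure lebesgue (\<Union>q\<in>R1. up q) = (\<Sum>q\<in>R1. measure lebesgue (up q))"
    proof (rule measure_negligible_finite_Union_image)
      show "pairwise (\<lambda>x y. negligible (up x \<inter> up y)) R1"
        unfolding pairwise_def
      proof (intro ballI impI)
        fix q r assume "q \<in> R1" "r \<in> R1" "q \<noteq> r"
        then have "q $ p < 1" "r $ p < 1" "s q \<noteq> s r"
          using R(3) s_inj by auto
        then show "negligible (up q \<inter> up r)"
          using negligible_cell_Int[of id t "s q" "s r"] t by (simp add: up_cell)
      qed
    qed (use R cb_up in auto)
    also have "\<dots> = (\<Sum>q\<in>R1. (1 - q $ p) * measure lebesgue (cell Z e t A B q))"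
      using R(3) vol_up by (intro sum.cong) auto
    finally show "measure lebesgue ?N = measure lebesgue ?M +
        (\<Sum>q\<in>R1. (1 - q $ p) * measure lebesgue (cell Z e t A B q))" by simp
  qed
qed

section \<open>Discarding one coordinate\<close>

definition reflect_coord :: "'n::finite \<Rightarrow> real ^ 'n \<Rightarrow> real ^ 'n" where
  "reflect_coord p x = (\<chi> i. (if i = p then - 1 else 1) * x $ i)"

lemma reflect_coord_nth [simp]: "reflect_coord p x $ i = (if i = p then - x $ i else x $ i)"
  by (simp add: reflect_coord_def)

lemma linear_reflect_coord [intro, simp]: "linear (reflect_coord p)"
  by (auto intro!: linearI simp: vec_eq_iff)

lemma volume_factor_reflect_coord: "volume_factor (reflect_coord p) 1"
  using volume_factor_stretch[of "\<lambda>i. if i = p then - 1 else 1"]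
  by (simp add: prod.delta reflect_coord_def[abs_def])

lemma reflect_coord_reflect_coord [simp]: "reflect_coord p (reflect_coord p x) = x"
  by (simp add: vec_eq_iff)

lemma zero_reflect_coord [simp]: "zero_coords {p} (reflect_coord p x) = zero_coords {p} x"
  by (simp add: vec_eq_iff)

lemma reflect_zero_coord [simp]: "reflect_coord p (zero_coords {p} x) = zero_coords {p} x"
  by (simp add: vec_eq_iff)

abbreviation nonneg_part :: "'n::finite \<Rightarrow> (real ^ 'n) set \<Rightarrow> (real ^ 'n) set" where
  "nonneg_part p A \<equiv> A \<inter> {x. 0 \<le> x $ p}"

lemma halfspace_eq: "{x :: real ^ 'n::finite. 0 \<le> x $ p} = {x. axis p 1 \<bullet> x \<ge> 0}"
  by (simp add: inner_axis')

lemma convex_body_nonneg_part: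
  assumes "convex_body A" "\<And>x. x \<in> A \<Longrightarrow> zero_coords {p} x \<in> A"
  shows "convex_body (nonneg_part p A)"
proof -
  obtain x where "x \<in> A"
    using assms(1) by (auto simp: convex_body_def)
  then have "zero_coords {p} x \<in> nonneg_part p A"
    using assms(2) by simp
  then show ?thesis
    using assms(1) unfolding convex_body_def halfspace_eq
    by (auto intro!: compact_Int_closed convex_Int closed_halfspace_ge convex_halfspace_ge)
qed

lemma segment_to_zero_coord:
  assumes "convex A" "x \<in> A" "zero_coords {p} x \<in> A" "0 \<le> u" "u \<le> 1"
  shows "x - (u * x $ p) *\<^sub>R axis p 1 \<in> A"
proof -
  have "x - (u * x $ p) *\<^sub>R axis p 1 = (1 - u) *\<^sub>R x + u *\<^sub>R zero_coords {p} x"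
    by (auto simp: vec_eq_iff axis_def algebra_simps)
  then show ?thesis
    using assms convexD[of A x "zero_coords {p} x" "1 - u" u] by simp
qed

text \<open>If one summand is below the wall, project it to the wall and shorten the other summand
  along its segment to the wall by the same amount; the sum is unchanged.\<close>

lemma nonneg_part_dilsum:
  assumes A: "convex A" "\<And>x. x \<in> A \<Longrightarrow> zero_coords {p} x \<in> A"
    and B: "convex B" "\<And>x. x \<in> B \<Longrightarrow> zero_coords {p} x \<in> B" and t: "t > 0"
  shows "nonneg_part p (dilsum t A B) = dilsum t (nonneg_part p A) (nonneg_part p B)"
proof
  show "dilsum t (nonneg_part p A) (nonneg_part p B) \<subseteq> nonneg_part p (dilsum t A B)"
    using t by (auto simp: dilsum_def)
  show "nonneg_part p (dilsum t A B) \<subseteq> dilsum t (nonneg_part p A) (nonneg_part p B)"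
  proof
    fix x assume "x \<in> nonneg_part p (dilsum t A B)"
    then obtain a b where ab: "a \<in> A" "b \<in> B" "x = t *\<^sub>R a + b" "0 \<le> t * a $ p + b $ p"
      by (auto simp: dilsum_def)
    consider "0 \<le> a $ p" "0 \<le> b $ p" | "b $ p < 0" | "a $ p < 0" by linarith
    then show "x \<in> dilsum t (nonneg_part p A) (nonneg_part p B)"
    proof cases
      case 1
      then show ?thesis using ab by (intro dilsumI) auto
    next
      case 2
      then have ap: "0 < a $ p"
        using ab(4) t by (smt (verit) mult_nonneg_nonpos)
      \<comment> \<open>Chosen so that lowering \<open>t * a $ p\<close> by the fraction
        \<open>u\<close> compensates for raising \<open>b $ p\<close> to zero.\<close>
      define u where "u = - b $ p / (t * a $ p)"
      have u: "0 \<le> u" "u \<le> 1"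
        using 2 ab(4) ap t by (auto simp: u_def field_simps)
      have "a - (u * a $ p) *\<^sub>R axis p 1 \<in> A"
        using segment_to_zero_coord A ab(1) u by blast
      moreover have "zero_coords {p} b \<in> B"
        using B ab by blast
      moreover have "x = t *\<^sub>R (a - (u * a $ p) *\<^sub>R axis p 1) + zero_coords {p} b"
        using ab(3) ap t by (auto simp: vec_eq_iff axis_def u_def field_simps)
      moreover have "0 \<le> (a - (u * a $ p) *\<^sub>R axis p 1) $ p"
        using u ap by (simp add: mult_left_le_one_le)
      ultimately show ?thesis by (intro dilsumI) auto
    next
      case 3
      then have bp: "0 < b $ p"
        using ab(4) t by (smt (verit) mult_pos_neg)
      define u where "u = - (t * a $ p) / b $ p"
      have u: "0 \<le> u" "u \<le> 1"
        using 3 ab(4) bp t by (auto simp: u_def field_simps mult_nonneg_nonpos mult_nonpos_nonneg)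
      have "b - (u * b $ p) *\<^sub>R axis p 1 \<in> B"
        using segment_to_zero_coord B ab(2) u by blast
      moreover have "zero_coords {p} a \<in> A"
        using A ab by blast
      moreover have "x = t *\<^sub>R zero_coords {p} a + (b - (u * b $ p) *\<^sub>R axis p 1)"
        using ab(3) bp t by (auto simp: vec_eq_iff axis_def u_def field_simps)
      moreover have "0 \<le> (b - (u * b $ p) *\<^sub>R axis p 1) $ p"
        using u bp by (simp add: mult_left_le_one_le)
      ultimately show ?thesis by (intro dilsumI) auto
    qed
  qed
qed

lemma measure_split_halfspace:
  fixes N :: "(real ^ 'n::finite) set"
  assumes "compact N"
  shows "measure lebesgue N =
    measure lebesgue (nonneg_part p N) + measure lebesgue (nonneg_part p (reflect_coord p ` N))"
proof -
  let ?M = "N \<inter> {x. x $ p \<le> 0}"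
  have cl: "closed {x :: real ^ 'n. 0 \<le> x $ p}" "closed {x :: real ^ 'n. x $ p \<le> 0}"
    by (auto intro!: closed_Collect_le continuous_intros)
  have "measure lebesgue N = measure lebesgue (nonneg_part p N) + measure lebesgue ?M
      + measure lebesgue ({} :: (real ^ 'n) set)"
  proof (rule measure_Un3_negligible)
    have "negligible {x. axis p (1 :: real) \<bullet> x = 0}"
      by (intro negligible_hyperplane) (simp add: axis_eq_0_iff)
    then show "negligible (nonneg_part p N \<inter> ?M)"
      by (rule negligible_subset) (auto simp: inner_axis')
  qed (use assms cl in \<open>auto intro!: lmeasurable_compact compact_Int_closed\<close>)
  moreover have "measure lebesgue ?M = measure lebesgue (reflect_coord p ` ?M)"
    using volume_factorD[OF volume_factor_reflect_coord[of p]] assms cl by (simp add: compact_Int_closed)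
  moreover have "reflect_coord p ` ?M = nonneg_part p (reflect_coord p ` N)"
    by auto
  ultimately show ?thesis by simp
qed

context mixed_volume
begin

lemma mixed_coeff_add:
  assumes "convex_body A" "convex_body B" "convex_body A1" "convex_body B1" "finite R"
    and FG: "\<And>q. q \<in> R \<Longrightarrow> convex_body (F q)" "\<And>q. q \<in> R \<Longrightarrow> convex_body (G q)" "j \<le> CARD('n)"
    and vol: "\<And>t. t > 0 \<Longrightarrow> measure lebesgue (dilsum t A B) =
        c * measure lebesgue (dilsum t A1 B1) + (\<Sum>q\<in>R. w q * measure lebesgue (dilsum t (F q) (G q)))"
  shows "mixed_coeff j A B = c * mixed_coeff j A1 B1 + (\<Sum>q\<in>R. w q * mixed_coeff j (F q) (G q))"
proof (rule mixed_coeff_eqI)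
  fix t :: real assume t: "t > 0"
  have "(\<Sum>q\<in>R. w q * measure lebesgue (dilsum t (F q) (G q))) =
      (\<Sum>q\<in>R. \<Sum>i\<le>CARD('n). w q * mixed_coeff i (F q) (G q) * t ^ i)"
    using FG t by (intro sum.cong) (simp_all add: volume_dilsum sum_distrib_left mult.assoc)
  also have "\<dots> = (\<Sum>i\<le>CARD('n). (\<Sum>q\<in>R. w q * mixed_coeff i (F q) (G q)) * t ^ i)"
    by (subst sum.swap) (simp add: sum_distrib_right)
  finally show "measure lebesgue (dilsum t A B) =
      (\<Sum>i\<le>CARD('n). (c * mixed_coeff i A1 B1 + (\<Sum>q\<in>R. w q * mixed_coeff i (F q) (G q))) * t ^ i)"
    using vol[OF t] assms(3,4) t
    by (simp add: volume_dilsum sum_distrib_left mult.assoc distrib_right sum.distrib)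
qed (use assms in auto)

text \<open>Subtracting the two expansions of the subdivision leaves the weight
  \<open>1 - (1 - q $ p)\<close> for slopes in \<open>R1\<close> and the weight 1 for those in
  \<open>R2\<close>, that is \<open>min 1 (q $ p)\<close>. All terms are nonnegative, and the one of
  \<open>q0\<close> is kept as the source of strictness.\<close>

lemma mixed_coeff_step_nonneg_polytope:
  fixes p :: 'n
  defines "Z \<equiv> zero_coords {p}" and "e \<equiv> axis p 1"
  assumes A: "polytope A" "A \<noteq> {}" "\<And>x. x \<in> A \<Longrightarrow> 0 \<le> x $ p" "\<And>x. x \<in> A \<Longrightarrow> Z x \<in> A"
    and B: "polytope B" "B \<noteq> {}" "\<And>x. x \<in> B \<Longrightarrow> 0 \<le> x $ p" "\<And>x. x \<in> B \<Longrightarrow> Z x \<in> B"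
    and q0: "0 \<le> q0 $ p" and j: "j \<le> CARD('n)"
  shows "mixed_coeff j A B + min 1 (q0 $ p) * mixed_coeff j (max_face q0 A) (Z ` max_face (Z q0 + e) B)
    \<le> mixed_coeff j A (Z ` B) + mixed_coeff j (Z ` A) B"
proof -
  have cA: "convex_body A" and cB: "convex_body B"
    using A(1,2) B(1,2) polytope_convex_body by blast+
  have linZ: "linear Z" by (simp add: Z_def)
  define m where "m q = mixed_coeff j (max_face q A) (Z ` max_face (Z q + e) B)" for q
  have cF: "convex_body (max_face q A)" and cG: "convex_body (Z ` max_face (Z q + e) B)" for q
    by (intro convex_body_max_face convex_body_linear_image linZ cA cB)+
  obtain R1 R2 where R: "finite R1" "finite R2" "R1 \<subseteq> {q. 0 \<le> q $ p \<and> q $ p < 1}" "R2 \<subseteq> {q. 1 \<le> q $ p}"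
    "q0 \<in> R1 \<union> R2"
    and C: "\<And>t. t > 0 \<Longrightarrow> measure lebesgue (dilsum t A (Z ` B)) =
        (\<Sum>q\<in>R1 \<union> R2. measure lebesgue (cell Z e t A B q))"
    and N: "\<And>t. t > 0 \<Longrightarrow> measure lebesgue (dilsum t A B) = measure lebesgue (dilsum t (Z ` A) B) +
        (\<Sum>q\<in>R1. (1 - q $ p) * measure lebesgue (cell Z e t A B q))"
    using mixed_subdivision[of A p B q0] A B q0 unfolding Z_def e_def by blast
  have "mixed_coeff j A (Z ` B) = 0 * mixed_coeff j A B + (\<Sum>q\<in>R1 \<union> R2. 1 * m q)"
    unfolding m_def using C R cA cB cF cG j unfolding cell_def
    by (intro mixed_coeff_add) (auto intro!: convex_body_linear_image linZ)
  moreover have "mixed_coeff j A B = 1 * mixed_coeff j (Z ` A) B + (\<Sum>q\<in>R1. (1 - q $ p) * m q)"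
    unfolding m_def using N R cA cB cF cG j unfolding cell_def
    by (intro mixed_coeff_add) (auto intro!: convex_body_linear_image linZ)
  moreover have "(\<Sum>q\<in>R1 \<union> R2. m q) = (\<Sum>q\<in>R1. m q) + (\<Sum>q\<in>R2. m q)"
    using R by (intro sum.union_disjoint) force+
  moreover have "min 1 (q0 $ p) * m q0 \<le> (\<Sum>q\<in>R1 \<union> R2. min 1 (q $ p) * m q)"
  proof (rule member_le_sum)
    show "0 \<le> min 1 (q $ p) * m q" if "q \<in> (R1 \<union> R2) - {q0}" for q
      using that R cF cG by (intro mult_nonneg_nonneg) (auto simp: m_def intro: mixed_coeff_nonneg)
  qed (use R in auto)
  moreover have "(\<Sum>q\<in>R1 \<union> R2. min 1 (q $ p) * m q) = (\<Sum>q\<in>R1. q $ p * m q) + (\<Sum>q\<in>R2. m q)"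
  proof -
    have "(\<Sum>q\<in>R1 \<union> R2. min 1 (q $ p) * m q) =
        (\<Sum>q\<in>R1. min 1 (q $ p) * m q) + (\<Sum>q\<in>R2. min 1 (q $ p) * m q)"
      using R by (intro sum.union_disjoint) force+
    moreover have "(\<Sum>q\<in>R1. min 1 (q $ p) * m q) = (\<Sum>q\<in>R1. q $ p * m q)"
      using R(3) by (intro sum.cong) (auto simp: min_def)
    moreover have "(\<Sum>q\<in>R2. min 1 (q $ p) * m q) = (\<Sum>q\<in>R2. m q)"
      using R(4) by (intro sum.cong) (auto simp: min_def)
    ultimately show ?thesis by simp
  qed
  moreover have "(\<Sum>q\<in>R1. (1 - q $ p) * m q) = (\<Sum>q\<in>R1. m q) - (\<Sum>q\<in>R1. q $ p * m q)"
    by (simp add: left_diff_distrib sum_subtractf)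
  ultimately have "mixed_coeff j A B + min 1 (q0 $ p) * m q0 \<le> mixed_coeff j A (Z ` B) + mixed_coeff j (Z ` A) B"
    by simp
  then show ?thesis by (simp add: m_def)
qed

lemma mixed_coeff_split:
  assumes A: "convex_body A" "\<And>x. x \<in> A \<Longrightarrow> zero_coords {p} x \<in> A"
    and B: "convex_body B" "\<And>x. x \<in> B \<Longrightarrow> zero_coords {p} x \<in> B" and j: "j \<le> CARD('n)"
  shows "mixed_coeff j A B = mixed_coeff j (nonneg_part p A) (nonneg_part p B) +
    mixed_coeff j (nonneg_part p (reflect_coord p ` A)) (nonneg_part p (reflect_coord p ` B))"
proof -
  let ?R = "reflect_coord p"
  have RA: "convex_body (?R ` A)" "\<And>x. x \<in> ?R ` A \<Longrightarrow> zero_coords {p} x \<in> ?R ` A"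
    using A by (auto intro!: convex_body_linear_image) (metis imageI reflect_zero_coord)
  have RB: "convex_body (?R ` B)" "\<And>x. x \<in> ?R ` B \<Longrightarrow> zero_coords {p} x \<in> ?R ` B"
    using B by (auto intro!: convex_body_linear_image) (metis imageI reflect_zero_coord)
  have "mixed_coeff j A B = 1 * mixed_coeff j (nonneg_part p A) (nonneg_part p B) +
      (\<Sum>_\<in>{()}. 1 * mixed_coeff j (nonneg_part p (?R ` A)) (nonneg_part p (?R ` B)))"
  proof (rule mixed_coeff_add)
    fix t :: real assume t: "t > 0"
    have "nonneg_part p (?R ` dilsum t A B) = dilsum t (nonneg_part p (?R ` A)) (nonneg_part p (?R ` B))"
      using nonneg_part_dilsum[of "?R ` A" p "?R ` B" t] RA RB t
      by (simp add: dilsum_linear_image convex_body_def)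
    moreover have "nonneg_part p (dilsum t A B) = dilsum t (nonneg_part p A) (nonneg_part p B)"
      using nonneg_part_dilsum[of A p B t] A B t by (simp add: convex_body_def)
    ultimately show "measure lebesgue (dilsum t A B) =
        1 * measure lebesgue (dilsum t (nonneg_part p A) (nonneg_part p B)) +
        (\<Sum>_\<in>{()}. 1 * measure lebesgue (dilsum t (nonneg_part p (?R ` A)) (nonneg_part p (?R ` B))))"
      using measure_split_halfspace[of "dilsum t A B" p] convex_body_dilsum[OF A(1) B(1), of t]
      by (simp add: convex_body_def)
  qed (use j convex_body_nonneg_part[OF A] convex_body_nonneg_part[OF B]
      convex_body_nonneg_part[OF RA] convex_body_nonneg_part[OF RB] A(1) B(1) in auto)
  then show ?thesis by simp
qed

text \<open>Both halves of the space are treated by the half-space version. The faces in the surplus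
  lie entirely in the half \<open>0 \<le> x $ p\<close>, so they can be taken in the uncut
  polytopes.\<close>

lemma mixed_coeff_step_polytope:
  fixes p :: 'n
  defines "Z \<equiv> zero_coords {p}" and "e \<equiv> axis p 1"
  assumes A: "polytope A" "A \<noteq> {}" "\<And>x. x \<in> A \<Longrightarrow> Z x \<in> A"
    and B: "polytope B" "B \<noteq> {}" "\<And>x. x \<in> B \<Longrightarrow> Z x \<in> B"
    and q: "0 < q $ p" and j: "j \<le> CARD('n)"
  shows "mixed_coeff j A B + min 1 (q $ p) * mixed_coeff j (max_face q A) (Z ` max_face (Z q + e) B)
    \<le> mixed_coeff j A (Z ` B) + mixed_coeff j (Z ` A) B"
proof -
  let ?R = "reflect_coord p" and ?P = "nonneg_part p"
  have ZZ [simp]: "Z (Z x) = Z x" "Z (?R x) = Z x" "?R (Z x) = Z x" "0 \<le> Z x $ p" for x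
    by (auto simp: Z_def)
  have linZ: "linear Z" by (simp add: Z_def)
  have good: "polytope (?P X)" "?P X \<noteq> {}" "\<And>x. x \<in> ?P X \<Longrightarrow> 0 \<le> x $ p" "\<And>x. x \<in> ?P X \<Longrightarrow> Z x \<in> ?P X"
      "Z ` ?P X = Z ` X"
    if X: "polytope X" "X \<noteq> {}" "\<And>x. x \<in> X \<Longrightarrow> Z x \<in> X" for X
  proof -
    show "polytope (?P X)"
      unfolding halfspace_eq by (intro polytope_Int_polyhedron X polyhedron_halfspace_ge)
    show "?P X \<noteq> {}"
      using X ZZ by blast
    show "Z ` ?P X = Z ` X"
    proof
      show "Z ` X \<subseteq> Z ` ?P X"
      proof
        fix y assume "y \<in> Z ` X"
        then obtain x where x: "x \<in> X" "y = Z x" by blast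
        then have "Z x \<in> ?P X" "y = Z (Z x)"
          using X(3) by auto
        then show "y \<in> Z ` ?P X" by blast
      qed
    qed blast
  qed (use X in auto)
  have mirror: "polytope (?R ` X)" "?R ` X \<noteq> {}" "\<And>x. x \<in> ?R ` X \<Longrightarrow> Z x \<in> ?R ` X" "Z ` ?R ` X = Z ` X"
    if X: "polytope X" "X \<noteq> {}" "\<And>x. x \<in> X \<Longrightarrow> Z x \<in> X" for X
    using that by (auto simp: image_comp o_def intro!: polytope_linear_image) (metis ZZ(3) imageI)
  have cA: "convex_body A" and cB: "convex_body B"
    using A(1,2) B(1,2) polytope_convex_body by blast+
  have PZ: "?P (Z ` X) = Z ` X" "?R ` Z ` X = Z ` X" "x \<in> Z ` X \<Longrightarrow> Z x \<in> Z ` X" for X x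
    by (auto simp: image_comp o_def)
  note split = mixed_coeff_split[of _ p _ j, folded Z_def, OF _ _ _ _ j]
  have s1: "mixed_coeff j A B = mixed_coeff j (?P A) (?P B) + mixed_coeff j (?P (?R ` A)) (?P (?R ` B))"
    by (intro split cA cB A B)
  have s2: "mixed_coeff j A (Z ` B) = mixed_coeff j (?P A) (Z ` B) + mixed_coeff j (?P (?R ` A)) (Z ` B)"
    using split[of A "Z ` B"] cA cB A(3) PZ by (simp add: convex_body_linear_image linZ)
  have s3: "mixed_coeff j (Z ` A) B = mixed_coeff j (Z ` A) (?P B) + mixed_coeff j (Z ` A) (?P (?R ` B))"
    using split[of "Z ` A" B] cA cB B(3) PZ by (simp add: convex_body_linear_image linZ)
  \<comment> \<open>The mirrored half is used with slope 0, whose surplus has weight 0.\<close>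
  have zero: "0 \<le> (0 :: real ^ 'n) $ p"
    by (simp only: zero_index order.refl)
  have "mixed_coeff j (?P (?R ` A)) (?P (?R ` B)) + min 1 ((0 :: real ^ 'n) $ p) *
        mixed_coeff j (max_face 0 (?P (?R ` A))) (Z ` max_face (Z 0 + e) (?P (?R ` B)))
      \<le> mixed_coeff j (?P (?R ` A)) (Z ` ?P (?R ` B)) + mixed_coeff j (Z ` ?P (?R ` A)) (?P (?R ` B))"
    unfolding Z_def e_def
    by (rule mixed_coeff_step_nonneg_polytope[OF good(1-4)[OF mirror(1-3)[OF A], unfolded Z_def]
        good(1-4)[OF mirror(1-3)[OF B], unfolded Z_def] zero j])
  moreover have e1: "Z ` ?P (?R ` A) = Z ` A"
    using good(5)[OF mirror(1-3)[OF A]] mirror(4)[OF A] by simp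
  moreover have e2: "Z ` ?P (?R ` B) = Z ` B"
    using good(5)[OF mirror(1-3)[OF B]] mirror(4)[OF B] by simp
  ultimately have "mixed_coeff j (?P (?R ` A)) (?P (?R ` B))
      \<le> mixed_coeff j (?P (?R ` A)) (Z ` B) + mixed_coeff j (Z ` A) (?P (?R ` B))"
    by simp
  moreover have "mixed_coeff j (?P A) (?P B) +
      min 1 (q $ p) * mixed_coeff j (max_face q (?P A)) (Z ` max_face (Z q + e) (?P B))
      \<le> mixed_coeff j (?P A) (Z ` ?P B) + mixed_coeff j (Z ` ?P A) (?P B)"
    unfolding Z_def e_def
    by (rule mixed_coeff_step_nonneg_polytope[OF good(1-4)[OF A, unfolded Z_def]
        good(1-4)[OF B, unfolded Z_def] less_imp_le[OF q] j])
  \<comment> \<open>Since \<open>Z x\<close> competes with \<open>x\<close> and \<open>v $ p\<close>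
    is positive, no maximiser has a negative \<open>p\<close>-th coordinate; cutting does not change
    the face.\<close>
  moreover have face: "max_face v (?P X) = max_face v X"
    if X: "X \<noteq> {}" "compact X" "\<And>x. x \<in> X \<Longrightarrow> Z x \<in> X" and v: "0 < v $ p" for v X
  proof -
    have pos: "0 \<le> x $ p" if "x \<in> max_face v X" for x
    proof -
      have "v \<bullet> Z x \<le> v \<bullet> x"
        using that X by (auto simp: max_face_def)
      moreover have "v \<bullet> x = v \<bullet> Z x + x $ p * v $ p"
        using arg_cong[OF zero_coords_singleton[of x p], of "\<lambda>y. v \<bullet> y"]
        by (simp add: Z_def inner_add_right inner_axis)
      ultimately show ?thesis
        using v by (simp add: zero_le_mult_iff)
    qed
    obtain y where y: "y \<in> max_face v X"
      using max_face_eq_Int_hyperplane X by (metis ex_in_conv)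
    show ?thesis
    proof
      show "max_face v X \<subseteq> max_face v (?P X)"
        using pos by (auto simp: max_face_def)
      show "max_face v (?P X) \<subseteq> max_face v X"
      proof
        fix x assume x: "x \<in> max_face v (?P X)"
        have "v \<bullet> y \<le> v \<bullet> x"
          using x y pos[OF y] by (auto simp: max_face_def)
        then show "x \<in> max_face v X"
          using x y by (auto simp: max_face_def intro: order.trans)
      qed
    qed
  qed
  have comp: "compact A" "compact B"
    using cA cB by (auto simp: convex_body_def)
  have "0 < (Z q + e) $ p"
    by (simp add: Z_def e_def)
  then have "max_face q (?P A) = max_face q A" "max_face (Z q + e) (?P B) = max_face (Z q + e) B"
    using face[OF A(2) comp(1) A(3) q] face[OF B(2) comp(2) B(3)] by blast+
  ultimately show ?thesis
    using s1 s2 s3 good(5)[OF A] good(5)[OF B] by simp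
qed

end

section \<open>Approximation of convex bodies by invariant polytopes\<close>

lemma convex_incseq_Union:
  fixes A :: "nat \<Rightarrow> 'a::real_vector set"
  assumes "incseq A" "\<And>k. convex (A k)"
  shows "convex (\<Union>k. A k)"
proof (rule convexI)
  fix x y and u v :: real
  assume "x \<in> (\<Union>k. A k)" "y \<in> (\<Union>k. A k)" and uv: "0 \<le> u" "0 \<le> v" "u + v = 1"
  then obtain k l where "x \<in> A k" "y \<in> A l" by blast
  then have "x \<in> A (max k l)" "y \<in> A (max k l)"
    using assms(1) by (meson incseqD max.cobounded1 max.cobounded2 subsetD)+
  then show "u *\<^sub>R x + v *\<^sub>R y \<in> (\<Union>k. A k)"
    using assms(2) uv by (meson UN_I UNIV_I convexD)
qed

text \<open>The union is convex and dense in \<open>N\<close>, hence contains the interior of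
  \<open>N\<close>; what it misses lies in the frontier, a null set.\<close>

lemma measure_dense_incseq:
  fixes S :: "nat \<Rightarrow> 'a::euclidean_space set"
  assumes N: "convex_body N" and S: "\<And>k. convex_body (S k)" "incseq S" "\<And>k. S k \<subseteq> N"
    and dense: "N \<subseteq> closure (\<Union>k. S k)"
  shows "(\<lambda>k. measure lebesgue (S k)) \<longlonglongrightarrow> measure lebesgue N"
proof -
  let ?U = "\<Union>k. S k"
  have meas: "\<And>k. S k \<in> lmeasurable" "N \<in> lmeasurable"
    using S(1) N by auto
  have le: "measure lebesgue (S k) \<le> measure lebesgue N" for k
    using meas S(3) by (intro measure_mono_fmeasurable) (auto simp: fmeasurableD)
  have lim: "(\<lambda>k. measure lebesgue (S k)) \<longlonglongrightarrow> measure lebesgue ?U" and U: "?U \<in> lmeasurable"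
    using measure_nested_Union[of S] measurable_nested_Union[of S] meas le S(2)
    by (metis incseq_SucD)+
  have "convex ?U"
    using S by (intro convex_incseq_Union) (auto simp: convex_body_def)
  then have "interior N \<subseteq> ?U"
    using interior_mono[OF dense] convex_interior_closure[of ?U] interior_subset by blast
  then have "?U - N \<union> (N - ?U) \<subseteq> frontier N"
    using S(3) closure_subset[of N] by (auto simp: frontier_def)
  then have "negligible (?U - N \<union> (N - ?U))"
    using N negligible_convex_frontier negligible_subset by (auto simp: convex_body_def)
  then have "measure lebesgue N = measure lebesgue ?U"
    by (rule measure_negligible_symdiff[OF U])
  then show ?thesis
    using lim by simp
qed

lemma measure_dilsum_dense:
  fixes A B :: "'a::euclidean_space set"
  assumes A: "convex_body A" "\<And>k. convex_body (A' k)" "incseq A'" "\<And>k. A' k \<subseteq> A" "A \<subseteq> closure (\<Union>k. A' k)"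
    and B: "convex_body B" "\<And>k. convex_body (B' k)" "incseq B'" "\<And>k. B' k \<subseteq> B" "B \<subseteq> closure (\<Union>k. B' k)"
  shows "(\<lambda>k. measure lebesgue (dilsum t (A' k) (B' k))) \<longlonglongrightarrow> measure lebesgue (dilsum t A B)"
proof (rule measure_dense_incseq)
  show "incseq (\<lambda>k. dilsum t (A' k) (B' k))"
    using A(3) B(3) by (intro monoI dilsum_mono) (auto dest: incseqD)
  show "dilsum t A B \<subseteq> closure (\<Union>k. dilsum t (A' k) (B' k))"
  proof -
    let ?f = "\<lambda>(a :: 'a, b). t *\<^sub>R a + b"
    have "dilsum t A B \<subseteq> ?f ` closure ((\<Union>k. A' k) \<times> (\<Union>k. B' k))"
      using A(5) B(5) unfolding dilsum_def closure_Times by (intro image_mono Sigma_mono) auto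
    also have "\<dots> \<subseteq> closure (\<Union>k. dilsum t (A' k) (B' k))"
    proof (rule image_closure_subset)
      show "continuous_on (closure ((\<Union>k. A' k) \<times> (\<Union>k. B' k))) ?f"
        unfolding case_prod_unfold by (intro continuous_intros)
      have "t *\<^sub>R a + b \<in> (\<Union>k. dilsum t (A' k) (B' k))" if "a \<in> A' k" "b \<in> B' l" for a b k l
      proof -
        have "a \<in> A' (max k l)" "b \<in> B' (max k l)"
          using that A(3) B(3) by (meson incseqD max.cobounded1 max.cobounded2 subsetD)+
        then show ?thesis
          by (auto intro: dilsumI)
      qed
      then show "?f ` ((\<Union>k. A' k) \<times> (\<Union>k. B' k)) \<subseteq> closure (\<Union>k. dilsum t (A' k) (B' k))"
        using closure_subset by fastforce
    qed simp
    finally show ?thesis .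
  qed
qed (simp_all add: A B convex_body_dilsum dilsum_mono)

text \<open>Hulls of the first points of a countable dense subset. Adding the images of these points
  under the idempotent \<open>f\<close> makes every hull invariant under \<open>f\<close>, as the
  polytope inequality requires.\<close>

lemma polytope_approximation:
  fixes A :: "'a::euclidean_space set"
  assumes A: "convex_body A" and f: "linear f" "\<And>x. f (f x) = f x" "\<And>x. x \<in> A \<Longrightarrow> f x \<in> A"
  obtains A' where "\<And>k :: nat. polytope (A' k)" "\<And>k. A' k \<noteq> {}" "\<And>k x. x \<in> A' k \<Longrightarrow> f x \<in> A' k"
    "incseq A'" "\<And>k. A' k \<subseteq> A" "A \<subseteq> closure (\<Union>k. A' k)"
proof -
  obtain D where D: "countable D" "D \<subseteq> A" "A \<subseteq> closure D"
    by (rule separable)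
  have "D \<noteq> {}"
    using A D(3) by (auto simp: convex_body_def)
  define e where "e = from_nat_into D"
  have e: "range e = D"
    unfolding e_def using range_from_nat_into[OF \<open>D \<noteq> {}\<close> D(1)] .
  define A' where "A' k = convex hull (e ` {..k} \<union> f ` e ` {..k})" for k :: nat
  show thesis
  proof (rule that[of A'])
    fix k
    show "polytope (A' k)"
      unfolding A'_def by (intro polytope_convex_hull) simp
    show "A' k \<noteq> {}"
      by (auto simp: A'_def)
    have "f ` A' k \<subseteq> A' k"
      unfolding A'_def convex_hull_linear_image[OF f(1)]
      by (intro hull_mono) (auto simp: f(2) image_iff)
    then show "f x \<in> A' k" if "x \<in> A' k" for x
      using that by blast
    have "e i \<in> A" for i
      using e D(2) by blast
    then show "A' k \<subseteq> A"
      unfolding A'_def using A f(3) by (intro hull_minimal) (auto simp: convex_body_def)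
  next
    show "incseq A'"
      unfolding A'_def by (intro monoI hull_mono Un_mono image_mono) auto
    have "D \<subseteq> (\<Union>k. A' k)"
    proof
      fix x assume "x \<in> D"
      then obtain i where "x = e i"
        using e by blast
      then have "x \<in> A' i"
        unfolding A'_def by (intro hull_inc) auto
      then show "x \<in> (\<Union>k. A' k)" by blast
    qed
    then show "A \<subseteq> closure (\<Union>k. A' k)"
      using D(3) closure_mono by blast
  qed
qed

lemma linear_image_dense:
  fixes f :: "'a::euclidean_space \<Rightarrow> 'b::euclidean_space"
  assumes "linear f" "A \<subseteq> closure (\<Union>k. A' k)"
  shows "f ` A \<subseteq> closure (\<Union>k. f ` A' k)"
proof -
  have "f ` A \<subseteq> f ` closure (\<Union>k. A' k)"
    using assms(2) by blast
  also have "\<dots> \<subseteq> closure (\<Union>k. f ` A' k)"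
    using closure_subset[of "\<Union>k. f ` A' k"] assms(1)
    by (intro image_closure_subset) (auto simp: linear_continuous_on linear_linear)
  finally show ?thesis .
qed

context mixed_volume
begin

text \<open>The polytope inequality in the limit. The surplus is only estimated by zero here, so any
  slope with positive \<open>p\<close>-th coordinate serves, and strict inequalities must be proved
  on polytopes.\<close>

lemma mixed_coeff_step:
  fixes p :: 'n
  defines "Z \<equiv> zero_coords {p}"
  assumes A: "convex_body A" "\<And>x. x \<in> A \<Longrightarrow> Z x \<in> A"
    and B: "convex_body B" "\<And>x. x \<in> B \<Longrightarrow> Z x \<in> B" and j: "j \<le> CARD('n)"
  shows "mixed_coeff j A B \<le> mixed_coeff j A (Z ` B) + mixed_coeff j (Z ` A) B"
proof -
  have Z: "linear Z" "\<And>x. Z (Z x) = Z x"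
    by (simp_all add: Z_def)
  obtain A' where A': "\<And>k :: nat. polytope (A' k)" "\<And>k. A' k \<noteq> {}" "\<And>k x. x \<in> A' k \<Longrightarrow> Z x \<in> A' k"
    "incseq A'" "\<And>k. A' k \<subseteq> A" "A \<subseteq> closure (\<Union>k. A' k)"
    using polytope_approximation[of A Z] A Z by blast
  obtain B' where B': "\<And>k :: nat. polytope (B' k)" "\<And>k. B' k \<noteq> {}" "\<And>k x. x \<in> B' k \<Longrightarrow> Z x \<in> B' k"
    "incseq B'" "\<And>k. B' k \<subseteq> B" "B \<subseteq> closure (\<Union>k. B' k)"
    using polytope_approximation[of B Z] B Z by blast
  have cA: "convex_body (A' k)" and cB: "convex_body (B' k)" for k
    using A'(1,2) B'(1,2) polytope_convex_body by blast+
  have img: "convex_body (Z ` X)" "\<And>k. convex_body (Z ` X' k)" "incseq (\<lambda>k. Z ` X' k)" "\<And>k. Z ` X' k \<subseteq> Z ` X"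
      "Z ` X \<subseteq> closure (\<Union>k. Z ` X' k)"
    if "convex_body X" "\<And>k. convex_body (X' k)" "incseq X'" "\<And>k. X' k \<subseteq> X" "X \<subseteq> closure (\<Union>k. X' k)" for X X'
    using that Z(1) linear_image_dense[OF Z(1) that(5)]
    by (simp_all add: convex_body_linear_image image_mono incseq_def)
  note ZA = img[OF A(1) cA A'(4-6)] and ZB = img[OF B(1) cB B'(4-6)]
  have lim: "(\<lambda>k. mixed_coeff j (X' k) (Y' k)) \<longlonglongrightarrow> mixed_coeff j X Y"
    if "convex_body X" "\<And>k. convex_body (X' k)" "incseq X'" "\<And>k. X' k \<subseteq> X" "X \<subseteq> closure (\<Union>k. X' k)"
      "convex_body Y" "\<And>k. convex_body (Y' k)" "incseq Y'" "\<And>k. Y' k \<subseteq> Y" "Y \<subseteq> closure (\<Union>k. Y' k)"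
    for X Y X' Y'
    using that by (intro mixed_coeff_tendsto measure_dilsum_dense j)
  have le: "mixed_coeff j (A' k) (B' k) \<le> mixed_coeff j (A' k) (Z ` B' k) + mixed_coeff j (Z ` A' k) (B' k)" for k
  proof -
    let ?q = "axis p 1 :: real ^ 'n"
    have "mixed_coeff j (A' k) (B' k) + min 1 (?q $ p) *
        mixed_coeff j (max_face ?q (A' k)) (Z ` max_face (Z ?q + axis p 1) (B' k))
        \<le> mixed_coeff j (A' k) (Z ` B' k) + mixed_coeff j (Z ` A' k) (B' k)"
      unfolding Z_def using A'(1-3) B'(1-3) j
      by (intro mixed_coeff_step_polytope) (auto simp: Z_def)
    moreover have "0 \<le> mixed_coeff j (max_face ?q (A' k)) (Z ` max_face (Z ?q + axis p 1) (B' k))"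
      by (intro mixed_coeff_nonneg convex_body_linear_image Z convex_body_max_face cA cB)
    ultimately show ?thesis by simp
  qed
  show ?thesis
    by (rule LIMSEQ_le[OF lim[OF A(1) cA A'(4-6) B(1) cB B'(4-6)]
        tendsto_add[OF lim[OF A(1) cA A'(4-6) ZB] lim[OF ZA B(1) cB B'(4-6)]]])
      (use le in auto)
qed

end

section \<open>Splitting all coordinates\<close>

definition coordinate_closed :: "(real ^ 'n::finite) set \<Rightarrow> bool" where
  "coordinate_closed A \<longleftrightarrow> convex_body A \<and> (\<forall>T. \<forall>x\<in>A. zero_coords T x \<in> A)"

lemma coordinate_closedD:
  "coordinate_closed A \<Longrightarrow> convex_body A"
  "coordinate_closed A \<Longrightarrow> x \<in> A \<Longrightarrow> zero_coords T x \<in> A"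
  by (auto simp: coordinate_closed_def)

lemma coordinate_closed_zero_coords: "coordinate_closed A \<Longrightarrow> coordinate_closed (zero_coords T ` A)"
  unfolding coordinate_closed_def
  by (auto simp: convex_body_linear_image) (metis Un_commute imageI zero_coords_zero_coords)

lemma coordinate_closed_uminus: "coordinate_closed A \<Longrightarrow> coordinate_closed (uminus ` A)"
proof -
  have "zero_coords T (- x) = - zero_coords T x" for T and x :: "real ^ 'a"
    by (simp add: vec_eq_iff)
  then show "coordinate_closed A \<Longrightarrow> coordinate_closed (uminus ` A)"
    using linear_compose_neg[OF linear_id]
    by (auto simp: coordinate_closed_def id_def intro!: convex_body_linear_image)
qed

lemma locally_anti_blocking_coordinate_closed:
  "locally_anti_blocking K \<Longrightarrow> coordinate_closed K"
proof -
  assume K: "locally_anti_blocking K"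
  have "zero_coords T x \<in> K" if "x \<in> K" for T x
  proof -
    have "orthogonal_projection (coordinate_subspace (- T)) x = zero_coords T x"
      by (simp add: orthogonal_projection_coordinate_subspace vec_eq_iff)
    then show ?thesis
      using K that unfolding locally_anti_blocking_def by (metis IntD1 imageI)
  qed
  then show "coordinate_closed K"
    using K by (simp add: coordinate_closed_def locally_anti_blocking_def)
qed

lemma sum_Pow_insert:
  assumes "finite S" "p \<notin> S"
  shows "(\<Sum>J\<in>Pow (insert p S). g J) = (\<Sum>J\<in>Pow S. g (insert p J) + g J :: real)"
proof -
  have "inj_on (insert p) (Pow S)"
    using assms(2) by (auto simp: inj_on_def)
  then have "(\<Sum>J\<in>Pow S. g (insert p J) + g J) = (\<Sum>J\<in>insert p ` Pow S. g J) + (\<Sum>J\<in>Pow S. g J)"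
    by (simp add: sum.distrib sum.reindex)
  also have "\<dots> = (\<Sum>J\<in>Pow (insert p S). g J)"
    unfolding Pow_insert using assms by (subst sum.union_disjoint) auto
  finally show ?thesis ..
qed

context mixed_volume
begin

lemma mixed_coeff_Pow_step:
  assumes A: "coordinate_closed A" and B: "coordinate_closed B" and j: "j \<le> CARD('n)"
    and J: "p \<notin> S" "J \<subseteq> S"
  shows "mixed_coeff j (zero_coords (S - J) ` A) (zero_coords J ` B) \<le>
    mixed_coeff j (zero_coords (insert p S - insert p J) ` A) (zero_coords (insert p J) ` B) +
    mixed_coeff j (zero_coords (insert p S - J) ` A) (zero_coords J ` B)"
proof -
  let ?A = "zero_coords (S - J) ` A" and ?B = "zero_coords J ` B"
  note cA = coordinate_closed_zero_coords[OF A, of "S - J"]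
    and cB = coordinate_closed_zero_coords[OF B, of J]
  have "mixed_coeff j ?A ?B \<le>
      mixed_coeff j ?A (zero_coords {p} ` ?B) + mixed_coeff j (zero_coords {p} ` ?A) ?B"
    by (rule mixed_coeff_step[OF coordinate_closedD(1)[OF cA] coordinate_closedD(2)[OF cA]
          coordinate_closedD(1)[OF cB] coordinate_closedD(2)[OF cB] j])
  moreover have "insert p S - insert p J = S - J" "{p} \<union> (S - J) = insert p S - J" "{p} \<union> J = insert p J"
    using J by auto
  ultimately show ?thesis
    by (simp add: image_comp o_def)
qed

text \<open>\<open>S\<close> holds the coordinates already distributed: those in \<open>J\<close>
  are kept by \<open>A\<close> and removed from \<open>B\<close>, those in \<open>S - J\<close> the
  other way round. Each further coordinate splits every summand in two.\<close>

lemma mixed_coeff_le_sum_Pow: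
  assumes A: "coordinate_closed A" and B: "coordinate_closed B" and j: "j \<le> CARD('n)"
  shows "mixed_coeff j A B \<le>
    (\<Sum>J\<in>Pow S. mixed_coeff j (zero_coords (S - J) ` A) (zero_coords J ` B))"
proof (induction S rule: finite_induct[OF finite])
  case 1
  have "zero_coords {} = (id :: real ^ 'n \<Rightarrow> _)"
    by (auto simp: vec_eq_iff)
  then show ?case by simp
next
  case (2 p S)
  let ?f = "\<lambda>S J. mixed_coeff j (zero_coords (S - J) ` A) (zero_coords J ` B)"
  have "(\<Sum>J\<in>Pow S. ?f S J) \<le> (\<Sum>J\<in>Pow S. ?f (insert p S) (insert p J) + ?f (insert p S) J)"
    using 2(2) by (intro sum_mono mixed_coeff_Pow_step A B j) auto
  also have "\<dots> = (\<Sum>J\<in>Pow (insert p S). ?f (insert p S) J)"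
    using 2(1,2) by (rule sum_Pow_insert[symmetric])
  finally show ?case
    using 2(3) by linarith
qed

text \<open>For bodies in complementary coordinate subspaces, dilating the first is a stretch of the
  coordinates in \<open>J\<close>. So the volume is a monomial in \<open>t\<close> and has a single
  nonzero coefficient at most.\<close>

lemma volume_dilsum_complementary:
  fixes A B :: "(real ^ 'n) set"
  assumes "convex_body A" "convex_body B" "t > 0"
  shows "measure lebesgue (dilsum t (zero_coords (- J) ` A) (zero_coords J ` B)) =
    t ^ card J * measure lebesgue (dilsum 1 (zero_coords (- J) ` A) (zero_coords J ` B))"
proof -
  let ?A = "zero_coords (- J) ` A" and ?B = "zero_coords J ` B"
  let ?f = "\<lambda>x :: real ^ 'n. \<chi> i. (if i \<in> J then t else 1) * x $ i"
  have "?f (zero_coords (- J) a + zero_coords J b) = t *\<^sub>R zero_coords (- J) a + zero_coords J b" for a b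
    by (auto simp: vec_eq_iff)
  then have "?f ` dilsum 1 ?A ?B = dilsum t ?A ?B"
    unfolding dilsum_def by (force simp: image_iff)
  moreover have "volume_factor ?f (t ^ card J)"
    using volume_factor_stretch[of "\<lambda>i. if i \<in> J then t else 1"] assms(3)
    by (simp add: prod.If_cases)
  moreover have "convex_body (dilsum 1 ?A ?B)"
    by (intro convex_body_dilsum convex_body_linear_image assms linear_zero_coords)
  then have "compact (dilsum 1 ?A ?B)"
    by (simp add: convex_body_def)
  ultimately show ?thesis
    using volume_factorD[of ?f "t ^ card J" "dilsum 1 ?A ?B"] by simp
qed

lemma mixed_coeff_complementary:
  assumes "convex_body A" "convex_body B" "j \<le> CARD('n)"
  shows "mixed_coeff j (zero_coords (- J) ` A) (zero_coords J ` B) =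
    (if card J = j then measure lebesgue (dilsum 1 (zero_coords (- J) ` A) (zero_coords J ` B)) else 0)"
proof -
  let ?v = "measure lebesgue (dilsum 1 (zero_coords (- J) ` A) (zero_coords J ` B))"
  have "mixed_coeff j (zero_coords (- J) ` A) (zero_coords J ` B) = (\<lambda>i. if card J = i then ?v else 0) j"
  proof (rule mixed_coeff_eqI)
    show "measure lebesgue (dilsum t (zero_coords (- J) ` A) (zero_coords J ` B)) =
        (\<Sum>i\<le>CARD('n). (if card J = i then ?v else 0) * t ^ i)" if "t > 0" for t
    proof -
      have "card J \<in> {..CARD('n)}"
        using card_mono[of UNIV J] by simp
      then have "(\<Sum>i\<le>CARD('n). (if card J = i then ?v else 0) * t ^ i) = ?v * t ^ card J"
        by (simp add: mult_delta_left)
      then show ?thesis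
        using volume_dilsum_complementary[OF assms(1,2) that] by simp
    qed
  qed (use assms in \<open>simp_all add: convex_body_linear_image\<close>)
  then show ?thesis by simp
qed

lemma mixed_coeff_le_complementary:
  assumes A: "coordinate_closed A" and B: "coordinate_closed B" and j: "j \<le> CARD('n)"
  shows "mixed_coeff j A B \<le>
    (\<Sum>J | card J = j. measure lebesgue (dilsum 1 (zero_coords (- J) ` A) (zero_coords J ` B)))"
proof -
  have "(\<Sum>J\<in>UNIV. mixed_coeff j (zero_coords (- J) ` A) (zero_coords J ` B)) =
      (\<Sum>J | card J = j. measure lebesgue (dilsum 1 (zero_coords (- J) ` A) (zero_coords J ` B)))"
    using A B j
    by (simp add: mixed_coeff_complementary coordinate_closedD sum.If_cases cong: sum.cong)
  then show ?thesis
    using mixed_coeff_le_sum_Pow[OF A B j, of UNIV] by (simp add: Compl_eq_Diff_UNIV)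
qed

end

section \<open>The Rogers--Shephard inequality for coordinate subspaces\<close>

text \<open>\<open>Q\<close> is the primitive of a Beta integrand; \<open>Q 1\<close> is the Beta
  integral that produces the binomial coefficient. Integration by parts trades one factor
  \<open>1 - t\<close> for one factor \<open>t\<close>, so \<open>j\<close> varies in the
  induction.\<close>

lemma beta_primitive:
  assumes "j \<ge> 1"
  shows "\<exists>Q :: real \<Rightarrow> real.
    (\<forall>t. (Q has_real_derivative real j * t ^ (j - 1) * (1 - t) ^ m) (at t)) \<and>
    Q 0 = 0 \<and> Q 1 = 1 / real ((j + m) choose j)"
  using assms
proof (induction m arbitrary: j)
  case 0
  show ?case
    using 0 by (intro exI[of _ "\<lambda>t. t ^ j"]) (auto intro!: derivative_eq_intros)
next
  case (Suc m)
  obtain Q :: "real \<Rightarrow> real" where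
    Q: "\<And>t. (Q has_real_derivative real (Suc j) * t ^ j * (1 - t) ^ m) (at t)"
    "Q 0 = 0" "Q 1 = 1 / real ((Suc j + m) choose Suc j)"
    using Suc.IH[of "Suc j"] by auto
  \<comment> \<open>Boundary term plus remaining integral; the quotient undoes the factor
    \<open>Suc j\<close> in the derivative of \<open>Q\<close>.\<close>
  define P where "P t = t ^ j * (1 - t) ^ Suc m + real (Suc m) / real (Suc j) * Q t" for t
  have "(P has_real_derivative real j * t ^ (j - 1) * (1 - t) ^ Suc m) (at t)" for t
    unfolding P_def
    by (rule derivative_eq_intros Q refl)+ (simp add: field_simps del: of_nat_Suc)
  moreover have "P 0 = 0"
    using Suc.prems by (simp add: P_def Q)
  moreover have "P 1 = 1 / real ((j + Suc m) choose j)"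
  proof -
    have "Suc m * ((j + Suc m) choose j) = Suc j * ((Suc j + m) choose Suc j)"
      using binomial_absorb_comp[of "j + Suc m" j] binomial_absorption[of j "j + Suc m"]
      by simp
    then have "real (Suc m) * real ((j + Suc m) choose j) = real (Suc j) * real ((Suc j + m) choose Suc j)"
      by (metis of_nat_mult)
    moreover have "real ((j + Suc m) choose j) > 0" "real ((Suc j + m) choose Suc j) > 0"
      by (simp_all del: binomial_Suc_Suc)
    ultimately show ?thesis
      by (simp add: P_def Q field_simps del: of_nat_Suc binomial_Suc_Suc)
  qed
  ultimately show ?case by blast
qed

lemma power_diff_le:
  fixes x y :: real
  assumes "0 \<le> y" "y \<le> x" "x \<le> 1"
  shows "x ^ m - y ^ m \<le> real m * (x - y)"
proof (induction m)
  case (Suc m)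
  have "x ^ Suc m - y ^ Suc m = x * (x ^ m - y ^ m) + (x - y) * y ^ m"
    by (simp add: algebra_simps)
  also have "\<dots> \<le> 1 * (x ^ m - y ^ m) + (x - y) * 1"
    using assms by (intro add_mono mult_right_mono mult_left_mono power_le_one) (auto intro: power_mono)
  finally show ?case
    using Suc by (simp add: algebra_simps)
qed simp

text \<open>Lower and upper Stieltjes sums of \<open>(1 - t) ^ m\<close> against
  \<open>t ^ j\<close>. They enclose the Beta integral and differ by at most \<open>m / N\<close>,
  since the integrand drops by at most that much on each grid interval.\<close>

lemma beta_riemann_sums:
  assumes "j \<ge> 1" "N > 0"
  defines "t \<equiv> \<lambda>k :: nat. real k / real N"
  shows "(\<Sum>k<N. (t (Suc k) ^ j - t k ^ j) * (1 - t (Suc k)) ^ m) \<ge> 1 / real ((j + m) choose j) - real m / real N"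
    and "(\<Sum>k<N. (t (Suc k) ^ j - t k ^ j) * (1 - t k) ^ m) \<le> 1 / real ((j + m) choose j) + real m / real N"
proof -
  obtain Q :: "real \<Rightarrow> real" where
    Q: "\<And>t. (Q has_real_derivative real j * t ^ (j - 1) * (1 - t) ^ m) (at t)"
    "Q 0 = 0" "Q 1 = 1 / real ((j + m) choose j)"
    using beta_primitive[OF assms(1)] by auto
  have t: "0 \<le> t k" "t k \<le> t (Suc k)" "t (Suc k) \<le> 1" if "k < N" for k
    using that assms(2) by (auto simp: t_def field_simps)
  have up: "Q b - Q a \<le> (b ^ j - a ^ j) * (1 - a) ^ m"
    and dn: "(b ^ j - a ^ j) * (1 - b) ^ m \<le> Q b - Q a" if ab: "0 \<le> a" "a \<le> b" "b \<le> 1" for a b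
  proof -
    have der: "((\<lambda>x. Q x - x ^ j * c) has_real_derivative real j * x ^ (j - 1) * ((1 - x) ^ m - c)) (at x)" for c x
      by (rule derivative_eq_intros Q refl)+ (simp add: field_simps)
    have "Q b - b ^ j * (1 - a) ^ m \<le> Q a - a ^ j * (1 - a) ^ m"
    proof (rule DERIV_nonpos_imp_nonincreasing[OF ab(2)])
      fix x assume "a \<le> x" "x \<le> b"
      then have "real j * x ^ (j - 1) * ((1 - x) ^ m - (1 - a) ^ m) \<le> 0"
        using ab by (intro mult_nonneg_nonpos) (auto intro!: power_mono)
      then show "\<exists>y. ((\<lambda>x. Q x - x ^ j * (1 - a) ^ m) has_real_derivative y) (at x) \<and> y \<le> 0"
        using der by blast
    qed
    then show "Q b - Q a \<le> (b ^ j - a ^ j) * (1 - a) ^ m"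
      by (simp add: algebra_simps)
    have "Q a - a ^ j * (1 - b) ^ m \<le> Q b - b ^ j * (1 - b) ^ m"
    proof (rule DERIV_nonneg_imp_nondecreasing[OF ab(2)])
      fix x assume "a \<le> x" "x \<le> b"
      then have "0 \<le> real j * x ^ (j - 1) * ((1 - x) ^ m - (1 - b) ^ m)"
        using ab by (intro mult_nonneg_nonneg) (auto intro!: power_mono)
      then show "\<exists>y. ((\<lambda>x. Q x - x ^ j * (1 - b) ^ m) has_real_derivative y) (at x) \<and> 0 \<le> y"
        using der by blast
    qed
    then show "(b ^ j - a ^ j) * (1 - b) ^ m \<le> Q b - Q a"
      by (simp add: algebra_simps)
  qed
  let ?L = "\<Sum>k<N. (t (Suc k) ^ j - t k ^ j) * (1 - t (Suc k)) ^ m"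
  let ?U = "\<Sum>k<N. (t (Suc k) ^ j - t k ^ j) * (1 - t k) ^ m"
  have tel: "(\<Sum>k<N. f (t (Suc k)) - f (t k)) = f 1 - f 0" for f :: "real \<Rightarrow> real"
    using assms(2) sum_lessThan_telescope[of "\<lambda>k. f (t k)" N] by (simp add: t_def)
  have "?L \<le> (\<Sum>k<N. Q (t (Suc k)) - Q (t k))" "(\<Sum>k<N. Q (t (Suc k)) - Q (t k)) \<le> ?U"
    using t by (auto intro!: sum_mono up dn)
  then have "?L \<le> 1 / real ((j + m) choose j)" "1 / real ((j + m) choose j) \<le> ?U"
    using tel[of Q] by (simp_all add: Q)
  moreover have "?U - ?L \<le> (\<Sum>k<N. (t (Suc k) ^ j - t k ^ j) * (real m / real N))"
    unfolding sum_subtractf[symmetric]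
  proof (rule sum_mono)
    fix k assume "k \<in> {..<N}"
    then have k: "k < N" by simp
    have "(1 - t k) ^ m - (1 - t (Suc k)) ^ m \<le> real m * ((1 - t k) - (1 - t (Suc k)))"
      using t[OF k] by (intro power_diff_le) auto
    also have "\<dots> = real m / real N"
      using assms(2) by (simp add: t_def field_simps)
    finally have "(t (Suc k) ^ j - t k ^ j) * ((1 - t k) ^ m - (1 - t (Suc k)) ^ m)
        \<le> (t (Suc k) ^ j - t k ^ j) * (real m / real N)"
      using t[OF k] by (intro mult_left_mono) (auto intro: power_mono)
    then show "(t (Suc k) ^ j - t k ^ j) * (1 - t k) ^ m - (t (Suc k) ^ j - t k ^ j) * (1 - t (Suc k)) ^ m
        \<le> (t (Suc k) ^ j - t k ^ j) * (real m / real N)"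
      by (simp add: algebra_simps)
  qed
  moreover have "(\<Sum>k<N. (t (Suc k) ^ j - t k ^ j) * (real m / real N)) = real m / real N"
    unfolding sum_distrib_right[symmetric] using tel[of "\<lambda>x. x ^ j"] assms(1) by simp
  ultimately show "?L \<ge> 1 / real ((j + m) choose j) - real m / real N"
    and "?U \<le> 1 / real ((j + m) choose j) + real m / real N"
    by linarith+
qed

text \<open>In effect the Cartesian product of \<open>P\<^sub>J A\<close> and
  \<open>P\<^sub>J\<^sub>' B\<close> with independent scales on the two coordinate blocks.\<close>

definition box_sum :: "(real ^ 'n::finite) set \<Rightarrow> (real ^ 'n) set \<Rightarrow> 'n set \<Rightarrow> real \<Rightarrow> real \<Rightarrow> (real ^ 'n) set" where
  "box_sum A B J r s = (\<lambda>(a, b). r *\<^sub>R zero_coords (- J) a + s *\<^sub>R zero_coords J b) ` (A \<times> B)"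

lemma box_sum_1: "box_sum A B J 1 1 = dilsum 1 (zero_coords (- J) ` A) (zero_coords J ` B)"
proof (intro set_eqI iffI)
  fix x assume "x \<in> dilsum 1 (zero_coords (- J) ` A) (zero_coords J ` B)"
  then show "x \<in> box_sum A B J 1 1"
    by (auto simp: dilsum_def box_sum_def)
qed (auto simp: box_sum_def intro!: dilsumI)

lemma compact_box_sum:
  fixes A B :: "(real ^ 'n::finite) set"
  assumes "compact A" "compact B"
  shows "compact (box_sum A B J r s)"
proof -
  have "linear (\<lambda>x :: (real ^ 'n) \<times> (real ^ 'n). r *\<^sub>R zero_coords (- J) (fst x) + s *\<^sub>R zero_coords J (snd x))"
    by (auto intro!: linearI simp: vec_eq_iff algebra_simps)
  then have "continuous_on (A \<times> B) (\<lambda>x. r *\<^sub>R zero_coords (- J) (fst x) + s *\<^sub>R zero_coords J (snd x))"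
    by (simp add: linear_continuous_on linear_linear)
  then show ?thesis
    using assms unfolding box_sum_def case_prod_unfold by (intro compact_continuous_image compact_Times)
qed

lemma box_sum_mono:
  assumes "convex A" "0 \<in> A" "convex B" "0 \<in> B" "0 \<le> r" "r \<le> r'" "0 \<le> s" "s \<le> s'"
  shows "box_sum A B J r s \<subseteq> box_sum A B J r' s'"
proof
  fix x assume "x \<in> box_sum A B J r s"
  then obtain a b where ab: "a \<in> A" "b \<in> B" "x = r *\<^sub>R zero_coords (- J) a + s *\<^sub>R zero_coords J b"
    by (auto simp: box_sum_def)
  have *: "\<exists>c'\<in>C. r *\<^sub>R f c = r' *\<^sub>R f c'" if C: "convex C" "0 \<in> C" "c \<in> C" "0 \<le> r" "r \<le> r'" "linear f"
    for C c r r' and f :: "real ^ 'a \<Rightarrow> real ^ 'a"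
  proof (cases "r' = 0")
    case False
    then have "(r / r') *\<^sub>R c \<in> C"
      using C convexD[OF C(1) C(2,3), of "1 - r / r'" "r / r'"] by simp
    moreover have "r *\<^sub>R f c = r' *\<^sub>R f ((r / r') *\<^sub>R c)"
      using False C(6) by (simp add: linear_scale)
    ultimately show ?thesis by blast
  qed (use that in auto)
  obtain a' where "a' \<in> A" "r *\<^sub>R zero_coords (- J) a = r' *\<^sub>R zero_coords (- J) a'"
    using *[OF assms(1,2) ab(1) assms(5,6), of "zero_coords (- J)"] by auto
  moreover obtain b' where "b' \<in> B" "s *\<^sub>R zero_coords J b = s' *\<^sub>R zero_coords J b'"
    using *[OF assms(3,4) ab(2) assms(7,8), of "zero_coords J"] by auto
  ultimately show "x \<in> box_sum A B J r' s'"
    using ab(3) by (auto simp: box_sum_def)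
qed

text \<open>The product structure: each scale constrains only its own block of coordinates.\<close>

lemma box_sum_mix:
  assumes "x \<in> box_sum A B J r s" "x \<in> box_sum A B J r' s'"
  shows "x \<in> box_sum A B J r s'"
proof -
  obtain a b where ab: "a \<in> A" "b \<in> B" "x = r *\<^sub>R zero_coords (- J) a + s *\<^sub>R zero_coords J b"
    using assms(1) by (auto simp: box_sum_def)
  obtain c d where cd: "c \<in> A" "d \<in> B" "x = r' *\<^sub>R zero_coords (- J) c + s' *\<^sub>R zero_coords J d"
    using assms(2) by (auto simp: box_sum_def)
  have "x $ i = (r *\<^sub>R zero_coords (- J) a + s' *\<^sub>R zero_coords J d) $ i" for i
    using arg_cong[OF ab(3), of "\<lambda>v. v $ i"] arg_cong[OF cd(3), of "\<lambda>v. v $ i"]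
    by (cases "i \<in> J") simp_all
  then have "x = r *\<^sub>R zero_coords (- J) a + s' *\<^sub>R zero_coords J d"
    by (simp add: vec_eq_iff)
  then show ?thesis
    using ab cd by (auto simp: box_sum_def)
qed

lemma measure_box_sum:
  fixes A B :: "(real ^ 'n::finite) set"
  assumes "compact A" "compact B" "0 \<le> r" "0 \<le> s"
  shows "measure lebesgue (box_sum A B J r s) =
    r ^ card J * s ^ card (- J) * measure lebesgue (box_sum A B J 1 1)"
proof -
  define f where "f x = (\<chi> i. (if i \<in> J then r else s) * x $ i)" for x :: "real ^ 'n"
  have "f (zero_coords (- J) a + zero_coords J b) = r *\<^sub>R zero_coords (- J) a + s *\<^sub>R zero_coords J b" for a b
    by (auto simp: vec_eq_iff f_def)
  then have "box_sum A B J r s = f ` box_sum A B J 1 1"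
    by (simp add: box_sum_def image_image case_prod_unfold)
  moreover have "volume_factor f (r ^ card J * s ^ card (- J))"
    using volume_factor_stretch[of "\<lambda>i. if i \<in> J then r else s"] assms(3,4)
    by (simp add: prod.If_cases Compl_eq f_def[abs_def])
  ultimately show ?thesis
    using volume_factorD[of f] compact_box_sum[OF assms(1,2)] by simp
qed

context
  fixes A B :: "(real ^ 'n::finite) set" and J :: "'n set"
  assumes A: "convex_body A" "0 \<in> A" and B: "convex_body B" "0 \<in> B"
    and J: "1 \<le> card J" "card J < CARD('n)"
begin

private lemma cmpct: "compact A" "compact B" "convex A" "convex B"
  using A B by (auto simp: convex_body_def)

private lemma card_Compl: "card J + card (- J) = CARD('n)" "1 \<le> card (- J)"
  using J card_Un_disjoint[of J "- J"] by (auto simp: Compl_partition)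

private lemma measure_shell:
  assumes "0 \<le> r'" "r' \<le> r" "0 \<le> s"
  shows "measure lebesgue (box_sum A B J r s - box_sum A B J r' s) =
    (r ^ card J - r' ^ card J) * s ^ card (- J) * measure lebesgue (box_sum A B J 1 1)"
proof -
  have "measure lebesgue (box_sum A B J r s - box_sum A B J r' s) =
      measure lebesgue (box_sum A B J r s) - measure lebesgue (box_sum A B J r' s)"
    using assms cmpct A B
    by (intro measurable_measure_Diff box_sum_mono)
       (auto intro!: lmeasurable_compact compact_box_sum fmeasurableD)
  then show ?thesis
    using assms cmpct by (simp add: measure_box_sum[of _ _ r] measure_box_sum[of _ _ r'] algebra_simps)
qed

text \<open>Disjoint shells inside \<open>K\<close>, indexed by a grid of scales of the
  \<open>J\<close>-block, have total volume equal to a lower Stieltjes sum times the volume of the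
  full product.\<close>

lemma box_sum_le_volume:
  assumes K: "K \<in> lmeasurable" "\<And>u. 0 \<le> u \<Longrightarrow> u \<le> 1 \<Longrightarrow> box_sum A B J u (1 - u) \<subseteq> K"
  shows "measure lebesgue (box_sum A B J 1 1) \<le> real (CARD('n) choose card J) * measure lebesgue K"
proof -
  let ?v = "measure lebesgue (box_sum A B J 1 1)" and ?c = "real (CARD('n) choose card J)"
  have bound: "?v * (1 / ?c - real (card (- J)) / real N) \<le> measure lebesgue K" if N: "N > 0" for N :: nat
  proof -
    define t where "t k = real k / real N" for k :: nat
    have t: "0 \<le> t k" "t k \<le> 1" if "k \<le> N" for k
      using that N by (auto simp: t_def)
    have t_mono: "t k \<le> t l" if "k \<le> l" for k l
      using that by (auto simp: t_def divide_right_mono)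
    \<comment> \<open>The second scale belongs to the outer radius \<open>t (Suc k)\<close>, so the
      shell stays inside \<open>K\<close>; for the covering in the opposite estimate it belongs to
      the inner radius.\<close>
    define T where "T k = box_sum A B J (t (Suc k)) (1 - t (Suc k)) - box_sum A B J (t k) (1 - t (Suc k))" for k
    have T_meas: "T k \<in> lmeasurable" for k
      unfolding T_def using cmpct
      by (intro fmeasurable.Diff lmeasurable_compact compact_box_sum)
    have disj: "T k \<inter> T l = {}" if "k < l" "l < N" for k l
    proof -
      have False if x: "x \<in> T k" "x \<in> T l" for x
      proof -
        have "x \<in> box_sum A B J (t (Suc k)) (1 - t (Suc l))"
          using x box_sum_mix unfolding T_def by blast
        moreover have "box_sum A B J (t (Suc k)) (1 - t (Suc l)) \<subseteq> box_sum A B J (t l) (1 - t (Suc l))"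
          using \<open>k < l\<close> \<open>l < N\<close> cmpct A B t by (intro box_sum_mono t_mono) auto
        ultimately show False
          using x(2) by (auto simp: T_def)
      qed
      then show ?thesis by blast
    qed
    have "pairwise (\<lambda>k l. negligible (T k \<inter> T l)) {..<N}"
      unfolding pairwise_def
    proof (intro ballI impI)
      fix k l assume "k \<in> {..<N}" "l \<in> {..<N}" "k \<noteq> l"
      then have "T k \<inter> T l = {}"
        using disj[of k l] disj[of l k] by (cases "k < l") auto
      then show "negligible (T k \<inter> T l)" by simp
    qed
    then have "(\<Sum>k<N. measure lebesgue (T k)) = measure lebesgue (\<Union>k<N. T k)"
      using T_meas by (intro measure_negligible_finite_Union_image[symmetric]) auto
    also have "\<dots> \<le> measure lebesgue K"
    proof (rule measure_mono_fmeasurable)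
      show "(\<Union>k<N. T k) \<subseteq> K"
      proof (rule UN_least)
        fix k assume "k \<in> {..<N}"
        then show "T k \<subseteq> K"
          using K(2)[OF t[of "Suc k"]] unfolding T_def by auto
      qed
    qed (use K T_meas in auto)
    finally have "(\<Sum>k<N. measure lebesgue (T k)) \<le> measure lebesgue K" .
    moreover have "(\<Sum>k<N. measure lebesgue (T k)) =
        ?v * (\<Sum>k<N. (t (Suc k) ^ card J - t k ^ card J) * (1 - t (Suc k)) ^ card (- J))"
      unfolding sum_distrib_left
    proof (rule sum.cong)
      fix k assume "k \<in> {..<N}"
      then show "measure lebesgue (T k) =
          ?v * ((t (Suc k) ^ card J - t k ^ card J) * (1 - t (Suc k)) ^ card (- J))"
        unfolding T_def using t[of k] t[of "Suc k"] t_mono[of k "Suc k"]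
        by (subst measure_shell) auto
    qed simp
    moreover have "?v * (\<Sum>k<N. (t (Suc k) ^ card J - t k ^ card J) * (1 - t (Suc k)) ^ card (- J))
        \<ge> ?v * (1 / ?c - real (card (- J)) / real N)"
      using beta_riemann_sums(1)[OF J(1) N, of "card (- J)"] card_Compl
      by (intro mult_left_mono) (simp_all add: t_def)
    ultimately show ?thesis by linarith
  qed
  have "(\<lambda>N. ?v * (1 / ?c - real (card (- J)) / real N)) \<longlonglongrightarrow> ?v * (1 / ?c - 0)"
    by (intro tendsto_intros lim_const_over_n)
  then have "?v * (1 / ?c - 0) \<le> measure lebesgue K"
    using bound by (intro LIMSEQ_le_const2) (auto intro!: exI[of _ 1])
  moreover have "?c > 0"
    using J by simp
  ultimately show ?thesis
    by (simp add: field_simps)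
qed

text \<open>The converse estimate: slightly larger shells cover \<open>K\<close> up to a null set,
  and their volumes form an upper Stieltjes sum.\<close>

lemma volume_le_box_sum:
  assumes K: "K \<in> lmeasurable" "K \<subseteq> (\<Union>u\<in>{0..1}. box_sum A B J u (1 - u))"
  shows "real (CARD('n) choose card J) * measure lebesgue K \<le> measure lebesgue (box_sum A B J 1 1)"
proof -
  let ?v = "measure lebesgue (box_sum A B J 1 1)" and ?c = "real (CARD('n) choose card J)"
  have bound: "measure lebesgue K \<le> ?v * (1 / ?c + real (card (- J)) / real N)" if N: "N > 0" for N :: nat
  proof -
    define t where "t k = real k / real N" for k :: nat
    have t: "0 \<le> t k" "t k \<le> 1" if "k \<le> N" for k
      using that N by (auto simp: t_def)
    have t_mono: "t k \<le> t l" if "k \<le> l" for k l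
      using that by (auto simp: t_def divide_right_mono)
    define T where "T k = box_sum A B J (t (Suc k)) (1 - t k) - box_sum A B J (t k) (1 - t k)" for k
    have T_meas: "T k \<in> lmeasurable" for k
      unfolding T_def using cmpct
      by (intro fmeasurable.Diff lmeasurable_compact compact_box_sum)
    have B_meas: "box_sum A B J r s \<in> lmeasurable" for r s
      using cmpct by (intro lmeasurable_compact compact_box_sum)
    have "K \<subseteq> box_sum A B J 0 1 \<union> (\<Union>k<N. T k)"
    proof
      fix x assume "x \<in> K"
      then have "\<exists>u\<in>{0..1}. x \<in> box_sum A B J u (1 - u)"
        using K(2) by blast
      then obtain u where u: "0 \<le> u" "u \<le> 1" "x \<in> box_sum A B J u (1 - u)"
        by auto
      \<comment> \<open>With second scale 1 this constrains the \<open>J\<close>-block alone. If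
        \<open>Suc i\<close> is the least such index, \<open>u\<close> must exceed
        \<open>t i\<close>, which bounds the other block by \<open>1 - t i\<close> and places
        \<open>x\<close> in \<open>T i\<close>.\<close>
      define P where "P k \<longleftrightarrow> x \<in> box_sum A B J (t k) 1" for k
      have "P N"
        unfolding P_def using u cmpct A B box_sum_mono[of A B u "t N" "1 - u" 1] N by (auto simp: t_def)
      define k where "k = (LEAST k. P k)"
      have k: "P k" "\<And>i. i < k \<Longrightarrow> \<not> P i" "k \<le> N"
        unfolding k_def by (fact LeastI[of P, OF \<open>P N\<close>] not_less_Least Least_le[of P, OF \<open>P N\<close>])+
      show "x \<in> box_sum A B J 0 1 \<union> (\<Union>k<N. T k)"
      proof (cases k)
        case 0
        then show ?thesis
          using k(1) by (simp add: P_def t_def)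
      next
        case (Suc i)
        have ni: "x \<notin> box_sum A B J (t i) 1"
          using k(2)[of i] Suc by (simp add: P_def)
        have ti: "0 \<le> t i" "t i \<le> 1"
          using t[of i] k(3) Suc by auto
        have "t i < u"
        proof (rule ccontr)
          assume "\<not> t i < u"
          then have "box_sum A B J u (1 - u) \<subseteq> box_sum A B J (t i) 1"
            using u cmpct A B by (intro box_sum_mono) auto
          then show False
            using u ni by blast
        qed
        have "x \<in> box_sum A B J (t (Suc i)) (1 - u)"
          using k(1) u(3) box_sum_mix unfolding P_def Suc by blast
        moreover have "box_sum A B J (t (Suc i)) (1 - u) \<subseteq> box_sum A B J (t (Suc i)) (1 - t i)"
          using \<open>t i < u\<close> u cmpct A B t[of "Suc i"] k(3) Suc by (intro box_sum_mono) auto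
        moreover have "box_sum A B J (t i) (1 - t i) \<subseteq> box_sum A B J (t i) 1"
          using ti cmpct A B by (intro box_sum_mono) auto
        ultimately have "x \<in> T i"
          using ni by (auto simp: T_def)
        then show ?thesis
          using k(3) Suc by auto
      qed
    qed
    then have "measure lebesgue K \<le> measure lebesgue (box_sum A B J 0 1 \<union> (\<Union>k<N. T k))"
      using K(1) T_meas B_meas
      by (intro measure_mono_fmeasurable fmeasurable.Un fmeasurable.finite_UN) (auto simp: fmeasurableD)
    also have "\<dots> \<le> measure lebesgue (box_sum A B J 0 1) + measure lebesgue (\<Union>k<N. T k)"
      using T_meas B_meas by (intro measure_Un_le) (auto simp: fmeasurableD)
    \<comment> \<open>The uncovered centre has scale 0 in a nonempty block of coordinates.\<close>
    also have "measure lebesgue (box_sum A B J 0 1) = 0"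
      using J cmpct by (subst measure_box_sum) auto
    also have "measure lebesgue (\<Union>k<N. T k) \<le> (\<Sum>k<N. measure lebesgue (T k))"
      using T_meas by (intro measure_UNION_le) (auto simp: fmeasurableD)
    finally have "measure lebesgue K \<le> (\<Sum>k<N. measure lebesgue (T k))" by simp
    moreover have "(\<Sum>k<N. measure lebesgue (T k)) =
        ?v * (\<Sum>k<N. (t (Suc k) ^ card J - t k ^ card J) * (1 - t k) ^ card (- J))"
      unfolding sum_distrib_left
    proof (rule sum.cong)
      fix k assume "k \<in> {..<N}"
      then show "measure lebesgue (T k) =
          ?v * ((t (Suc k) ^ card J - t k ^ card J) * (1 - t k) ^ card (- J))"
        unfolding T_def using t[of k] t[of "Suc k"] t_mono[of k "Suc k"]
        by (subst measure_shell) auto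
    qed simp
    moreover have "?v * (\<Sum>k<N. (t (Suc k) ^ card J - t k ^ card J) * (1 - t k) ^ card (- J))
        \<le> ?v * (1 / ?c + real (card (- J)) / real N)"
      using beta_riemann_sums(2)[OF J(1) N, of "card (- J)"] card_Compl
      by (intro mult_left_mono) (simp_all add: t_def)
    ultimately show ?thesis by linarith
  qed
  have "(\<lambda>N. ?v * (1 / ?c + real (card (- J)) / real N)) \<longlonglongrightarrow> ?v * (1 / ?c + 0)"
    by (intro tendsto_intros lim_const_over_n)
  then have "measure lebesgue K \<le> ?v * (1 / ?c + 0)"
    using bound by (intro LIMSEQ_le_const) (auto intro!: exI[of _ 1])
  moreover have "?c > 0"
    using J by simp
  ultimately show ?thesis
    by (simp add: field_simps)
qed

end

section \<open>Godbersen's inequality and simplices\<close>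

lemma coordinate_closed_zero_mem:
  fixes K :: "(real ^ 'n::finite) set"
  assumes "coordinate_closed K"
  shows "0 \<in> K"
proof -
  obtain x where "x \<in> K"
    using assms by (auto simp: coordinate_closed_def convex_body_def)
  moreover have "zero_coords UNIV x = 0"
    by (simp add: vec_eq_iff)
  ultimately show ?thesis
    using coordinate_closedD(2)[OF assms, of x UNIV] by simp
qed

text \<open>Reflecting the coordinates outside \<open>J\<close> removes the sign of the second body;
  this is how \<open>- K\<close> becomes comparable with \<open>K\<close>.\<close>

lemma measure_complementary_uminus:
  fixes K :: "(real ^ 'n::finite) set"
  assumes "compact K"
  shows "measure lebesgue (dilsum 1 (zero_coords (- J) ` K) (zero_coords J ` uminus ` K)) =
    measure lebesgue (box_sum K K J 1 1)"
proof -
  define f where "f x = (\<chi> i. (if i \<in> J then 1 else - 1) * x $ i)" for x :: "real ^ 'n"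
  have "f (zero_coords (- J) a + zero_coords J b) = zero_coords (- J) a + zero_coords J (- b)" for a b
    by (auto simp: vec_eq_iff f_def)
  then have "box_sum K (uminus ` K) J 1 1 = f ` box_sum K K J 1 1"
    unfolding box_sum_def image_image case_prod_unfold by (force simp: image_iff)
  moreover have "volume_factor f 1"
    using volume_factor_stretch[of "\<lambda>i. if i \<in> J then 1 else - 1"]
    by (simp add: prod.If_cases f_def[abs_def] abs_mult power_abs)
  ultimately show ?thesis
    using volume_factorD[of f 1] compact_box_sum[OF assms assms] by (simp add: box_sum_1[symmetric])
qed

lemma box_sum_subset:
  assumes K: "coordinate_closed K" and u: "0 \<le> u" "u \<le> 1"
  shows "box_sum K K J u (1 - u) \<subseteq> K"
proof
  fix x assume "x \<in> box_sum K K J u (1 - u)"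
  then obtain a b where ab: "a \<in> K" "b \<in> K" "x = u *\<^sub>R zero_coords (- J) a + (1 - u) *\<^sub>R zero_coords J b"
    by (auto simp: box_sum_def)
  then have "zero_coords (- J) a \<in> K" "zero_coords J b \<in> K"
    using K by (auto intro: coordinate_closedD)
  then show "x \<in> K"
    using K u unfolding ab(3) coordinate_closed_def convex_body_def by (intro convexD) auto
qed

lemma rogers_shephard_coordinates:
  fixes K :: "(real ^ 'n::finite) set"
  assumes K: "coordinate_closed K" and J: "1 \<le> card J" "card J < CARD('n)"
  shows "measure lebesgue (box_sum K K J 1 1) \<le> real (CARD('n) choose card J) * measure lebesgue K"
  using K J coordinate_closed_zero_mem[OF K] box_sum_subset[OF K]
  by (intro box_sum_le_volume) (auto dest: coordinate_closedD)

lemma card_subsets: "card {J :: 'n::finite set. card J = j} = CARD('n) choose j"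
  using n_subsets[of "UNIV :: 'n set" j] by simp

context mixed_volume
begin

text \<open>The intermediate sum is exposed because equality must be examined in both estimates. Of
  the two binomial factors, one bounds each summand and the other counts the sets \<open>J\<close>;
  the latter cancels against the factor in \<open>mixed_coeff\<close>.\<close>

lemma mixed_coeff_uminus_le:
  assumes K: "coordinate_closed K" and j: "0 < j" "j < CARD('n)"
  shows "mixed_coeff j K (uminus ` K) \<le> (\<Sum>J | card J = j. measure lebesgue (box_sum K K J 1 1))"
    and "(\<Sum>J | card J = j. measure lebesgue (box_sum K K J 1 1)) \<le>
      real (CARD('n) choose j) * (real (CARD('n) choose j) * measure lebesgue K)"
proof -
  have "compact K"
    using K by (simp add: coordinate_closed_def convex_body_def)
  then show "mixed_coeff j K (uminus ` K) \<le> (\<Sum>J | card J = j. measure lebesgue (box_sum K K J 1 1))"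
    using mixed_coeff_le_complementary[OF K coordinate_closed_uminus[OF K], of j] j
    by (simp add: measure_complementary_uminus)
  have "(\<Sum>J | card J = j. measure lebesgue (box_sum K K J 1 1)) \<le>
      (\<Sum>J :: 'n set | card J = j. real (CARD('n) choose j) * measure lebesgue K)"
  proof (rule sum_mono)
    fix J :: "'n set" assume "J \<in> {J. card J = j}"
    then show "measure lebesgue (box_sum K K J 1 1) \<le> real (CARD('n) choose j) * measure lebesgue K"
      using rogers_shephard_coordinates[OF K, of J] j by auto
  qed
  then show "(\<Sum>J | card J = j. measure lebesgue (box_sum K K J 1 1)) \<le>
      real (CARD('n) choose j) * (real (CARD('n) choose j) * measure lebesgue K)"
    by (simp add: card_subsets)
qed

lemma godbersen_iff_mixed_coeff:
  assumes "j < CARD('n)"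
  shows "V (replicate j A @ replicate (CARD('n) - j) B) \<le> c \<longleftrightarrow>
      mixed_coeff j A B \<le> real (CARD('n) choose j) * c"
    and "V (replicate j A @ replicate (CARD('n) - j) B) = c \<longleftrightarrow>
      mixed_coeff j A B = real (CARD('n) choose j) * c"
  using assms by (simp_all add: mixed_coeff_def)

end

section \<open>Simplices attain equality\<close>

definition unit_simplex :: "(real ^ 'n::finite) set" where
  "unit_simplex = convex hull (insert 0 (range (\<lambda>i. axis i 1)))"

lemma unit_simplex_eq: "unit_simplex = {x :: real ^ 'n::finite. (\<forall>i. 0 \<le> x $ i) \<and> (\<Sum>i\<in>UNIV. x $ i) \<le> 1}"
proof -
  have B: "(Basis :: (real ^ 'n) set) = range (\<lambda>i. axis i 1)"
    by (auto simp: Basis_vec_def)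
  show ?thesis
    unfolding unit_simplex_def B[symmetric] std_simplex
    by (simp add: B sum.reindex inj_on_def axis_eq_axis inner_axis)
qed

lemma coordinate_closed_unit_simplex: "coordinate_closed (unit_simplex :: (real ^ 'n::finite) set)"
proof -
  have "convex_body (unit_simplex :: (real ^ 'n) set)"
    unfolding unit_simplex_def by (intro polytope_convex_body polytope_convex_hull) auto
  moreover have "zero_coords T x \<in> unit_simplex" if "x \<in> unit_simplex" for T and x :: "real ^ 'n"
  proof -
    have "(\<Sum>i\<in>UNIV. zero_coords T x $ i) \<le> (\<Sum>i\<in>UNIV. x $ i)"
      using that by (intro sum_mono) (simp add: unit_simplex_eq)
    then show ?thesis
      using that by (auto simp: unit_simplex_eq)
  qed
  ultimately show ?thesis
    by (simp add: coordinate_closed_def)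
qed

text \<open>Take \<open>u\<close> to be the sum of the coordinates in \<open>J\<close>; each block
  of \<open>x\<close>, divided by its share \<open>u\<close> or \<open>1 - u\<close>, again lies in
  the simplex.\<close>

lemma unit_simplex_subset_box_sums:
  "(unit_simplex :: (real ^ 'n::finite) set) \<subseteq> (\<Union>u\<in>{0..1}. box_sum unit_simplex unit_simplex J u (1 - u))"
proof
  fix x :: "real ^ 'n" assume x: "x \<in> unit_simplex"
  define u where "u = (\<Sum>i\<in>J. x $ i)"
  have nn: "0 \<le> x $ i" for i
    using x by (simp add: unit_simplex_eq)
  have part: "\<exists>a\<in>unit_simplex. zero_coords (- T) x = c *\<^sub>R zero_coords (- T) a"
    if c: "(\<Sum>i\<in>T. x $ i) \<le> c" for T c
  proof (cases "c = 0")
    case True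
    then have "(\<Sum>i\<in>T. x $ i) = 0"
      using c sum_nonneg[of T "\<lambda>i. x $ i"] nn by force
    then have "zero_coords (- T) x = 0"
      using nn by (auto simp: vec_eq_iff sum_nonneg_eq_0_iff)
    then show ?thesis
      using True x by auto
  next
    case False
    then have c0: "c > 0"
      using c sum_nonneg[of T "\<lambda>i. x $ i"] nn by force
    let ?a = "(1 / c) *\<^sub>R zero_coords (- T) x"
    have "(\<Sum>i\<in>UNIV. zero_coords (- T) x $ i) = (\<Sum>i\<in>T. x $ i)"
    proof -
      have "- {i. i \<notin> T} = T" by auto
      then show ?thesis by (simp add: sum.If_cases)
    qed
    then have "(\<Sum>i\<in>UNIV. ?a $ i) = (\<Sum>i\<in>T. x $ i) / c"
      unfolding vector_scaleR_component by (simp add: sum_divide_distrib[symmetric] del: zero_coords_nth)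
    also have "\<dots> \<le> 1"
      using c c0 by simp
    finally have "?a \<in> unit_simplex"
      using nn c0 by (auto simp: unit_simplex_eq)
    moreover have "zero_coords (- T) x = c *\<^sub>R zero_coords (- T) ?a"
      using c0 by (simp add: vec_eq_iff)
    ultimately show ?thesis by blast
  qed
  have tot: "u + (\<Sum>i\<in>- J. x $ i) = (\<Sum>i\<in>UNIV. x $ i)"
    unfolding u_def by (subst sum.union_disjoint[symmetric]) (auto simp: Compl_partition)
  then have u: "0 \<le> u" "u \<le> 1" "(\<Sum>i\<in>- J. x $ i) \<le> 1 - u"
    using x nn sum_nonneg[of "- J" "\<lambda>i. x $ i"] sum_nonneg[of J "\<lambda>i. x $ i"]
    by (auto simp: unit_simplex_eq u_def)
  obtain a b where ab: "a \<in> unit_simplex" "zero_coords (- J) x = u *\<^sub>R zero_coords (- J) a"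
    "b \<in> unit_simplex" "zero_coords J x = (1 - u) *\<^sub>R zero_coords J b"
    using part[of J u] part[of "- J" "1 - u"] u by (auto simp: u_def)
  have "x = zero_coords (- J) x + zero_coords J x"
    by (auto simp: vec_eq_iff)
  then have "x \<in> box_sum unit_simplex unit_simplex J u (1 - u)"
    unfolding ab(2,4) using ab(1,3) by (auto simp: box_sum_def)
  then show "x \<in> (\<Union>u\<in>{0..1}. box_sum unit_simplex unit_simplex J u (1 - u))"
    using u by auto
qed

context mixed_volume
begin

text \<open>The pieces \<open>P J\<close> lie in different orthants inside \<open>S + (- S)\<close>,
  so their volumes sum to at most the sum of all coefficients. Each coefficient is bounded above by
  its share of the same volumes, so every bound is attained. The volume of a piece is known exactly
  because \<open>volume_le_box_sum\<close> reverses the Rogers-Shephard estimate.\<close>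

lemma mixed_coeff_unit_simplex:
  assumes j: "0 < j" "j < CARD('n)"
  shows "mixed_coeff j unit_simplex (uminus ` unit_simplex) =
    real (CARD('n) choose j) * (real (CARD('n) choose j) * measure lebesgue (unit_simplex :: (real ^ 'n) set))"
proof -
  let ?S = "unit_simplex :: (real ^ 'n) set" and ?n = "CARD('n)"
  have cc: "coordinate_closed ?S"
    by (rule coordinate_closed_unit_simplex)
  have cb: "convex_body ?S" "convex_body (uminus ` ?S)"
    using cc coordinate_closed_uminus[OF cc] by (auto simp: coordinate_closed_def)
  define P where "P J = dilsum 1 (zero_coords (- J) ` ?S) (zero_coords J ` uminus ` ?S)" for J
  have cP: "convex_body (P J)" for J
    unfolding P_def by (intro convex_body_dilsum convex_body_linear_image cb linear_zero_coords)
  have sub: "P J \<subseteq> dilsum 1 ?S (uminus ` ?S)" for J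
    unfolding P_def using coordinate_closedD(2)[OF cc] coordinate_closedD(2)[OF coordinate_closed_uminus[OF cc]]
    by (intro dilsum_mono) auto
  have pos: "0 \<le> x $ i" if "x \<in> P J" "i \<in> J" for x i J
    using that by (auto simp: P_def dilsum_def unit_simplex_eq)
  have neg: "x $ i \<le> 0" if "x \<in> P J" "i \<notin> J" for x i J
    using that by (auto simp: P_def dilsum_def unit_simplex_eq)
  have "pairwise (\<lambda>J J'. negligible (P J \<inter> P J')) UNIV"
    unfolding pairwise_def
  proof (intro ballI impI)
    fix J J' :: "'n set" assume "J \<noteq> J'"
    then obtain i where "i \<in> J \<and> i \<notin> J' \<or> i \<in> J' \<and> i \<notin> J"
      by blast
    then have "x $ i = 0" if "x \<in> P J \<inter> P J'" for x
      using that pos[of x J i] pos[of x J' i] neg[of x J i] neg[of x J' i] by auto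
    then have "P J \<inter> P J' \<subseteq> {x. axis i (1 :: real) \<bullet> x = 0}"
      by (auto simp: inner_axis')
    moreover have "negligible {x. axis i (1 :: real) \<bullet> x = 0}"
      by (intro negligible_hyperplane) (simp add: axis_eq_0_iff)
    ultimately show "negligible (P J \<inter> P J')"
      by (rule negligible_subset[rotated])
  qed
  then have "measure lebesgue (\<Union>J. P J) = (\<Sum>J\<in>UNIV. measure lebesgue (P J))"
    using cP by (intro measure_negligible_finite_Union_image) auto
  moreover have "measure lebesgue (\<Union>J. P J) \<le> measure lebesgue (dilsum 1 ?S (uminus ` ?S))"
    using sub cP convex_body_dilsum[OF cb, of 1]
    by (intro measure_mono_fmeasurable) (auto intro!: fmeasurableD fmeasurable.finite_UN)
  moreover have "measure lebesgue (dilsum 1 ?S (uminus ` ?S)) = (\<Sum>i\<le>?n. mixed_coeff i ?S (uminus ` ?S))"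
    using volume_dilsum[OF cb, of 1] by simp
  moreover have "(\<Sum>J\<in>UNIV. measure lebesgue (P J)) = (\<Sum>i\<le>?n. \<Sum>J | card J = i. measure lebesgue (P J))"
  proof -
    have "card ` (UNIV :: 'n set set) \<subseteq> {..?n}"
      by (auto intro: card_mono)
    then show ?thesis
      using sum.group[of "UNIV :: 'n set set" "{..?n}" card "\<lambda>J. measure lebesgue (P J)"] by simp
  qed
  ultimately have tot: "(\<Sum>i\<le>?n. \<Sum>J | card J = i. measure lebesgue (P J)) \<le> (\<Sum>i\<le>?n. mixed_coeff i ?S (uminus ` ?S))"
    by simp
  have le: "mixed_coeff i ?S (uminus ` ?S) \<le> (\<Sum>J | card J = i. measure lebesgue (P J))" if "i \<in> {..?n}" for i
    unfolding P_def using that by (intro mixed_coeff_le_complementary cc coordinate_closed_uminus) auto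
  have "mixed_coeff j ?S (uminus ` ?S) = (\<Sum>J | card J = j. measure lebesgue (P J))"
  proof (rule ccontr)
    assume "\<not> ?thesis"
    then have "mixed_coeff j ?S (uminus ` ?S) < (\<Sum>J | card J = j. measure lebesgue (P J))"
      using le[of j] j by simp
    then have "\<exists>i\<in>{..?n}. mixed_coeff i ?S (uminus ` ?S) < (\<Sum>J | card J = i. measure lebesgue (P J))"
      using j by (intro bexI[of _ j]) simp_all
    then have "(\<Sum>i\<le>?n. mixed_coeff i ?S (uminus ` ?S)) < (\<Sum>i\<le>?n. \<Sum>J | card J = i. measure lebesgue (P J))"
      using le by (intro sum_strict_mono_ex1 ballI finite_atMost)
    then show False
      using tot by simp
  qed
  also have "\<dots> = (\<Sum>J :: 'n set | card J = j. real (?n choose j) * measure lebesgue ?S)"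
  proof (rule sum.cong)
    fix J :: "'n set" assume "J \<in> {J. card J = j}"
    then have J: "1 \<le> card J" "card J < ?n" "card J = j"
      using j by auto
    have "real (?n choose card J) * measure lebesgue ?S \<le> measure lebesgue (box_sum ?S ?S J 1 1)"
      using J cb coordinate_closed_zero_mem[OF cc] unit_simplex_subset_box_sums
      by (intro volume_le_box_sum) auto
    then show "measure lebesgue (P J) = real (?n choose j) * measure lebesgue ?S"
      using rogers_shephard_coordinates[OF cc J(1,2)] J(3) cb
      by (simp add: P_def measure_complementary_uminus convex_body_def)
  qed simp
  finally show ?thesis
    by (simp add: card_subsets)
qed

text \<open>A full-dimensional simplex is an affine image of the unit simplex. Translations do not
  affect the coefficients, and the linear part multiplies both sides by its volume factor.\<close>

lemma mixed_coeff_simplex: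
  fixes K :: "(real ^ 'n) set"
  assumes j: "0 < j" "j < CARD('n)" and K: "int CARD('n) simplex K"
  shows "mixed_coeff j K (uminus ` K) =
    real (CARD('n) choose j) * (real (CARD('n) choose j) * measure lebesgue K)"
proof -
  let ?S = "unit_simplex :: (real ^ 'n) set"
  obtain C where C: "finite C" "card C = Suc CARD('n)" "K = convex hull C"
    using K unfolding simplex by (metis add.commute of_nat_Suc of_nat_eq_iff)
  then obtain v where v: "v \<in> C"
    by force
  then have "card (C - {v}) = CARD('n)"
    using C by simp
  then obtain h where h: "bij_betw h (UNIV :: 'n set) (C - {v})"
    using finite_same_card_bij[of "UNIV :: 'n set" "C - {v}"] C(1) by auto
  define f where "f x = (\<Sum>i\<in>UNIV. x $ i *\<^sub>R (h i - v))" for x :: "real ^ 'n"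
  have f: "linear f"
    unfolding f_def by (intro linear_compose_sum ballI) (auto intro!: linearI simp: algebra_simps)
  have fax: "f (axis i 1) = h i - v" for i
    unfolding f_def axis_def by (simp add: if_distrib[of "\<lambda>u. u *\<^sub>R _"] cong: if_cong)
  have "(+) v ` f ` ?S = convex hull ((+) v ` f ` insert 0 (range (\<lambda>i. axis i 1)))"
    unfolding unit_simplex_def convex_hull_linear_image[OF f] convex_hull_translation ..
  also have "(+) v ` f ` insert 0 (range (\<lambda>i. axis i 1)) = insert v (range h)"
    using linear_0[OF f] by (simp add: image_image fax)
  also have "\<dots> = C"
    using h v by (auto simp: bij_betw_def)
  finally have Kf: "K = (+) v ` f ` ?S"
    using C(3) by simp
  have mK: "uminus ` K = (+) (- v) ` f ` uminus ` ?S"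
    unfolding Kf by (simp add: image_image linear_neg[OF f] minus_diff_commute)
  obtain d where d: "volume_factor f d"
    using linear_has_volume_factor[OF f] by blast
  have cb: "convex_body ?S" "convex_body (uminus ` ?S)"
    using coordinate_closed_unit_simplex coordinate_closed_uminus coordinate_closedD(1) by blast+
  have "mixed_coeff j K (uminus ` K) = mixed_coeff j (f ` ?S) (f ` uminus ` ?S)"
    unfolding mK unfolding Kf using j cb f
    by (intro mixed_coeff_translation) (auto intro: convex_body_linear_image)
  also have "\<dots> = d * mixed_coeff j ?S (uminus ` ?S)"
    using j cb f d by (intro mixed_coeff_linear_image) auto
  finally have "mixed_coeff j K (uminus ` K) = d * mixed_coeff j ?S (uminus ` ?S)" .
  moreover have "measure lebesgue K = d * measure lebesgue ?S"
    unfolding Kf using volume_factorD[OF d, of ?S] cb by (simp add: measure_translation convex_body_def)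
  ultimately show ?thesis
    using mixed_coeff_unit_simplex[OF j] by simp
qed

end

section \<open>The equality case\<close>

text \<open>The open set \<open>interior K - L\<close> is null, hence empty, and \<open>K\<close> is
  the closure of its interior.\<close>

lemma convex_body_eq_of_measure_le:
  fixes K L :: "'a::euclidean_space set"
  assumes K: "convex_body K" "interior K \<noteq> {}" and L: "compact L" "L \<subseteq> K"
    and le: "measure lebesgue K \<le> measure lebesgue L"
  shows "K = L"
proof
  have "measure lebesgue (K - L) = measure lebesgue K - measure lebesgue L"
    using K L by (intro measurable_measure_Diff) (auto simp: fmeasurableD lmeasurable_compact)
  also have "\<dots> = 0"
    using le measure_mono_fmeasurable[of L K lebesgue] convex_body_lmeasurable[OF K(1)] L
    by (simp add: fmeasurableD lmeasurable_compact)
  finally have "negligible (K - L)"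
    using K L by (simp add: negligible_iff_measure fmeasurable.Diff lmeasurable_compact convex_body_def)
  then have "negligible (interior K - L)"
    by (rule negligible_subset) (use interior_subset in blast)
  moreover have "open (interior K - L)"
    using L by (simp add: compact_imp_closed open_Diff)
  ultimately have "interior K \<subseteq> L"
    using open_not_negligible by blast
  then have "closure (interior K) \<subseteq> L"
    using L(1) by (simp add: closure_minimal compact_imp_closed)
  moreover have "K \<subseteq> closure (interior K)"
    using K convex_closure_interior[of K] closure_subset by (auto simp: convex_body_def)
  ultimately show "K \<subseteq> L" by blast
qed (fact L)

lemma hull_hull_Un: "convex hull (convex hull A \<union> convex hull B) = convex hull (A \<union> B)"
  by (simp only: hull_Un_left[symmetric] hull_Un_right[symmetric])

lemma zero_coords_image_zero_coords: "zero_coords S ` zero_coords T ` A = zero_coords (S \<union> T) ` A"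
  by (simp add: image_image)

text \<open>As \<open>0 < j < n\<close>, any two coordinates of \<open>S\<close> can be separated by
  some \<open>J\<close> of size \<open>j\<close>. Projecting the splitting for this \<open>J\<close>
  to the coordinates in \<open>S\<close> reduces \<open>S\<close> to the smaller sets
  \<open>S \<inter> J\<close> and \<open>S - J\<close>.\<close>

lemma convex_hull_of_axes:
  fixes K :: "(real ^ 'n::finite) set"
  assumes j: "0 < j" "j < CARD('n)"
    and split: "\<And>J. card J = j \<Longrightarrow> K = convex hull (zero_coords (- J) ` K \<union> zero_coords J ` K)"
    and S: "S \<noteq> {}" and K: "convex K"
  shows "zero_coords (- S) ` K = convex hull (\<Union>i\<in>S. zero_coords (- {i}) ` K)"
  using S
proof (induction "card S" arbitrary: S rule: less_induct)
  case less
  show ?case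
  proof (cases "\<exists>p. S = {p}")
    case True
    have "convex (zero_coords (- S) ` K)"
      using K by (intro convex_linear_image linear_zero_coords)
    then show ?thesis
      using True by (auto simp: hull_same)
  next
    case False
    then obtain p q where pq: "p \<in> S" "q \<in> S" "p \<noteq> q"
      using less.prems by blast
    have "j - 1 \<le> card (UNIV - {p, q})"
      using j pq by (simp add: card_Diff_subset)
    then obtain J0 where J0: "J0 \<subseteq> UNIV - {p, q}" "card J0 = j - 1"
      by (metis obtain_subset_with_card_n)
    define J where "J = insert p J0"
    have J: "card J = j" "p \<in> J" "q \<notin> J"
      using J0 j pq by (auto simp: J_def card_insert_if finite_subset)
    have ne: "S \<inter> J \<noteq> {}" "S - J \<noteq> {}" "card (S \<inter> J) < card S" "card (S - J) < card S"
      using pq J by (auto intro!: psubset_card_mono)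
    have "zero_coords (- S) ` K =
        convex hull (zero_coords (- S) ` (zero_coords (- J) ` K \<union> zero_coords J ` K))"
      by (subst split[OF J(1)]) (simp add: convex_hull_linear_image)
    also have "zero_coords (- S) ` (zero_coords (- J) ` K \<union> zero_coords J ` K) =
        zero_coords (- (S \<inter> J)) ` K \<union> zero_coords (- (S - J)) ` K"
    proof -
      have "- S \<union> - J = - (S \<inter> J)" "- S \<union> J = - (S - J)" by auto
      then show ?thesis
        by (simp only: image_Un zero_coords_image_zero_coords)
    qed
    also have "\<dots> = convex hull (\<Union>i\<in>S \<inter> J. zero_coords (- {i}) ` K) \<union>
        convex hull (\<Union>i\<in>S - J. zero_coords (- {i}) ` K)"
      unfolding less.hyps[OF ne(3,1)] less.hyps[OF ne(4,2)] ..
    also have "convex hull \<dots> =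
        convex hull ((\<Union>i\<in>S \<inter> J. zero_coords (- {i}) ` K) \<union> (\<Union>i\<in>S - J. zero_coords (- {i}) ` K))"
      by (rule hull_hull_Un)
    also have "(\<Union>i\<in>S \<inter> J. zero_coords (- {i}) ` K) \<union> (\<Union>i\<in>S - J. zero_coords (- {i}) ` K) =
        (\<Union>i\<in>S. zero_coords (- {i}) ` K)"
      by blast
    finally show ?thesis .
  qed
qed

definition axis_ends :: "('n::finite \<Rightarrow> real) \<Rightarrow> ('n \<Rightarrow> real) \<Rightarrow> 'n set \<Rightarrow> (real ^ 'n) set" where
  "axis_ends l u S = (\<Union>i\<in>S. {l i *\<^sub>R axis i 1, u i *\<^sub>R axis i 1})"

lemma coordinate_range:
  fixes K :: "(real ^ 'n::finite) set"
  assumes K: "coordinate_closed K" "interior K \<noteq> {}"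
  obtains l u where "\<And>i. l i \<le> 0" "\<And>i. 0 \<le> u i" "\<And>i. l i < u i"
    "\<And>i. zero_coords (- {i}) ` K = convex hull {l i *\<^sub>R axis i 1, u i *\<^sub>R axis i 1}"
proof -
  have cb: "compact K" "convex K" "0 \<in> K"
    using K coordinate_closed_zero_mem[OF K(1)] by (auto simp: coordinate_closed_def convex_body_def)
  have "\<exists>l u. l \<le> 0 \<and> 0 \<le> u \<and> l < u \<and>
      zero_coords (- {i}) ` K = convex hull {l *\<^sub>R axis i 1, u *\<^sub>R axis i 1}" for i
  proof -
    have lin: "linear (\<lambda>x :: real ^ 'n. x $ i)"
      by (auto intro!: linearI)
    have "compact ((\<lambda>x. x $ i) ` K)" "connected ((\<lambda>x. x $ i) ` K)"
      using cb lin
      by (simp_all add: compact_continuous_image convex_connected convex_linear_image linear_continuous_on linear_linear)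
    then obtain l u where lu: "(\<lambda>x. x $ i) ` K = {l..u}"
      using connected_compact_interval_1[of "(\<lambda>x. x $ i) ` K"] by auto
    have lu0: "0 \<in> {l..u}"
      using cb(3) unfolding lu[symmetric] by (auto intro!: image_eqI[of _ _ 0])
    have "l \<noteq> u"
    proof
      assume "l = u"
      then have "x $ i = l" if "x \<in> K" for x
        using lu that by (metis atLeastAtMost_singleton imageI singletonD)
      then have "K \<subseteq> {x. axis i 1 \<bullet> x = l}"
        by (auto simp: inner_axis')
      moreover have "interior {x :: real ^ 'n. axis i 1 \<bullet> x = l} = {}"
        by (intro interior_hyperplane) (simp add: axis_eq_0_iff)
      ultimately show False
        using K(2) interior_mono by blast
    qed
    moreover have "zero_coords (- {i}) ` K = convex hull {l *\<^sub>R axis i 1, u *\<^sub>R axis i 1}"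
    proof -
      have "zero_coords (- {i}) x = x $ i *\<^sub>R axis i 1" for x :: "real ^ 'n"
        by (auto simp: vec_eq_iff axis_def)
      then have "zero_coords (- {i}) ` K = (\<lambda>s. s *\<^sub>R axis i 1) ` (\<lambda>x. x $ i) ` K"
        by (simp add: image_image)
      also have "\<dots> = (\<lambda>s. s *\<^sub>R axis i 1) ` (convex hull {l, u})"
        using lu0 unfolding lu by (simp add: segment_convex_hull[symmetric] closed_segment_eq_real_ivl)
      also have "\<dots> = convex hull {l *\<^sub>R axis i 1, u *\<^sub>R axis i 1}"
        by (subst convex_hull_linear_image) (auto intro!: linearI simp: algebra_simps)
      finally show ?thesis .
    qed
    ultimately show ?thesis
      using lu0 by (intro exI[of _ l] exI[of _ u]) auto
  qed
  then show thesis
    using that by metis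
qed

lemma convex_hull_UN_hull: "convex hull (\<Union>i\<in>S. convex hull (X i)) = convex hull (\<Union>i\<in>S. X i)"
proof
  show "convex hull (\<Union>i\<in>S. convex hull (X i)) \<subseteq> convex hull (\<Union>i\<in>S. X i)"
    by (intro hull_minimal UN_least hull_mono) auto
  show "convex hull (\<Union>i\<in>S. X i) \<subseteq> convex hull (\<Union>i\<in>S. convex hull (X i))"
    by (intro hull_mono UN_mono hull_subset) simp
qed

context mixed_volume
begin

text \<open>Equality forces the Rogers-Shephard bound to be attained for every \<open>J\<close>.
  That bound already holds for the hull of the two projections in place of \<open>K\<close>, so this
  hull has at least the volume of \<open>K\<close> and equals it.\<close>

lemma equality_imp_convex_hull_axes:
  fixes K :: "(real ^ 'n) set"
  assumes K: "coordinate_closed K" "interior K \<noteq> {}" and j: "0 < j" "j < CARD('n)"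
    and eq: "mixed_coeff j K (uminus ` K) =
      real (CARD('n) choose j) * (real (CARD('n) choose j) * measure lebesgue K)"
  obtains l u where "\<And>i. l i \<le> 0" "\<And>i. 0 \<le> u i" "\<And>i. l i < u i"
    "\<And>S. S \<noteq> {} \<Longrightarrow> zero_coords (- S) ` K = convex hull (axis_ends l u S)"
proof -
  let ?b = "real (CARD('n) choose j)"
  have cb: "convex_body K" "compact K" "convex K" "0 \<in> K"
    using K coordinate_closed_zero_mem[OF K(1)] by (auto simp: coordinate_closed_def convex_body_def)
  have le: "measure lebesgue (box_sum K K J 1 1) \<le> ?b * measure lebesgue K" if "card J = j" for J
    using rogers_shephard_coordinates[OF K(1), of J] that j by auto
  have split: "K = convex hull (zero_coords (- J) ` K \<union> zero_coords J ` K)" if J: "card J = j" for J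
  proof (rule convex_body_eq_of_measure_le[OF cb(1) K(2)])
    let ?L = "convex hull (zero_coords (- J) ` K \<union> zero_coords J ` K)"
    have "compact (zero_coords T ` K)" for T
      using convex_body_linear_image[OF linear_zero_coords cb(1)] by (simp add: convex_body_def)
    then show L: "compact ?L"
      by (intro compact_convex_hull compact_Un)
    show "?L \<subseteq> K"
      using cb K by (intro hull_minimal) (auto dest: coordinate_closedD)
    have "box_sum K K J u (1 - u) \<subseteq> ?L" if "0 \<le> u" "u \<le> 1" for u
    proof
      fix x assume "x \<in> box_sum K K J u (1 - u)"
      then obtain a b where ab: "a \<in> K" "b \<in> K" "x = u *\<^sub>R zero_coords (- J) a + (1 - u) *\<^sub>R zero_coords J b"
        by (auto simp: box_sum_def)
      have "zero_coords (- J) a \<in> ?L" "zero_coords J b \<in> ?L"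
        using ab by (auto intro: hull_inc)
      then show "x \<in> ?L"
        unfolding ab(3) using that by (intro convexD convex_convex_hull) auto
    qed
    then have "measure lebesgue (box_sum K K J 1 1) \<le> ?b * measure lebesgue ?L"
      using box_sum_le_volume[of K K J ?L] cb j J L by (simp add: lmeasurable_compact)
    moreover have "?b * measure lebesgue K \<le> measure lebesgue (box_sum K K J 1 1)"
    proof (rule ccontr)
      assume "\<not> ?thesis"
      then have "(\<Sum>J | card J = j. measure lebesgue (box_sum K K J 1 1)) <
          (\<Sum>J :: 'n set | card J = j. ?b * measure lebesgue K)"
        using J le by (intro sum_strict_mono_ex1) (auto intro!: bexI[of _ J])
      then show False
        using mixed_coeff_uminus_le(1)[OF K(1) j] eq by (simp add: card_subsets)
    qed
    moreover have "?b > 0"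
      using j by simp
    ultimately have "?b * measure lebesgue K \<le> ?b * measure lebesgue ?L" by linarith
    then show "measure lebesgue K \<le> measure lebesgue ?L"
      using \<open>?b > 0\<close> by (simp add: mult_le_cancel_left)
  qed
  obtain l u where lu: "\<And>i. l i \<le> 0" "\<And>i. 0 \<le> u i" "\<And>i. l i < u i"
    "\<And>i. zero_coords (- {i}) ` K = convex hull {l i *\<^sub>R axis i 1, u i *\<^sub>R axis i 1}"
    using coordinate_range[OF K] by blast
  have "zero_coords (- S) ` K = convex hull (axis_ends l u S)" if "S \<noteq> {}" for S
    using convex_hull_of_axes[OF j split that cb(3)]
    unfolding lu(4) convex_hull_UN_hull axis_ends_def .
  then show thesis
    using that lu by blast
qed

end

text \<open>Only n + 1 of the end points are needed to span \<open>K\<close>, and a spanning set of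
  this size for a full-dimensional hull is affinely independent.\<close>

lemma one_sided_imp_simplex:
  fixes K :: "(real ^ 'n::finite) set"
  assumes K: "interior K \<noteq> {}" "K = convex hull (axis_ends l u UNIV)"
    and lu: "\<And>i. l i \<le> 0" "\<And>i. 0 \<le> u i" and p: "\<And>i. i \<noteq> p \<Longrightarrow> l i = 0 \<or> u i = 0"
  shows "int CARD('n) simplex K"
proof -
  \<comment> \<open>For \<open>i \<noteq> p\<close> the end not chosen is 0, which lies on the
    segment between the two ends on axis \<open>p\<close>.\<close>
  define c where "c i = (if i = p \<or> l i = 0 then u i else l i)" for i
  define C where "C = insert (l p *\<^sub>R axis p (1 :: real)) (range (\<lambda>i. c i *\<^sub>R axis i 1))"
  have C_sub: "C \<subseteq> axis_ends l u UNIV"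
    by (auto simp: C_def axis_ends_def c_def)
  have cp: "u p *\<^sub>R axis p 1 \<in> C" "l p *\<^sub>R axis p 1 \<in> C"
    unfolding C_def c_def by (auto intro!: image_eqI[of _ _ p])
  have "0 \<in> closed_segment (l p *\<^sub>R axis p 1) (u p *\<^sub>R axis p (1 :: real))"
  proof (cases "l p = 0")
    case False
    then have "u p - l p > 0"
      using lu(1)[of p] lu(2)[of p] by linarith
    then have w: "0 \<le> (- l p) / (u p - l p)" "(- l p) / (u p - l p) \<le> 1"
      using lu(1)[of p] lu(2)[of p] by (simp_all only: divide_nonneg_pos divide_le_eq_1_pos)
    have "0 = (1 - (- l p) / (u p - l p)) *\<^sub>R (l p *\<^sub>R axis p (1 :: real)) + ((- l p) / (u p - l p)) *\<^sub>R (u p *\<^sub>R axis p 1)"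
      using \<open>u p - l p > 0\<close> by (simp add: vec_eq_iff axis_def field_simps)
    then show ?thesis
      unfolding in_segment using w by blast
  qed simp
  then have "0 \<in> convex hull {l p *\<^sub>R axis p 1, u p *\<^sub>R axis p (1 :: real)}"
    by (simp add: segment_convex_hull)
  then have zero: "0 \<in> convex hull C"
    using hull_mono[of "{l p *\<^sub>R axis p 1, u p *\<^sub>R axis p (1 :: real)}" C convex] cp by blast
  have "axis_ends l u UNIV \<subseteq> convex hull C"
  proof -
    have "l i *\<^sub>R axis i 1 \<in> convex hull C \<and> u i *\<^sub>R axis i 1 \<in> convex hull C" for i
    proof (cases "i = p")
      case True
      then show ?thesis using cp by (auto intro: hull_inc)
    next
      case False
      have "c i *\<^sub>R axis i 1 \<in> convex hull C"
        by (intro hull_inc) (auto simp: C_def)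
      then show ?thesis
        using False p[OF False] zero by (auto simp: c_def split: if_splits)
    qed
    then show ?thesis
      by (auto simp: axis_ends_def)
  qed
  then have KC: "K = convex hull C"
    unfolding K(2) using C_sub by (metis convex_convex_hull hull_minimal hull_mono subset_antisym)
  have fin: "finite C"
    by (simp add: C_def)
  have "card C \<le> Suc CARD('n)"
    unfolding C_def using card_image_le[of "UNIV :: 'n set" "\<lambda>i. c i *\<^sub>R axis i (1 :: real)"]
    by (intro order.trans[OF card_insert_le_m1]) auto
  moreover have dim: "aff_dim C = int CARD('n)"
    using low_dim_interior[of K] K(1) by (auto simp: KC aff_dim_convex_hull)
  moreover have "aff_dim C \<le> int (card C) - 1"
    using aff_dim_le_card[OF fin] .
  ultimately have "int (card C) = int CARD('n) + 1"
    by linarith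
  then show ?thesis
    unfolding simplex_def using KC dim fin by (auto simp: affine_independent_iff_card intro!: exI[of _ C])
qed

section \<open>Strictness from a pair of complementary faces\<close>

lemma max_face_convex_hull:
  fixes X :: "'a::euclidean_space set"
  assumes X: "finite X" and Y: "Y \<subseteq> X" "Y \<noteq> {}" "\<And>y. y \<in> Y \<Longrightarrow> q \<bullet> y = m"
    and less: "\<And>x. x \<in> X - Y \<Longrightarrow> q \<bullet> x < m"
  shows "max_face q (convex hull X) = convex hull Y"
proof -
  have le: "q \<bullet> x \<le> m" if "x \<in> convex hull X" for x
  proof -
    have "convex hull X \<subseteq> {x. q \<bullet> x \<le> m}"
      using Y less by (intro hull_minimal convex_halfspace_le) force
    then show ?thesis using that by blast
  qed
  have eqY: "q \<bullet> x = m" if "x \<in> convex hull Y" for x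
  proof -
    have "convex hull Y \<subseteq> {x. q \<bullet> x = m}"
      using Y by (intro hull_minimal convex_hyperplane) auto
    then show ?thesis using that by blast
  qed
  have sub: "convex hull Y \<subseteq> convex hull X"
    using Y(1) by (rule hull_mono)
  obtain y where y: "y \<in> Y" using Y(2) by blast
  have "y \<in> convex hull X" "q \<bullet> y = m"
    using sub eqY hull_inc[OF y, of convex] by auto
  then have face: "max_face q (convex hull X) = convex hull X \<inter> {x. q \<bullet> x = m}"
    using le by (auto simp: max_face_def intro: antisym)
  have "convex hull X \<inter> {x. q \<bullet> x = m} face_of convex hull X"
    using le by (intro face_of_Int_supporting_hyperplane_le) auto
  then obtain X' where X': "X' \<subseteq> X" "convex hull X \<inter> {x. q \<bullet> x = m} = convex hull X'"
    using face_of_convex_hull_subset[OF finite_imp_compact[OF X]] by blast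
  have "X' \<subseteq> Y"
  proof
    fix x assume "x \<in> X'"
    then have "x \<in> X" "q \<bullet> x = m"
      using X' hull_inc[of x X'] by auto
    then show "x \<in> Y"
      using less by force
  qed
  then show ?thesis
    unfolding face using X'(2) sub eqY hull_mono[of X' Y convex] by blast
qed

lemma axis_endsI: "i \<in> S \<Longrightarrow> s = l i \<or> s = u i \<Longrightarrow> s *\<^sub>R axis i 1 \<in> axis_ends l u S"
  by (auto simp: axis_ends_def)

text \<open>On each axis the end that is not chosen lies on the other side of 0 or at 0, so its
  value under \<open>q\<close> is at most 0 and below \<open>m\<close>.\<close>

lemma max_face_axis_ends:
  fixes q :: "real ^ 'n::finite"
  assumes T: "T \<noteq> {}" and m: "0 < m" and c: "\<And>i. i \<in> T \<Longrightarrow> q $ i * c i = m"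
    "\<And>i. c i = l i \<or> c i = u i" and lu: "\<And>i. l i * u i \<le> 0"
  shows "max_face q (convex hull (axis_ends l u T)) = convex hull ((\<lambda>i. c i *\<^sub>R axis i 1) ` T)"
proof (rule max_face_convex_hull[where m = m])
  have inner: "q \<bullet> (s *\<^sub>R axis i 1) = q $ i * s" for s i
    by (simp add: inner_axis)
  show "finite (axis_ends l u T)"
    by (simp add: axis_ends_def)
  show "(\<lambda>i. c i *\<^sub>R axis i 1) ` T \<subseteq> axis_ends l u T"
    using c(2) by (intro image_subsetI axis_endsI) auto
  show "(\<lambda>i. c i *\<^sub>R axis i (1 :: real)) ` T \<noteq> {}"
    using T by simp
  show "q \<bullet> y = m" if y: "y \<in> (\<lambda>i. c i *\<^sub>R axis i 1) ` T" for y
  proof -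
    obtain i where "i \<in> T" "y = c i *\<^sub>R axis i 1"
      using y by blast
    then show ?thesis
      using c(1) by (simp only: inner)
  qed
  show "q \<bullet> x < m" if x: "x \<in> axis_ends l u T - (\<lambda>i. c i *\<^sub>R axis i 1) ` T" for x
  proof -
    obtain i s where i: "i \<in> T" "x = s *\<^sub>R axis i 1" "s = l i \<or> s = u i"
      using x by (auto simp: axis_ends_def)
    then have "s \<noteq> c i"
      using x by auto
    then have "s * c i = l i * u i"
      using i(3) c(2)[of i] by (auto simp: mult.commute)
    then have "s * c i \<le> 0"
      using lu by simp
    moreover have "0 < q $ i * c i"
      using c(1)[OF i(1)] m by simp
    ultimately have "q $ i * s \<le> 0"
      by (auto simp: mult_le_0_iff zero_less_mult_iff)
    then show ?thesis
      using m unfolding i(2) inner by simp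
  qed
qed

context mixed_volume
begin

text \<open>Translating the vertex on axis \<open>q\<close> of the first simplex to 0 makes both
  simplices images, under one injective linear map, of faces of the unit simplex in the
  complementary coordinate subspaces \<open>M\<close> and \<open>- M\<close>. There the coefficient
  is the volume of their sum.\<close>

lemma mixed_coeff_complementary_simplices_pos:
  fixes M :: "'n set" and c d :: "'n \<Rightarrow> real"
  assumes M: "card M = j" "0 < j" "j < CARD('n)" "q \<notin> M"
    and c: "\<And>i. i \<in> insert q M \<Longrightarrow> c i \<noteq> 0" and d: "\<And>i. i \<notin> M \<Longrightarrow> d i \<noteq> 0"
  shows "0 < mixed_coeff j (convex hull ((\<lambda>i. c i *\<^sub>R axis i 1) ` insert q M))
    (convex hull (insert 0 ((\<lambda>i. d i *\<^sub>R axis i 1) ` (- M))))"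
proof -
  let ?S = "unit_simplex :: (real ^ 'n) set"
  define f :: "real ^ 'n \<Rightarrow> real ^ 'n" where
    "f x = (\<Sum>i\<in>UNIV. x $ i *\<^sub>R (if i \<in> M then c i *\<^sub>R axis i 1 - c q *\<^sub>R axis q 1 else d i *\<^sub>R axis i 1))" for x
  have lin: "linear f"
    unfolding f_def by (intro linear_compose_sum ballI) (auto intro!: linearI simp: algebra_simps)
  have fax: "f (axis i 1) = (if i \<in> M then c i *\<^sub>R axis i 1 - c q *\<^sub>R axis q 1 else d i *\<^sub>R axis i 1)" for i
    unfolding f_def by (subst axis_def) (simp add: if_distrib[of "\<lambda>u. u *\<^sub>R _"] cong: if_cong)
  have "inj f"
    unfolding linear_injective_0[OF lin]
  proof (intro allI impI)
    fix x assume x: "f x = 0"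
    have comp: "f x $ k = (\<Sum>i\<in>UNIV. x $ i * (if i \<in> M then c i *\<^sub>R axis i 1 - c q *\<^sub>R axis q 1 else d i *\<^sub>R axis i 1) $ k)" for k
      unfolding f_def by simp
    have M0: "x $ k = 0" if "k \<in> M" for k
    proof -
      have "f x $ k = (\<Sum>i\<in>UNIV. if i = k then x $ k * c k else 0)"
        unfolding comp using that M(4) by (intro sum.cong) (auto simp: axis_def)
      then show ?thesis
        using x c[of k] that by simp
    qed
    have "x $ k = 0" if "k \<notin> M" for k
    proof -
      have "f x $ k = (\<Sum>i\<in>UNIV. if i = k then x $ k * d k else 0)"
        unfolding comp using that M0 by (intro sum.cong) (auto simp: axis_def)
      then show ?thesis
        using x d[of k] that by simp
    qed
    then show "x = 0"
      using M0 by (auto simp: vec_eq_iff)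
  qed
  obtain e where e: "0 \<le> e" "volume_factor f e"
    using linear_has_volume_factor[OF lin] by blast
  have epos: "0 < e"
    by (rule volume_factor_pos[OF e(2,1) lin \<open>inj f\<close>])
  have zax: "zero_coords T (axis i 1) = (if i \<in> T then 0 else axis i (1 :: real))" for T i
    by (auto simp: vec_eq_iff axis_def)
  have faceS: "zero_coords (- T) ` ?S = convex hull (insert 0 ((\<lambda>i. axis i 1) ` T))" if "T \<noteq> UNIV" for T
  proof -
    have "zero_coords (- T) ` insert 0 (range (\<lambda>i. axis i 1)) = insert 0 ((\<lambda>i. axis i (1 :: real)) ` T)"
      using that linear_0[OF linear_zero_coords] by (auto simp: zax image_image image_iff split: if_splits)
    then show ?thesis
      unfolding unit_simplex_def by (subst convex_hull_linear_image) simp_all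
  qed
  have "M \<noteq> {}"
    using M by auto
  then have M_ne: "M \<noteq> UNIV" "- M \<noteq> UNIV"
    using M by blast+
  have A: "convex hull ((\<lambda>i. c i *\<^sub>R axis i 1) ` insert q M) = (+) (c q *\<^sub>R axis q 1) ` f ` zero_coords (- M) ` ?S"
  proof -
    have "(+) (c q *\<^sub>R axis q 1) ` f ` insert 0 ((\<lambda>i. axis i 1) ` M) = (\<lambda>i. c i *\<^sub>R axis i 1) ` insert q M"
      using linear_0[OF lin] by (auto simp: fax image_image)
    then show ?thesis
      unfolding faceS[OF M_ne(1)] convex_hull_linear_image[OF lin] convex_hull_translation[symmetric] by simp
  qed
  have B: "convex hull (insert 0 ((\<lambda>i. d i *\<^sub>R axis i 1) ` (- M))) = (+) 0 ` f ` zero_coords M ` ?S"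
  proof -
    have "f ` insert 0 ((\<lambda>i. axis i 1) ` (- M)) = insert 0 ((\<lambda>i. d i *\<^sub>R axis i 1) ` (- M))"
      using linear_0[OF lin] by (simp add: fax image_image)
    then show ?thesis
      using faceS[OF M_ne(2)] by (simp add: convex_hull_linear_image[OF lin])
  qed
  note cc = coordinate_closed_unit_simplex
  have cb: "convex_body ?S" "convex_body (zero_coords T ` ?S)" for T
    using cc coordinate_closed_zero_coords coordinate_closedD(1) by blast+
  have "mixed_coeff j (convex hull ((\<lambda>i. c i *\<^sub>R axis i 1) ` insert q M))
      (convex hull (insert 0 ((\<lambda>i. d i *\<^sub>R axis i 1) ` (- M)))) =
      mixed_coeff j (f ` zero_coords (- M) ` ?S) (f ` zero_coords M ` ?S)"
    unfolding A B using cb lin M by (intro mixed_coeff_translation) (auto intro: convex_body_linear_image)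
  also have "\<dots> = e * mixed_coeff j (zero_coords (- M) ` ?S) (zero_coords M ` ?S)"
    using cb lin e M by (intro mixed_coeff_linear_image) auto
  also have "mixed_coeff j (zero_coords (- M) ` ?S) (zero_coords M ` ?S) = measure lebesgue (box_sum ?S ?S M 1 1)"
    using mixed_coeff_complementary[OF cb(1) cb(1), of j M] M by (simp add: box_sum_1)
  finally have val: "mixed_coeff j (convex hull ((\<lambda>i. c i *\<^sub>R axis i 1) ` insert q M))
      (convex hull (insert 0 ((\<lambda>i. d i *\<^sub>R axis i 1) ` (- M)))) = e * measure lebesgue (box_sum ?S ?S M 1 1)" .
  have "real (CARD('n) choose card M) * measure lebesgue ?S \<le> measure lebesgue (box_sum ?S ?S M 1 1)"
    using M cb coordinate_closed_zero_mem[OF cc] unit_simplex_subset_box_sums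
    by (intro volume_le_box_sum) auto
  moreover have "0 < measure lebesgue ?S"
  proof -
    have "(Basis :: (real ^ 'n) set) = range (\<lambda>i. axis i 1)"
      by (auto simp: Basis_vec_def)
    then have "measure lborel ?S = 1 / fact CARD('n)"
      using content_std_simplex[where ?'a = "real ^ 'n"] by (simp add: unit_simplex_def)
    moreover have "measure lborel ?S = measure lebesgue ?S"
      using cb(1) by (simp add: convex_body_def borel_compact)
    ultimately show ?thesis by simp
  qed
  ultimately have "0 < measure lebesgue (box_sum ?S ?S M 1 1)"
    using M by (smt (verit) mult_pos_pos of_nat_0_less_iff zero_less_binomial_iff less_imp_le)
  then show ?thesis
    unfolding val using epos by simp
qed

text \<open>The coordinates \<open>p\<close> and \<open>q\<close> are split last, and the surplus is
  used for one summand \<open>J0\<close> when \<open>p\<close> is split. At that stage both bodies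
  still extend in the axes \<open>p\<close> and \<open>q\<close>, in both directions; this leaves
  room for a slope whose faces are simplices of dimensions \<open>j\<close> and
  \<open>n - j\<close>.\<close>

lemma mixed_coeff_lt_of_two_sided:
  fixes K :: "(real ^ 'n) set"
  assumes K: "coordinate_closed K" and j: "0 < j" "j < CARD('n)"
    and lu: "\<And>i. l i \<le> 0" "\<And>i. 0 \<le> u i" "\<And>i. l i < u i"
    and hull: "\<And>S. S \<noteq> {} \<Longrightarrow> zero_coords (- S) ` K = convex hull (axis_ends l u S)"
    and p: "l p < 0" "0 < u p" and q: "l q < 0" "0 < u q" and pq: "p \<noteq> q"
  shows "mixed_coeff j K (uminus ` K) < (\<Sum>J | card J = j. measure lebesgue (box_sum K K J 1 1))"
proof -
  let ?K = "uminus ` K"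
  have mK: "coordinate_closed ?K"
    using K by (rule coordinate_closed_uminus)
  have cb: "convex_body K" "convex_body ?K"
    using K mK by (auto dest: coordinate_closedD)
  define G where "G S J = mixed_coeff j (zero_coords (S - J) ` K) (zero_coords J ` ?K)" for S J
  define S0 where "S0 = - {p, q}"
  have "j - 1 \<le> card S0"
    using j pq unfolding S0_def Compl_eq_Diff_UNIV by (simp add: card_Diff_subset)
  then obtain J0 where J0: "J0 \<subseteq> S0" "card J0 = j - 1"
    by (metis obtain_subset_with_card_n)
  define M where "M = insert p J0"
  have pJ: "p \<notin> J0" "q \<notin> J0" "q \<notin> M" "p \<in> M"
    using J0 pq by (auto simp: S0_def M_def)
  have M: "card M = j"
    using J0 pJ j by (simp add: M_def card_insert_if finite_subset[OF J0(1)])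
  define A where "A = zero_coords (S0 - J0) ` K"
  define B where "B = zero_coords J0 ` ?K"
  have cA: "coordinate_closed A" and cB: "coordinate_closed B"
    unfolding A_def B_def by (intro coordinate_closed_zero_coords K mK)+
  have S0J0: "S0 - J0 = - (insert q M)" "J0 = - (insert p (- M))"
    using J0 pJ by (auto simp: S0_def M_def)
  have A: "A = convex hull (axis_ends l u (insert q M))"
    unfolding A_def S0J0(1) by (intro hull) simp
  have B: "B = convex hull (axis_ends (\<lambda>i. - l i) (\<lambda>i. - u i) (insert p (- M)))"
  proof -
    have "B = uminus ` zero_coords J0 ` K"
      unfolding B_def by (simp add: image_image linear_neg)
    also have "\<dots> = uminus ` (convex hull (axis_ends l u (insert p (- M))))"
      using hull[of "insert p (- M)"] S0J0(2) by simp
    also have "\<dots> = convex hull (uminus ` axis_ends l u (insert p (- M)))"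
      by (rule convex_hull_linear_image) (auto intro!: linearI)
    also have "uminus ` axis_ends l u (insert p (- M)) = axis_ends (\<lambda>i. - l i) (\<lambda>i. - u i) (insert p (- M))"
      unfolding axis_ends_def image_UN by simp
    finally show ?thesis .
  qed
  \<comment> \<open>\<open>c i\<close> and \<open>d i\<close> are nonzero ends of \<open>K\<close>
    and \<open>- K\<close> on axis \<open>i\<close>, positive where possible; on the axes
    \<open>p\<close> and \<open>q\<close> all four are positive.\<close>
  define c where "c i = (if 0 < u i then u i else l i)" for i
  define d where "d i = (if l i < 0 then - l i else - u i)" for i
  have c0: "c i \<noteq> 0" and d0: "d i \<noteq> 0" for i
    using lu(1,2,3)[of i] by (auto simp: c_def d_def)
  \<comment> \<open>\<open>Q\<close> must be constant on the chosen ends of \<open>A\<close>, and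
    \<open>?W\<close> on those of \<open>B\<close>. As \<open>?W\<close> has \<open>p\<close>-th
    coordinate 1, its constant is \<open>d p\<close>, which fixes \<open>Q\<close> outside
    \<open>M\<close>. The shared axis \<open>q\<close> then dictates the constant
    \<open>\<eta>\<close> for \<open>A\<close>, and this fixes \<open>Q\<close> on
    \<open>M\<close>.\<close>
  define \<eta> where "\<eta> = d p / d q * c q"
  define Q where "Q = (\<chi> i. if i \<in> M then \<eta> / c i else d p / d i)"
  have "0 < d p" "0 < d q" "0 < c q" "0 < c p"
    using p q by (auto simp: c_def d_def)
  moreover from this have "0 < \<eta>"
    unfolding \<eta>_def by (intro mult_pos_pos divide_pos_pos)
  ultimately have pos: "0 < d p" "0 < d q" "0 < c q" "0 < c p" "0 < \<eta>"
    by blast+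
  have Qp: "0 < Q $ p"
    using pos pJ by (simp add: Q_def)
  have Qc: "Q $ i * c i = \<eta>" if "i \<in> insert q M" for i
    using that c0[of i] pJ by (auto simp: Q_def \<eta>_def)
  have lu_prod: "l i * u i \<le> 0" for i
    using lu(1,2)[of i] by (rule mult_nonpos_nonneg)
  have faceA: "max_face Q A = convex hull ((\<lambda>i. c i *\<^sub>R axis i 1) ` insert q M)"
    unfolding A by (rule max_face_axis_ends[OF _ pos(5) Qc _ lu_prod]) (auto simp: c_def)
  let ?W = "zero_coords {p} Q + axis p 1"
  have Wd: "?W $ i * d i = d p" if "i \<in> insert p (- M)" for i
    using that d0[of i] pJ by (auto simp: Q_def axis_def)
  have lu_prod': "(- l i) * (- u i) \<le> 0" for i
    using lu_prod[of i] by simp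
  have faceB: "max_face ?W B = convex hull ((\<lambda>i. d i *\<^sub>R axis i 1) ` insert p (- M))"
    unfolding B by (rule max_face_axis_ends[OF _ pos(1) Wd _ lu_prod']) (auto simp: d_def)
  have ZfaceB: "zero_coords {p} ` max_face ?W B = convex hull (insert 0 ((\<lambda>i. d i *\<^sub>R axis i 1) ` (- M)))"
  proof -
    have "zero_coords {p} (d i *\<^sub>R axis i 1) = (if i = p then 0 else d i *\<^sub>R axis i 1)" for i
      by (auto simp: vec_eq_iff axis_def)
    then have "zero_coords {p} ` (\<lambda>i. d i *\<^sub>R axis i 1) ` insert p (- M) = insert 0 ((\<lambda>i. d i *\<^sub>R axis i 1) ` (- M))"
      using pJ by (auto simp: image_image)
    then show ?thesis
      unfolding faceB by (simp add: convex_hull_linear_image)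
  qed
  have polyA: "polytope A" "A \<noteq> {}" and polyB: "polytope B" "B \<noteq> {}"
    using cA cB unfolding A B
    by (auto simp: axis_ends_def coordinate_closed_def convex_body_def intro!: polytope_convex_hull)
  have "mixed_coeff j A B + min 1 (Q $ p) * mixed_coeff j (max_face Q A) (zero_coords {p} ` max_face ?W B)
      \<le> mixed_coeff j A (zero_coords {p} ` B) + mixed_coeff j (zero_coords {p} ` A) B"
    using polyA polyB cA cB Qp j
    by (intro mixed_coeff_step_polytope) (auto dest: coordinate_closedD)
  moreover have "0 < mixed_coeff j (max_face Q A) (zero_coords {p} ` max_face ?W B)"
    unfolding faceA ZfaceB using M j pJ c0 d0
    by (intro mixed_coeff_complementary_simplices_pos) auto
  ultimately have "mixed_coeff j A B < mixed_coeff j A (zero_coords {p} ` B) + mixed_coeff j (zero_coords {p} ` A) B"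
    using Qp by (smt (verit) mult_pos_pos min_def)
  moreover have "insert p S0 - insert p J0 = S0 - J0" "{p} \<union> (S0 - J0) = insert p S0 - J0" "{p} \<union> J0 = insert p J0"
    using J0 pq by (auto simp: S0_def)
  ultimately have strict: "G S0 J0 < G (insert p S0) (insert p J0) + G (insert p S0) J0"
    unfolding A_def B_def G_def by (simp add: image_comp o_def)
  have step: "G S J \<le> G (insert r S) (insert r J) + G (insert r S) J" if "r \<notin> S" "J \<subseteq> S" for r S J
    unfolding G_def using mixed_coeff_Pow_step[OF K mK, of j] j that by simp
  have "mixed_coeff j K ?K \<le> (\<Sum>J\<in>Pow S0. G S0 J)"
    unfolding G_def using j by (intro mixed_coeff_le_sum_Pow K mK) simp
  also have "\<dots> < (\<Sum>J\<in>Pow S0. G (insert p S0) (insert p J) + G (insert p S0) J)"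
    using step[of p S0] strict J0 by (intro sum_strict_mono_ex1) (auto simp: S0_def)
  also have "\<dots> = (\<Sum>J\<in>Pow (insert p S0). G (insert p S0) J)"
    by (intro sum_Pow_insert[symmetric]) (auto simp: S0_def)
  also have "\<dots> \<le> (\<Sum>J\<in>Pow (insert p S0). G (insert q (insert p S0)) (insert q J) + G (insert q (insert p S0)) J)"
    using pq by (intro sum_mono step) (auto simp: S0_def)
  also have "\<dots> = (\<Sum>J\<in>Pow (insert q (insert p S0)). G (insert q (insert p S0)) J)"
    using pq by (intro sum_Pow_insert[symmetric]) (auto simp: S0_def)
  also have "insert q (insert p S0) = UNIV"
    by (auto simp: S0_def)
  also have "(\<Sum>J\<in>Pow UNIV. G UNIV J) = (\<Sum>J | card J = j. measure lebesgue (box_sum K K J 1 1))"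
  proof -
    have "G UNIV J = (if card J = j then measure lebesgue (box_sum K K J 1 1) else 0)" for J
      unfolding G_def using mixed_coeff_complementary[OF cb, of j J] j measure_complementary_uminus[of K J] cb(1)
      by (simp add: Compl_eq_Diff_UNIV convex_body_def)
    then show ?thesis
      by (simp add: sum.If_cases)
  qed
  finally show ?thesis .
qed

end

text \<open>For a body with empty interior both sides vanish, so every lower-dimensional simplex
  gives equality as well, and equality characterises simplices only among bodies with interior
  points.\<close>

theorem theorem1p1:
  fixes V :: "(real ^ 'n::finite) set list \<Rightarrow> real"
    and K :: "(real ^ 'n) set"
    and n j :: nat
  defines "n \<equiv> CARD('n)"
  assumes V: "is_mixed_volume V"
    and K: "locally_anti_blocking K"
    and j: "0 < j" "j < n"
  shows "V (replicate j K @ replicate (n - j) (uminus ` K))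
           \<le> real (n choose j) * measure lebesgue K \<and>
         ((\<exists>k. k simplex K) \<longrightarrow>
           V (replicate j K @ replicate (n - j) (uminus ` K))
             = real (n choose j) * measure lebesgue K) \<and>
         (interior K \<noteq> {} \<longrightarrow>
           V (replicate j K @ replicate (n - j) (uminus ` K))
             = real (n choose j) * measure lebesgue K \<longrightarrow>
           int n simplex K)"
proof -
  have j': "0 < j" "j < CARD('n)"
    using j by (simp_all add: n_def)
  interpret mixed_volume V
    using V j' by unfold_locales auto
  have cc: "coordinate_closed K"
    using K by (rule locally_anti_blocking_coordinate_closed)
  have cb: "convex_body K" "convex_body (uminus ` K)"
    using cc coordinate_closed_uminus by (auto dest: coordinate_closedD)
  let ?b = "real (n choose j)"
  note iff = godbersen_iff_mixed_coeff[OF j'(2), of K "uminus ` K" "?b * measure lebesgue K", folded n_def]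
  note le = mixed_coeff_uminus_le[OF cc j', folded n_def]
  have ineq: "mixed_coeff j K (uminus ` K) \<le> ?b * (?b * measure lebesgue K)"
    using le by linarith
  have simplex_eq: "mixed_coeff j K (uminus ` K) = ?b * (?b * measure lebesgue K)" if k: "k simplex K" for k
  proof (cases "k = int n")
    case True
    then show ?thesis
      using mixed_coeff_simplex[OF j'] k by (simp add: n_def)
  next
    case False
    then have "interior K = {}"
      using low_dim_interior[of K] aff_dim_simplex[OF k] by (simp add: n_def)
    then have "measure lebesgue K = 0"
      using cb(1) negligible_convex_interior[of K] by (simp add: convex_body_def negligible_imp_measure0)
    then show ?thesis
      using ineq mixed_coeff_nonneg[OF cb, of j] by simp
  qed
  have char: "int n simplex K"
    if int: "interior K \<noteq> {}" and eq: "mixed_coeff j K (uminus ` K) = ?b * (?b * measure lebesgue K)"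
  proof -
    obtain l u where lu: "\<And>i. l i \<le> 0" "\<And>i. 0 \<le> u i" "\<And>i. l i < u i"
      "\<And>S. S \<noteq> {} \<Longrightarrow> zero_coords (- S) ` K = convex hull (axis_ends l u S)"
      using equality_imp_convex_hull_axes[OF cc int j' eq[unfolded n_def]] by blast
    have two: False if "l p < 0" "0 < u p" "l q < 0" "0 < u q" "p \<noteq> q" for p q
      using mixed_coeff_lt_of_two_sided[OF cc j' lu that] le eq by simp
    have "\<exists>p. \<forall>i. i \<noteq> p \<longrightarrow> l i = 0 \<or> u i = 0"
    proof (rule ccontr)
      assume neg: "\<not> ?thesis"
      obtain p where p: "l p \<noteq> 0" "u p \<noteq> 0"
        using neg by blast
      obtain q where q: "q \<noteq> p" "l q \<noteq> 0" "u q \<noteq> 0"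
        using neg by blast
      show False
        using two[of p q] p q lu(1)[of p] lu(1)[of q] lu(2)[of p] lu(2)[of q] by simp
    qed
    then obtain p where p: "\<And>i. i \<noteq> p \<Longrightarrow> l i = 0 \<or> u i = 0"
      by blast
    have "K = convex hull (axis_ends l u UNIV)"
    proof -
      have "zero_coords (- UNIV) = (id :: real ^ 'n \<Rightarrow> _)"
        by (auto simp: vec_eq_iff)
      then show ?thesis
        using lu(4)[of UNIV] by simp
    qed
    then show ?thesis
      unfolding n_def by (rule one_sided_imp_simplex[OF int _ lu(1,2) p])
  qed
  show ?thesis
    unfolding iff using ineq simplex_eq char by blast
qed

end
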